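(* Let $E$ be a vector bundle over $M$. For $D_1\in\mathrm{Der}^n(E)$ and $D_2\in\mathrm{Der}^m(E)$ define the Matsushima--Nijenhuis bracket $$[D_1,D_2]_{\mathrm{MN}}=D_1\circ D_2-(-1)^{mn}D_2\circ D_1\in\mathrm{Der}^{m+n}(E),$$ where $$\begin{aligned} (D_1\circ D_2)&(u_1,\dots,u_{m+n+1})\\ ={}&\sum_{\sigma\in\mathbb{S}_{(m,1,n-1)}}(-1)^\sigma D_1\big(D_2(u_{\sigma(1)},\dots,u_{\sigma(m+1)}),u_{\sigma(m+2)},\dots,u_{\sigma(m+n)},u_{m+n+1}\big)\\ &+(-1)^{mn}\sum_{\sigma\in\mathbb{S}_{(n,m)}}(-1)^\sigma D_1\big(u_{\sigma(1)},\dots,u_{\sigma(n)},D_2(u_{\sigma(n+1)},\dots,u_{\sigma(m+n)},u_{m+n+1})\big). \end{aligned}$$ Then $(\mathrm{Der}^*(E),[\cdot,\cdot]_{\mathrm{MN}})$ is a graded Lie algebra. Furthermore, $\pi\in\mathrm{Der}^1(E)$ defines a left-symmetric algebroid structure on $E$ if and only if $[\pi,\pi]_{\mathrm{MN}}=0$, that is, $\pi$ is a Maurer--Cartan element of the graded Lie algebra $(\mathrm{Der}^*(E),[\cdot,\cdot]_{\mathrm{MN}})$.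
   Context: Vector bundles are smooth real vector bundles over a smooth manifold $M$. A multiderivation of degree $n\ge0$ on $E$ is an $\mathbb{R}$-multilinear map $D\in\mathrm{Hom}(\wedge^n\Gamma(E)\otimes\Gamma(E),\Gamma(E))$ (skew-symmetric in its first $n$ arguments) such that for $f\in C^\infty(M)$: $D$ is $C^\infty(M)$-linear in each of its first $n$ arguments, and $D(u_1,\dots,u_n,fu_{n+1})=fD(u_1,\dots,u_{n+1})+\sigma_D(u_1,\dots,u_n)(f)u_{n+1}$ for some $\sigma_D\in\Gamma(\mathrm{Hom}(\wedge^nE,TM))$, called the symbol of $D$. $\mathrm{Der}^n(E)$ is the space of these and $\mathrm{Der}^*(E)=\oplus_{n\ge0}\mathrm{Der}^n(E)$, with $\mathrm{Der}^n(E)$ in degree $n$. A left-symmetric algebroid $(\mathcal{A},\ast_{\mathcal{A}},a_{\mathcal{A}})$ is a vector bundle $\mathcal{A}\to M$ with an $\mathbb{R}$-bilinear product $\ast_{\mathcal{A}}$ on $\Gamma(\mathcal{A})$ satisfying $x\ast(y\ast z)-(x\ast y)\ast z=y\ast(x\ast z)-(y\ast x)\ast z$, and a bundle map $a_{\mathcal{A}}:\mathcal{A}\to TM$, such that $x\ast_{\mathcal{A}}(fy)=f(x\ast_{\mathcal{A}}y)+a_{\mathcal{A}}(x)(f)y$ and $(fx)\ast_{\mathcal{A}}y=f(x\ast_{\mathcal{A}}y)$. "$\pi$ defines a left-symmetric algebroid structure on $E$" means that $(E,\pi,\sigma_\pi)$ is a left-symmetric algebroid, i.e. $u\ast v=\pi(u,v)$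 with anchor $\sigma_\pi$. $\mathbb{S}_{(i_1,\dots,i_k)}$ is the set of unshuffles (permutations increasing on consecutive blocks of lengths $i_1,\dots,i_k$), $(-1)^\sigma$ is the sign, and a sum involving a block of length $-1$ is zero. A Maurer--Cartan element of a graded Lie algebra is a degree $1$ element $\theta$ with $[\theta,\theta]=0$. *)

theory Defs
  imports "HOL-Analysis.Analysis" "HOL-Library.Function_Algebras"
begin

section \<open>Pointwise real vector space structure on functions\<close>

instantiation "fun" :: (type, real_vector) real_vector
begin

definition scaleR_fun :: "real \<Rightarrow> ('a \<Rightarrow> 'b) \<Rightarrow> 'a \<Rightarrow> 'b" where
  "scaleR_fun r f = (\<lambda>x. r *\<^sub>R f x)"

instance
  by standard (auto simp: scaleR_fun_def plus_fun_def scaleR_add_right scaleR_add_left)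

end


section \<open>Smooth manifolds\<close>

text \<open>\<open>Ck_on k S f\<close> is meant for open \<open>S\<close> in a finite-dimensional space, where \<open>C\<^sup>k\<close> is the same as
  having continuous iterated directional derivatives of all orders up to \<open>k\<close>.\<close>

primrec Ck_on ::
  "nat \<Rightarrow> 'a::real_normed_vector set \<Rightarrow> ('a \<Rightarrow> 'b::real_normed_vector) \<Rightarrow> bool" where
  "Ck_on 0 S f \<longleftrightarrow> continuous_on S f"
| "Ck_on (Suc k) S f \<longleftrightarrow>
     (\<forall>x\<in>S. f differentiable (at x)) \<and> (\<forall>v. Ck_on k S (\<lambda>x. frechet_derivative f (at x) v))"

definition Cinf_on :: "'a::real_normed_vector set \<Rightarrow> ('a \<Rightarrow> 'b::real_normed_vector) \<Rightarrow> bool" where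
  "Cinf_on S f \<longleftrightarrow> (\<forall>k. Ck_on k S f)"

definition finite_dim :: "'a::real_vector itself \<Rightarrow> bool" where
  "finite_dim _ \<longleftrightarrow> (\<exists>B::'a set. finite B \<and> span B = UNIV)"

text \<open>The manifold is the whole type \<open>'m\<close>. Its model space \<open>'e\<close> is an arbitrary finite-dimensional real
  inner product space rather than a type of class \<^class>\<open>euclidean_space\<close>, because that class excludes
  dimension 0, that is, the case where \<open>M\<close> is a discrete set of points.\<close>

type_synonym ('m, 'e) chart = "'m set \<times> ('m \<Rightarrow> 'e)"

definition smooth_manifold ::
  "('m::{t2_space,second_countable_topology}, 'e::real_inner) chart set \<Rightarrow> bool" where
  "smooth_manifold A \<longleftrightarrow>
     finite_dim TYPE('e) \<and>
     (\<Union>(U, \<phi>)\<in>A. U) = UNIV \<and>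
     (\<forall>(U, \<phi>)\<in>A. open U \<and> open (\<phi> ` U) \<and> homeomorphism U (\<phi> ` U) \<phi> (inv_into U \<phi>)) \<and>
     (\<forall>(U, \<phi>)\<in>A. \<forall>(V, \<psi>)\<in>A. Cinf_on (\<phi> ` (U \<inter> V)) (\<psi> \<circ> inv_into U \<phi>))"

definition smooth_map_on ::
  "('m::topological_space, 'e::real_inner) chart set \<Rightarrow> 'm set \<Rightarrow> ('m \<Rightarrow> 'b::real_normed_vector) \<Rightarrow> bool"
  where
  "smooth_map_on A W f \<longleftrightarrow> (\<forall>(U, \<phi>)\<in>A. Cinf_on (\<phi> ` (U \<inter> W)) (f \<circ> inv_into U \<phi>))"

definition smooth_funs :: "('m::topological_space, 'e::real_inner) chart set \<Rightarrow> ('m \<Rightarrow> real) set" where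
  "smooth_funs A = {f. smooth_map_on A UNIV f}"

text \<open>Tangent vectors at \<open>p\<close> are derivations \<open>C\<^sup>\<infinity>(M) \<rightarrow> \<real>\<close> at \<open>p\<close>. They are set to 0 outside
  \<open>C\<^sup>\<infinity>(M)\<close>, so that equality in \<open>T\<^sub>pM\<close> is equality of HOL functions.\<close>

definition tangent_space ::
  "('m::topological_space, 'e::real_inner) chart set \<Rightarrow> 'm \<Rightarrow> (('m \<Rightarrow> real) \<Rightarrow> real) set" where
  "tangent_space A p =
     {X. (\<forall>f. f \<notin> smooth_funs A \<longrightarrow> X f = 0) \<and>
         (\<forall>f\<in>smooth_funs A. \<forall>g\<in>smooth_funs A. \<forall>a b. X (a *\<^sub>R f + b *\<^sub>R g) = a * X f + b * X g) \<and>
         (\<forall>f\<in>smooth_funs A. \<forall>g\<in>smooth_funs A. X (f * g) = X f * g p + f p * X g)}"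

definition smooth_vector_field_on ::
  "('m::topological_space, 'e::real_inner) chart set \<Rightarrow> 'm set \<Rightarrow> ('m \<Rightarrow> ('m \<Rightarrow> real) \<Rightarrow> real) \<Rightarrow> bool"
  where
  "smooth_vector_field_on A W X \<longleftrightarrow>
     (\<forall>x\<in>W. X x \<in> tangent_space A x) \<and>
     (\<forall>f\<in>smooth_funs A. smooth_map_on A W (\<lambda>x. X x f))"


section \<open>Smooth vector bundles\<close>

text \<open>A vector bundle over \<open>M\<close> is given by its fibres \<open>E x\<close>, which are subspaces of some real vector space
  \<open>'v\<close> that plays no further role (any family of vector spaces embeds in such a way, e.g. into its direct
  sum), and by a set \<open>T\<close> of local trivializations \<open>(U, \<Phi>)\<close>. Here \<open>\<Phi> x\<close> is a linear isomorphism from \<open>E x\<close>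
  onto the finite-dimensional model fibre \<open>'f\<close> for \<open>x \<in> U\<close>, and the transition functions
  \<open>U \<inter> V \<rightarrow> GL('f)\<close> are smooth. These data determine the topology and the smooth structure of the total
  space. Rank 0 is allowed.\<close>

type_synonym ('m, 'v, 'f) trivialization = "'m set \<times> ('m \<Rightarrow> 'v \<Rightarrow> 'f)"

definition vector_bundle ::
  "('m::topological_space, 'e::real_inner) chart set \<Rightarrow> ('m \<Rightarrow> 'v::real_vector set) \<Rightarrow>
   ('m, 'v, 'f::real_inner) trivialization set \<Rightarrow> bool" where
  "vector_bundle A E T \<longleftrightarrow>
     finite_dim TYPE('f) \<and>
     (\<forall>x. subspace (E x)) \<and>
     (\<Union>(U, \<Phi>)\<in>T. U) = UNIV \<and>
     (\<forall>(U, \<Phi>)\<in>T. open U \<and>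
        (\<forall>x\<in>U. bij_betw (\<Phi> x) (E x) UNIV \<and>
           (\<forall>v\<in>E x. \<forall>w\<in>E x. \<forall>a b. \<Phi> x (a *\<^sub>R v + b *\<^sub>R w) = a *\<^sub>R \<Phi> x v + b *\<^sub>R \<Phi> x w))) \<and>
     (\<forall>(U, \<Phi>)\<in>T. \<forall>(V, \<Psi>)\<in>T. \<forall>w.
        smooth_map_on A (U \<inter> V) (\<lambda>x. \<Psi> x (inv_into (E x) (\<Phi> x) w)))"

definition smooth_section_on ::
  "('m::topological_space, 'e::real_inner) chart set \<Rightarrow> ('m \<Rightarrow> 'v::real_vector set) \<Rightarrow>
   ('m, 'v, 'f::real_inner) trivialization set \<Rightarrow> 'm set \<Rightarrow> ('m \<Rightarrow> 'v) \<Rightarrow> bool" where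
  "smooth_section_on A E T W u \<longleftrightarrow>
     (\<forall>x\<in>W. u x \<in> E x) \<and> (\<forall>(U, \<Phi>)\<in>T. smooth_map_on A (U \<inter> W) (\<lambda>x. \<Phi> x (u x)))"

definition sections ::
  "('m::topological_space, 'e::real_inner) chart set \<Rightarrow> ('m \<Rightarrow> 'v::real_vector set) \<Rightarrow>
   ('m, 'v, 'f::real_inner) trivialization set \<Rightarrow> ('m \<Rightarrow> 'v) set" where
  "sections A E T = {u. smooth_section_on A E T UNIV u}"

definition fscale :: "('m \<Rightarrow> real) \<Rightarrow> ('m \<Rightarrow> 'v::real_vector) \<Rightarrow> 'm \<Rightarrow> 'v" (infixr "\<odot>" 75) where
  "f \<odot> u = (\<lambda>x. f x *\<^sub>R u x)"


section \<open>Multiderivations\<close>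

text \<open>An \<open>n\<close>-ary map is a function on lists, of which only the values on \<open>args S n\<close> matter.\<close>

definition args :: "'a set \<Rightarrow> nat \<Rightarrow> 'a list set" where
  "args S n = {us. length us = n \<and> set us \<subseteq> S}"

definition multilinear_on ::
  "'a::real_vector set \<Rightarrow> nat \<Rightarrow> ('a list \<Rightarrow> 'b::real_vector) \<Rightarrow> bool" where
  "multilinear_on S n F \<longleftrightarrow>
     (\<forall>us\<in>args S n. \<forall>i<n. \<forall>v\<in>S. \<forall>w\<in>S. \<forall>a b.
        F (us[i := a *\<^sub>R v + b *\<^sub>R w]) = a *\<^sub>R F (us[i := v]) + b *\<^sub>R F (us[i := w]))"

text \<open>\<open>F\<close> has \<open>n\<close> arguments and is skew-symmetric in the first \<open>k\<close> of them.\<close>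

definition skew_on :: "'a set \<Rightarrow> nat \<Rightarrow> nat \<Rightarrow> ('a list \<Rightarrow> 'b::real_vector) \<Rightarrow> bool" where
  "skew_on S n k F \<longleftrightarrow>
     (\<forall>us\<in>args S n. \<forall>i<k. \<forall>j<k. i \<noteq> j \<longrightarrow> F (us[i := us ! j, j := us ! i]) = - F us)"

text \<open>\<open>\<Gamma>(Hom(\<Lambda>\<^sup>nE, TM))\<close>. Smoothness of the fibrewise maps \<open>\<sigma> x\<close> is tested on all local smooth sections
  of \<open>E\<close>, in particular on local frames.\<close>

definition wedge_hom_sections ::
  "('m::topological_space, 'e::real_inner) chart set \<Rightarrow> ('m \<Rightarrow> 'v::real_vector set) \<Rightarrow>
   ('m, 'v, 'f::real_inner) trivialization set \<Rightarrow> nat \<Rightarrow>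
   ('m \<Rightarrow> 'v list \<Rightarrow> ('m \<Rightarrow> real) \<Rightarrow> real) set" where
  "wedge_hom_sections A E T n =
     {\<sigma>. (\<forall>x. \<forall>vs\<in>args (E x) n. \<sigma> x vs \<in> tangent_space A x) \<and>
          (\<forall>x. multilinear_on (E x) n (\<sigma> x) \<and> skew_on (E x) n n (\<sigma> x)) \<and>
          (\<forall>W. open W \<longrightarrow> (\<forall>us\<in>args {u. smooth_section_on A E T W u} n.
             smooth_vector_field_on A W (\<lambda>x. \<sigma> x (map (\<lambda>u. u x) us))))}"

definition is_symbol ::
  "('m::topological_space, 'e::real_inner) chart set \<Rightarrow> ('m \<Rightarrow> 'v::real_vector set) \<Rightarrow>
   ('m, 'v, 'f::real_inner) trivialization set \<Rightarrow> nat \<Rightarrow>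
   (('m \<Rightarrow> 'v) list \<Rightarrow> 'm \<Rightarrow> 'v) \<Rightarrow> ('m \<Rightarrow> 'v list \<Rightarrow> ('m \<Rightarrow> real) \<Rightarrow> real) \<Rightarrow> bool" where
  "is_symbol A E T n D \<sigma> \<longleftrightarrow>
     \<sigma> \<in> wedge_hom_sections A E T n \<and>
     (\<forall>us\<in>args (sections A E T) n. \<forall>u\<in>sections A E T. \<forall>f\<in>smooth_funs A.
        D (us @ [f \<odot> u]) = f \<odot> D (us @ [u]) + (\<lambda>x. \<sigma> x (map (\<lambda>u. u x) us) f) \<odot> u)"

text \<open>\<open>Der\<^sup>n(E)\<close>. Multiderivations are set to 0 outside their domain \<open>\<Gamma>(E)\<^sup>n\<^sup>+\<^sup>1\<close>, so that they form a linear
  subspace of a function space.\<close>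

definition Der ::
  "('m::topological_space, 'e::real_inner) chart set \<Rightarrow> ('m \<Rightarrow> 'v::real_vector set) \<Rightarrow>
   ('m, 'v, 'f::real_inner) trivialization set \<Rightarrow> nat \<Rightarrow> (('m \<Rightarrow> 'v) list \<Rightarrow> 'm \<Rightarrow> 'v) set" where
  "Der A E T n =
     {D. (\<forall>us\<in>args (sections A E T) (n + 1). D us \<in> sections A E T) \<and>
         (\<forall>us. us \<notin> args (sections A E T) (n + 1) \<longrightarrow> D us = 0) \<and>
         multilinear_on (sections A E T) (n + 1) D \<and>
         skew_on (sections A E T) (n + 1) n D \<and>
         (\<forall>us\<in>args (sections A E T) (n + 1). \<forall>i<n. \<forall>f\<in>smooth_funs A.
            D (us[i := f \<odot> us ! i]) = f \<odot> D us) \<and>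
         (\<exists>\<sigma>. is_symbol A E T n D \<sigma>)}"


section \<open>The Matsushima--Nijenhuis bracket\<close>

text \<open>Permutations of \<open>{0, 1, ...}\<close> that are increasing on consecutive blocks of the given lengths.\<close>

definition unshuffles :: "nat list \<Rightarrow> (nat \<Rightarrow> nat) set" where
  "unshuffles ks =
     {\<sigma>. \<sigma> permutes {..<sum_list ks} \<and>
          (\<forall>j<length ks. strict_mono_on {sum_list (take j ks)..<sum_list (take (Suc j) ks)} \<sigma>)}"

text \<open>\<open>D1 \<circ> D2\<close> for \<open>D1 \<in> Der\<^sup>n(E)\<close> and \<open>D2 \<in> Der\<^sup>m(E)\<close>, where \<open>S = \<Gamma>(E)\<close>. Arguments are indexed from 0: the
  list \<open>w \<sigma> i j\<close> is \<open>u\<^bsub>\<sigma>(i+1)\<^esub>, \<dots>, u\<^bsub>\<sigma>(j)\<^esub>\<close> in the usual indexing from 1. For \<open>n = 0\<close> the first sum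
  involves a block of length \<open>-1\<close> and is therefore zero.\<close>

definition mn_comp ::
  "'s::real_vector set \<Rightarrow> nat \<Rightarrow> nat \<Rightarrow> ('s list \<Rightarrow> 's) \<Rightarrow> ('s list \<Rightarrow> 's) \<Rightarrow> 's list \<Rightarrow> 's" where
  "mn_comp S n m D1 D2 us =
     (let w = (\<lambda>\<sigma> i j. map (\<lambda>k. us ! \<sigma> k) [i..<j]); ulast = us ! (m + n)
      in if us \<notin> args S (m + n + 1) then 0
         else (if n = 0 then 0
               else \<Sum>\<sigma>\<in>unshuffles [m, 1, n - 1]. of_int (sign \<sigma>) *\<^sub>R
                      D1 (D2 (w \<sigma> 0 (m + 1)) # w \<sigma> (m + 1) (m + n) @ [ulast]))
            + (-1) ^ (m * n) *\<^sub>R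
              (\<Sum>\<sigma>\<in>unshuffles [n, m]. of_int (sign \<sigma>) *\<^sub>R
                 D1 (w \<sigma> 0 n @ [D2 (w \<sigma> n (m + n) @ [ulast])])))"

definition mn_bracket ::
  "'s::real_vector set \<Rightarrow> nat \<Rightarrow> nat \<Rightarrow> ('s list \<Rightarrow> 's) \<Rightarrow> ('s list \<Rightarrow> 's) \<Rightarrow> 's list \<Rightarrow> 's" where
  "mn_bracket S n m D1 D2 = mn_comp S n m D1 D2 - (-1) ^ (m * n) *\<^sub>R mn_comp S m n D2 D1"


section \<open>Graded Lie algebras and Maurer--Cartan elements\<close>

text \<open>A graded vector space concentrated in degrees \<open>n \<ge> 0\<close> is the family of its homogeneous components
  \<open>V n\<close>, and \<open>br m n\<close> is the bracket on \<open>V m \<times> V n\<close>.\<close>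

definition graded_lie_algebra ::
  "(nat \<Rightarrow> 'a::real_vector set) \<Rightarrow> (nat \<Rightarrow> nat \<Rightarrow> 'a \<Rightarrow> 'a \<Rightarrow> 'a) \<Rightarrow> bool" where
  "graded_lie_algebra V br \<longleftrightarrow>
     (\<forall>n. subspace (V n)) \<and>
     (\<forall>m n. \<forall>x\<in>V m. \<forall>y\<in>V n. br m n x y \<in> V (m + n)) \<and>
     (\<forall>m n. \<forall>x\<in>V m. \<forall>x'\<in>V m. \<forall>y\<in>V n. \<forall>a b.
        br m n (a *\<^sub>R x + b *\<^sub>R x') y = a *\<^sub>R br m n x y + b *\<^sub>R br m n x' y) \<and>
     (\<forall>m n. \<forall>x\<in>V m. \<forall>y\<in>V n. \<forall>y'\<in>V n. \<forall>a b.
        br m n x (a *\<^sub>R y + b *\<^sub>R y') = a *\<^sub>R br m n x y + b *\<^sub>R br m n x y') \<and>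
     (\<forall>m n. \<forall>x\<in>V m. \<forall>y\<in>V n. br m n x y = - ((-1) ^ (m * n) *\<^sub>R br n m y x)) \<and>
     (\<forall>m n p. \<forall>x\<in>V m. \<forall>y\<in>V n. \<forall>z\<in>V p.
        br m (n + p) x (br n p y z) =
          br (m + n) p (br m n x y) z + (-1) ^ (m * n) *\<^sub>R br n (m + p) y (br m p x z))"

definition maurer_cartan ::
  "(nat \<Rightarrow> 'a::real_vector set) \<Rightarrow> (nat \<Rightarrow> nat \<Rightarrow> 'a \<Rightarrow> 'a \<Rightarrow> 'a) \<Rightarrow> 'a \<Rightarrow> bool" where
  "maurer_cartan V br \<theta> \<longleftrightarrow> \<theta> \<in> V 1 \<and> br 1 1 \<theta> \<theta> = 0"


section \<open>Left-symmetric algebroids\<close>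

definition bundle_map_to_tangent ::
  "('m::topological_space, 'e::real_inner) chart set \<Rightarrow> ('m \<Rightarrow> 'v::real_vector set) \<Rightarrow>
   ('m, 'v, 'f::real_inner) trivialization set \<Rightarrow> ('m \<Rightarrow> 'v \<Rightarrow> ('m \<Rightarrow> real) \<Rightarrow> real) \<Rightarrow> bool" where
  "bundle_map_to_tangent A E T a \<longleftrightarrow>
     (\<forall>x. \<forall>v\<in>E x. a x v \<in> tangent_space A x) \<and>
     (\<forall>x. \<forall>v\<in>E x. \<forall>w\<in>E x. \<forall>r s. a x (r *\<^sub>R v + s *\<^sub>R w) = r *\<^sub>R a x v + s *\<^sub>R a x w) \<and>
     (\<forall>W u. open W \<longrightarrow> smooth_section_on A E T W u \<longrightarrow> smooth_vector_field_on A W (\<lambda>x. a x (u x)))"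

definition left_symmetric_algebroid ::
  "('m::topological_space, 'e::real_inner) chart set \<Rightarrow> ('m \<Rightarrow> 'v::real_vector set) \<Rightarrow>
   ('m, 'v, 'f::real_inner) trivialization set \<Rightarrow>
   (('m \<Rightarrow> 'v) \<Rightarrow> ('m \<Rightarrow> 'v) \<Rightarrow> 'm \<Rightarrow> 'v) \<Rightarrow> ('m \<Rightarrow> 'v \<Rightarrow> ('m \<Rightarrow> real) \<Rightarrow> real) \<Rightarrow> bool" where
  "left_symmetric_algebroid A E T pr a \<longleftrightarrow>
     vector_bundle A E T \<and>
     (\<forall>x\<in>sections A E T. \<forall>y\<in>sections A E T. pr x y \<in> sections A E T) \<and>
     (\<forall>x\<in>sections A E T. \<forall>y\<in>sections A E T. \<forall>z\<in>sections A E T. \<forall>r s.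
        pr (r *\<^sub>R x + s *\<^sub>R y) z = r *\<^sub>R pr x z + s *\<^sub>R pr y z \<and>
        pr z (r *\<^sub>R x + s *\<^sub>R y) = r *\<^sub>R pr z x + s *\<^sub>R pr z y) \<and>
     (\<forall>x\<in>sections A E T. \<forall>y\<in>sections A E T. \<forall>z\<in>sections A E T.
        pr x (pr y z) - pr (pr x y) z = pr y (pr x z) - pr (pr y x) z) \<and>
     bundle_map_to_tangent A E T a \<and>
     (\<forall>x\<in>sections A E T. \<forall>y\<in>sections A E T. \<forall>f\<in>smooth_funs A.
        pr x (f \<odot> y) = f \<odot> pr x y + (\<lambda>p. a p (x p) f) \<odot> y \<and>
        pr (f \<odot> x) y = f \<odot> pr x y)"

end

theory Submission
  imports Defs
begin

text \<open>
  Let \<open>S = \<Gamma>(E)\<close>. For \<open>F \<in> Der\<^sup>n(E)\<close> write \<open>F\<^sub>y(u\<^sub>1, \<dots>, u\<^sub>n) = F(u\<^sub>1, \<dots>, u\<^sub>n, y)\<close> and let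
  \<open>X\<^sub>F = F \<and> id\<close> be the alternation of \<open>F\<close> over all of its \<open>n + 1\<close> arguments. With the insertion operator
  \<open>i\<close> of Nijenhuis and Richardson, the composition of the statement is
  \<open>(F \<circ> G)\<^sub>y = i(X\<^sub>G) F\<^sub>y + (-1)\<^bsup>mn\<^esup> F \<and> G\<^sub>y\<close>. Hence \<open>[F, G]\<^sub>y = (-1)\<^bsup>mn\<^esup> L\<^sub>F G\<^sub>y - L\<^sub>G F\<^sub>y\<close>, where
  \<open>L\<^sub>F \<beta> = F \<and> \<beta> - i(X\<^sub>F) \<beta>\<close> acts on alternating \<open>S\<close>-valued forms. Since \<open>i\<close> is a graded derivation of
  \<open>\<and>\<close>, since \<open>i(Y) i(Z) - i(i(Y) Z)\<close> is graded symmetric in \<open>Y\<close> and \<open>Z\<close>, and since \<open>L\<^sub>F id = 0\<close>, one gets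
  \<open>L\<^bsub>[F, G]\<^esub> = (-1)\<^bsup>mn\<^esup> L\<^sub>F L\<^sub>G - L\<^sub>G L\<^sub>F\<close>; the graded Jacobi identity is then immediate.
  The symbol of \<open>[F, G]\<close> is the same expression with \<open>F\<^sub>y\<close>, \<open>G\<^sub>y\<close> replaced by the symbols. It is a priori
  defined on global sections only; bump functions and local frames turn it into a bundle map. For \<open>\<pi>\<close> of
  degree 1, \<open>[\<pi>, \<pi>]\<close> is \<open>-2\<close> times the antisymmetrized associator.
\<close>

section \<open>Wedge products and insertions of forms\<close>

text \<open>In degree 1 the operators L are those of a connection. Write a*b for
  \<open>\<pi> [a, b]\<close>; then X(a, b) = a*b - b*a, and on 1-forms L sends \<beta> to
  a*\<beta>(b) - b*\<beta>(a) - \<beta>(X(a, b)), the exterior covariant derivative with X in place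
  of the Lie bracket. L id = 0 says that the torsion vanishes, and L applied to the form b \<mapsto>
  b*y is the curvature acting on y. In all degrees L id = 0 has a second use: applying the rule for
  [F, G] \<and> \<beta> to the identity computes the field X of the bracket. The obstacle is the
  signs. Forms are functions on lists of every length, so that fixing the first argument yields a
  form of the same kind. Each identity then follows by induction on the argument list: the head goes
  to one of the factors, and each resulting term is an instance of the induction hypothesis. For the
  derivation rule and the symmetry of insertions, degrees matter only at the empty list, and there
  only modulo 2. Permutations occur in one place only, where sums over unshuffles are matched with
  these recursions.\<close>

text \<open>The signed sums over unshuffles are defined by recursion on the first argument, which lies at the
  beginning of one of the two blocks. The index \<open>k\<close> stands for the degree of the first factor and matters
  modulo 2 only, so it may go up where the degree goes down. The recursion for \<open>insertion\<close> is the sum over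
  unshuffles only if \<open>\<beta>\<close> is alternating: \<open>\<beta>(Y, a, \<dots>)\<close> has been replaced by \<open>-\<beta>(a, Y, \<dots>)\<close>.\<close>

primrec wedge :: "nat \<Rightarrow> ('s list \<Rightarrow> 'z \<Rightarrow> 'b) \<Rightarrow> ('s list \<Rightarrow> 'z) \<Rightarrow> 's list \<Rightarrow> 'b::real_vector" where
  wedge_Nil: "wedge k F \<beta> [] = F [] (\<beta> [])"
| wedge_Cons: "wedge k F \<beta> (a # us) =
     wedge (Suc k) (\<lambda>vs. F (a # vs)) \<beta> us + (-1) ^ k *\<^sub>R wedge k F (\<lambda>vs. \<beta> (a # vs)) us"

primrec insertion :: "nat \<Rightarrow> ('s list \<Rightarrow> 's) \<Rightarrow> ('s list \<Rightarrow> 'b) \<Rightarrow> 's list \<Rightarrow> 'b::real_vector" where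
  insertion_Nil: "insertion k Y \<beta> [] = \<beta> [Y []]"
| insertion_Cons: "insertion k Y \<beta> (a # us) =
     insertion (Suc k) (\<lambda>vs. Y (a # vs)) \<beta> us - (-1) ^ k *\<^sub>R insertion k Y (\<lambda>vs. \<beta> (a # vs)) us"

text \<open>No arity is fixed and lists of every length are tested, so fixing the first argument of
  a form gives a form over the same \<open>S\<close>. The degree is recorded separately by
  \<open>supported\<close>.\<close>

definition mlinear :: "'s::real_vector set \<Rightarrow> 'b::real_vector set \<Rightarrow> ('s list \<Rightarrow> 'b) \<Rightarrow> bool" where
  "mlinear S Z \<beta> \<longleftrightarrow> (\<forall>us. set us \<subseteq> S \<longrightarrow> \<beta> us \<in> Z) \<and>
     (\<forall>xs ys. set xs \<subseteq> S \<longrightarrow> set ys \<subseteq> S \<longrightarrow> (\<forall>v\<in>S. \<forall>w\<in>S. \<forall>a b.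
        \<beta> (xs @ (a *\<^sub>R v + b *\<^sub>R w) # ys) = a *\<^sub>R \<beta> (xs @ v # ys) + b *\<^sub>R \<beta> (xs @ w # ys)))"

text \<open>Adjacent transpositions generate all permutations and are what an induction on the list
  can handle directly. Arbitrary exchanges are recovered in \<open>skewf_swap\<close>.\<close>

definition skewf :: "'s set \<Rightarrow> ('s list \<Rightarrow> 'b::real_vector) \<Rightarrow> bool" where
  "skewf S \<beta> \<longleftrightarrow> (\<forall>xs ys. set xs \<subseteq> S \<longrightarrow> set ys \<subseteq> S \<longrightarrow> (\<forall>v\<in>S. \<forall>w\<in>S.
     \<beta> (xs @ v # w # ys) = - \<beta> (xs @ w # v # ys)))"

definition linear_op :: "'s set \<Rightarrow> 'z::real_vector set \<Rightarrow> ('s list \<Rightarrow> 'z \<Rightarrow> 'z) \<Rightarrow> bool" where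
  "linear_op S Z F \<longleftrightarrow> (\<forall>xs. set xs \<subseteq> S \<longrightarrow> (\<forall>z\<in>Z. F xs z \<in> Z) \<and>
     (\<forall>z\<in>Z. \<forall>z'\<in>Z. \<forall>a b. F xs (a *\<^sub>R z + b *\<^sub>R z') = a *\<^sub>R F xs z + b *\<^sub>R F xs z'))"

text \<open>A predicate on lengths instead of a number covers the exact degree, the parity that
  decides signs and, with the false predicate, vanishing.\<close>

definition supported :: "'s set \<Rightarrow> (nat \<Rightarrow> bool) \<Rightarrow> ('s list \<Rightarrow> 'b::zero) \<Rightarrow> bool" where
  "supported S P \<beta> \<longleftrightarrow> (\<forall>us. set us \<subseteq> S \<longrightarrow> \<beta> us \<noteq> 0 \<longrightarrow> P (length us))"

abbreviation parity_supported :: "'s set \<Rightarrow> nat \<Rightarrow> ('s list \<Rightarrow> 'b::zero) \<Rightarrow> bool" where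
  "parity_supported S k \<equiv> supported S (\<lambda>i. even (i + k))"

definition id_form :: "'s list \<Rightarrow> 's::zero" where
  "id_form us = (case us of [u] \<Rightarrow> u | _ \<Rightarrow> 0)"

lemma id_form_simps [simp]: "id_form [] = 0" "id_form [u] = u" "id_form (u # v # us) = 0"
  by (simp_all add: id_form_def)

lemma mlinear_in: "mlinear S Z \<beta> \<Longrightarrow> set us \<subseteq> S \<Longrightarrow> \<beta> us \<in> Z"
  by (simp add: mlinear_def)

lemma mlinear_lin: "mlinear S Z \<beta> \<Longrightarrow> set xs \<subseteq> S \<Longrightarrow> set ys \<subseteq> S \<Longrightarrow> v \<in> S \<Longrightarrow> w \<in> S \<Longrightarrow>
    \<beta> (xs @ (a *\<^sub>R v + b *\<^sub>R w) # ys) = a *\<^sub>R \<beta> (xs @ v # ys) + b *\<^sub>R \<beta> (xs @ w # ys)"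
  by (simp add: mlinear_def)

lemma mlinear_lin_hd: "mlinear S Z \<beta> \<Longrightarrow> set ys \<subseteq> S \<Longrightarrow> v \<in> S \<Longrightarrow> w \<in> S \<Longrightarrow>
    \<beta> ((a *\<^sub>R v + b *\<^sub>R w) # ys) = a *\<^sub>R \<beta> (v # ys) + b *\<^sub>R \<beta> (w # ys)"
  using mlinear_lin[of S Z \<beta> "[]"] by simp

lemma mlinear_scale_hd: "mlinear S Z \<beta> \<Longrightarrow> set ys \<subseteq> S \<Longrightarrow> v \<in> S \<Longrightarrow>
    \<beta> ((a *\<^sub>R v) # ys) = a *\<^sub>R \<beta> (v # ys)"
  using mlinear_lin_hd[of S Z \<beta> ys v v a 0] by simp

lemma mlinear_zero_hd: "mlinear S Z \<beta> \<Longrightarrow> set ys \<subseteq> S \<Longrightarrow> 0 \<in> S \<Longrightarrow> \<beta> (0 # ys) = 0"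
  using mlinear_scale_hd[of S Z \<beta> ys 0 0] by simp

lemma mlinear_Cons: "mlinear S Z \<beta> \<Longrightarrow> a \<in> S \<Longrightarrow> mlinear S Z (\<lambda>vs. \<beta> (a # vs))"
  unfolding mlinear_def by (metis append_Cons insert_subset list.simps(15))

lemma skewf_Cons: "skewf S \<beta> \<Longrightarrow> a \<in> S \<Longrightarrow> skewf S (\<lambda>vs. \<beta> (a # vs))"
  unfolding skewf_def by (metis append_Cons insert_subset list.simps(15))

lemma skewf_hd: "skewf S \<beta> \<Longrightarrow> v \<in> S \<Longrightarrow> w \<in> S \<Longrightarrow> set ys \<subseteq> S \<Longrightarrow>
    \<beta> (v # w # ys) = - \<beta> (w # v # ys)"
  unfolding skewf_def by (metis append_Nil empty_set empty_subsetI)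

lemma linear_op_Cons: "linear_op S Z F \<Longrightarrow> a \<in> S \<Longrightarrow> linear_op S Z (\<lambda>vs. F (a # vs))"
  unfolding linear_op_def by auto

lemma linear_op_in: "linear_op S Z F \<Longrightarrow> set xs \<subseteq> S \<Longrightarrow> z \<in> Z \<Longrightarrow> F xs z \<in> Z"
  by (simp add: linear_op_def)

lemma linear_op_lin: "linear_op S Z F \<Longrightarrow> set xs \<subseteq> S \<Longrightarrow> z \<in> Z \<Longrightarrow> z' \<in> Z \<Longrightarrow>
   F xs (a *\<^sub>R z + b *\<^sub>R z') = a *\<^sub>R F xs z + b *\<^sub>R F xs z'"
  by (simp add: linear_op_def)

lemma linear_op_zero: "linear_op S Z F \<Longrightarrow> set xs \<subseteq> S \<Longrightarrow> 0 \<in> Z \<Longrightarrow> F xs 0 = 0"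
  using linear_op_lin[of S Z F xs 0 0 0 0] by simp

lemma supported_Cons: "supported S P \<beta> \<Longrightarrow> a \<in> S \<Longrightarrow> supported S (\<lambda>i. P (Suc i)) (\<lambda>vs. \<beta> (a # vs))"
  unfolding supported_def by (metis insert_subset length_Cons list.simps(15))

lemma parity_supported_Cons: "parity_supported S k \<beta> \<Longrightarrow> a \<in> S \<Longrightarrow> parity_supported S (Suc k) (\<lambda>vs. \<beta> (a # vs))"
  using supported_Cons[of S "\<lambda>i. even (i + k)" \<beta> a] by simp

section \<open>Congruence, dependence on parity and linearity of wedge and insertion\<close>

lemma wedge_cong:
  assumes "set us \<subseteq> S" "\<And>xs z. set xs \<subseteq> S \<Longrightarrow> z \<in> Z \<Longrightarrow> F xs z = F' xs z"
    and "\<And>xs. set xs \<subseteq> S \<Longrightarrow> \<beta> xs = \<beta>' xs" "\<And>xs. set xs \<subseteq> S \<Longrightarrow> \<beta> xs \<in> Z"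
  shows "wedge k F \<beta> us = wedge k F' \<beta>' us"
  using assms
proof (induction us arbitrary: k F F' \<beta> \<beta>')
  case Nil
  then show ?case by simp
next
  case (Cons a us)
  have "wedge (Suc k) (\<lambda>vs. F (a # vs)) \<beta> us = wedge (Suc k) (\<lambda>vs. F' (a # vs)) \<beta>' us"
    by (rule Cons.IH) (use Cons.prems in auto)
  moreover have "wedge k F (\<lambda>vs. \<beta> (a # vs)) us = wedge k F' (\<lambda>vs. \<beta>' (a # vs)) us"
    by (rule Cons.IH) (use Cons.prems in auto)
  ultimately show ?case by simp
qed

lemma insertion_cong:
  assumes "set us \<subseteq> S" "\<And>xs. set xs \<subseteq> S \<Longrightarrow> Y xs = Y' xs" "\<And>xs. set xs \<subseteq> S \<Longrightarrow> Y xs \<in> S"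
    and "\<And>xs. set xs \<subseteq> S \<Longrightarrow> \<beta> xs = \<beta>' xs"
  shows "insertion k Y \<beta> us = insertion k Y' \<beta>' us"
  using assms
proof (induction us arbitrary: k Y Y' \<beta> \<beta>')
  case Nil
  then show ?case by simp
next
  case (Cons a us)
  have "insertion (Suc k) (\<lambda>vs. Y (a # vs)) \<beta> us = insertion (Suc k) (\<lambda>vs. Y' (a # vs)) \<beta>' us"
    by (rule Cons.IH) (use Cons.prems in auto)
  moreover have "insertion k Y (\<lambda>vs. \<beta> (a # vs)) us = insertion k Y' (\<lambda>vs. \<beta>' (a # vs)) us"
    by (rule Cons.IH) (use Cons.prems in auto)
  ultimately show ?case by simp
qed

lemma wedge_parity:
  assumes "even k = even l" shows "wedge k F \<beta> us = wedge l F \<beta> us"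
  using assms
proof (induction us arbitrary: k l F \<beta>)
  case (Cons a us)
  have "(-1::real) ^ k = (-1) ^ l" using Cons.prems by (simp add: minus_one_power_iff)
  moreover have "wedge (Suc k) (\<lambda>vs. F (a # vs)) \<beta> us = wedge (Suc l) (\<lambda>vs. F (a # vs)) \<beta> us"
    by (rule Cons.IH) (use Cons.prems in auto)
  ultimately show ?case using Cons.IH[OF Cons.prems] by simp
qed simp

lemma insertion_parity:
  assumes "even k = even l" shows "insertion k Y \<beta> us = insertion l Y \<beta> us"
  using assms
proof (induction us arbitrary: k l Y \<beta>)
  case (Cons a us)
  have "(-1::real) ^ k = (-1) ^ l" using Cons.prems by (simp add: minus_one_power_iff)
  moreover have "insertion (Suc k) (\<lambda>vs. Y (a # vs)) \<beta> us = insertion (Suc l) (\<lambda>vs. Y (a # vs)) \<beta> us"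
    by (rule Cons.IH) (use Cons.prems in auto)
  ultimately show ?case using Cons.IH[OF Cons.prems] by simp
qed simp

lemma wedge_in:
  assumes "set us \<subseteq> S" "subspace Z'"
    and "\<And>xs z. set xs \<subseteq> S \<Longrightarrow> z \<in> Z \<Longrightarrow> F xs z \<in> Z'" "\<And>xs. set xs \<subseteq> S \<Longrightarrow> \<beta> xs \<in> Z"
  shows "wedge k F \<beta> us \<in> Z'"
  using assms(1,3,4)
proof (induction us arbitrary: k F \<beta>)
  case (Cons a us)
  have "wedge (Suc k) (\<lambda>vs. F (a # vs)) \<beta> us \<in> Z'" "wedge k F (\<lambda>vs. \<beta> (a # vs)) us \<in> Z'"
    by (rule Cons.IH; use Cons.prems in auto)+
  then show ?case using assms(2) by (simp add: subspace_add subspace_scale)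
qed simp

lemma insertion_in:
  assumes "set us \<subseteq> S" "subspace Z"
    and "\<And>xs. set xs \<subseteq> S \<Longrightarrow> Y xs \<in> S" "\<And>xs. set xs \<subseteq> S \<Longrightarrow> \<beta> xs \<in> Z"
  shows "insertion k Y \<beta> us \<in> Z"
  using assms(1,3,4)
proof (induction us arbitrary: k Y \<beta>)
  case (Cons a us)
  have "insertion (Suc k) (\<lambda>vs. Y (a # vs)) \<beta> us \<in> Z" "insertion k Y (\<lambda>vs. \<beta> (a # vs)) us \<in> Z"
    by (rule Cons.IH; use Cons.prems in auto)+
  then show ?case using assms(2) by (simp add: subspace_diff subspace_scale)
qed simp

lemma wedge_add_op: "wedge k (\<lambda>xs z. F xs z + G xs z) \<beta> us = wedge k F \<beta> us + wedge k G \<beta> us"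
  by (induction us arbitrary: k F G \<beta>) (auto simp: algebra_simps)

lemma wedge_scale_op: "wedge k (\<lambda>xs z. c *\<^sub>R F xs z) \<beta> us = c *\<^sub>R wedge k F \<beta> us"
  by (induction us arbitrary: k F \<beta>) (auto simp: algebra_simps)

lemma wedge_diff_op: "wedge k (\<lambda>xs z. F xs z - G xs z) \<beta> us = wedge k F \<beta> us - wedge k G \<beta> us"
  using wedge_add_op[of k F "\<lambda>xs z. -1 *\<^sub>R G xs z" \<beta> us] wedge_scale_op[of k "-1" G \<beta> us] by simp

lemma wedge_zero_op: "wedge k (\<lambda>xs z. 0) \<beta> us = 0"
  by (induction us arbitrary: k \<beta>) auto

lemma insertion_add_form: "insertion k Y (\<lambda>xs. \<beta> xs + \<gamma> xs) us = insertion k Y \<beta> us + insertion k Y \<gamma> us"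
  by (induction us arbitrary: k Y \<beta> \<gamma>) (auto simp: algebra_simps)

lemma insertion_scale_form: "insertion k Y (\<lambda>xs. c *\<^sub>R \<beta> xs) us = c *\<^sub>R insertion k Y \<beta> us"
  by (induction us arbitrary: k Y \<beta>) (auto simp: algebra_simps)

lemma insertion_diff_form: "insertion k Y (\<lambda>xs. \<beta> xs - \<gamma> xs) us = insertion k Y \<beta> us - insertion k Y \<gamma> us"
  using insertion_add_form[of k Y \<beta> "\<lambda>xs. -1 *\<^sub>R \<gamma> xs" us] insertion_scale_form[of k Y "-1" \<gamma> us] by simp

lemma insertion_zero_form: "insertion k Y (\<lambda>xs. 0) us = 0"
  by (induction us arbitrary: k Y) auto

lemma wedge_lin_form:
  assumes "set us \<subseteq> S" "linear_op S Z F"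
    and "\<And>xs. set xs \<subseteq> S \<Longrightarrow> \<beta> xs \<in> Z" "\<And>xs. set xs \<subseteq> S \<Longrightarrow> \<gamma> xs \<in> Z"
  shows "wedge k F (\<lambda>xs. a *\<^sub>R \<beta> xs + b *\<^sub>R \<gamma> xs) us = a *\<^sub>R wedge k F \<beta> us + b *\<^sub>R wedge k F \<gamma> us"
  using assms
proof (induction us arbitrary: k F \<beta> \<gamma>)
  case Nil
  then show ?case by (simp add: linear_op_lin)
next
  case (Cons c us)
  have "wedge (Suc k) (\<lambda>vs. F (c # vs)) (\<lambda>xs. a *\<^sub>R \<beta> xs + b *\<^sub>R \<gamma> xs) us =
     a *\<^sub>R wedge (Suc k) (\<lambda>vs. F (c # vs)) \<beta> us + b *\<^sub>R wedge (Suc k) (\<lambda>vs. F (c # vs)) \<gamma> us"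
    by (rule Cons.IH) (use Cons.prems in \<open>auto intro: linear_op_Cons\<close>)
  moreover have "wedge k F (\<lambda>vs. a *\<^sub>R \<beta> (c # vs) + b *\<^sub>R \<gamma> (c # vs)) us =
     a *\<^sub>R wedge k F (\<lambda>vs. \<beta> (c # vs)) us + b *\<^sub>R wedge k F (\<lambda>vs. \<gamma> (c # vs)) us"
    by (rule Cons.IH) (use Cons.prems in auto)
  ultimately show ?case by (simp add: algebra_simps)
qed

lemma wedge_add_form:
  assumes "set us \<subseteq> S" "linear_op S Z F"
    and "\<And>xs. set xs \<subseteq> S \<Longrightarrow> \<beta> xs \<in> Z" "\<And>xs. set xs \<subseteq> S \<Longrightarrow> \<gamma> xs \<in> Z"
  shows "wedge k F (\<lambda>xs. \<beta> xs + \<gamma> xs) us = wedge k F \<beta> us + wedge k F \<gamma> us"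
  using wedge_lin_form[where k=k and a=1 and b=1, OF assms] by simp

lemma wedge_diff_form:
  assumes "set us \<subseteq> S" "linear_op S Z F"
    and "\<And>xs. set xs \<subseteq> S \<Longrightarrow> \<beta> xs \<in> Z" "\<And>xs. set xs \<subseteq> S \<Longrightarrow> \<gamma> xs \<in> Z"
  shows "wedge k F (\<lambda>xs. \<beta> xs - \<gamma> xs) us = wedge k F \<beta> us - wedge k F \<gamma> us"
  using wedge_lin_form[where k=k and a=1 and b="-1", OF assms] by simp

lemma wedge_scale_form:
  assumes "set us \<subseteq> S" "linear_op S Z F" "\<And>xs. set xs \<subseteq> S \<Longrightarrow> \<beta> xs \<in> Z"
  shows "wedge k F (\<lambda>xs. c *\<^sub>R \<beta> xs) us = c *\<^sub>R wedge k F \<beta> us"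
  using wedge_lin_form[where k=k and a=c and b=0, OF assms(1,2,3,3)] by simp

lemma wedge_zero_form:
  assumes "set us \<subseteq> S" "linear_op S Z F" "0 \<in> Z"
  shows "wedge k F (\<lambda>xs. 0) us = 0"
  using wedge_lin_form[where k=k and a=0 and b=0 and \<beta>="\<lambda>_. 0" and \<gamma>="\<lambda>_. 0", OF assms(1,2)] assms(3) by simp

lemma insertion_lin_vec:
  assumes "set us \<subseteq> S" "mlinear S Z \<beta>"
    and "\<And>xs. set xs \<subseteq> S \<Longrightarrow> X xs \<in> S" "\<And>xs. set xs \<subseteq> S \<Longrightarrow> Y xs \<in> S"
  shows "insertion k (\<lambda>xs. a *\<^sub>R X xs + b *\<^sub>R Y xs) \<beta> us = a *\<^sub>R insertion k X \<beta> us + b *\<^sub>R insertion k Y \<beta> us"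
  using assms
proof (induction us arbitrary: k \<beta> X Y)
  case Nil
  then show ?case by (simp add: mlinear_lin_hd)
next
  case (Cons c us)
  have "insertion k (\<lambda>xs. a *\<^sub>R X xs + b *\<^sub>R Y xs) (\<lambda>vs. \<beta> (c # vs)) us =
     a *\<^sub>R insertion k X (\<lambda>vs. \<beta> (c # vs)) us + b *\<^sub>R insertion k Y (\<lambda>vs. \<beta> (c # vs)) us"
    by (rule Cons.IH) (use Cons.prems in \<open>auto intro: mlinear_Cons\<close>)
  moreover have "insertion (Suc k) (\<lambda>vs. a *\<^sub>R X (c # vs) + b *\<^sub>R Y (c # vs)) \<beta> us =
     a *\<^sub>R insertion (Suc k) (\<lambda>vs. X (c # vs)) \<beta> us + b *\<^sub>R insertion (Suc k) (\<lambda>vs. Y (c # vs)) \<beta> us"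
    by (rule Cons.IH) (use Cons.prems in auto)
  ultimately show ?case by (simp add: algebra_simps)
qed

lemma insertion_zero_vec:
  assumes "set us \<subseteq> S" "mlinear S Z \<beta>" "0 \<in> S"
  shows "insertion k (\<lambda>xs. 0) \<beta> us = 0"
  using insertion_lin_vec[where k=k and a=0 and b=0 and X="\<lambda>_. 0" and Y="\<lambda>_. 0", OF assms(1,2)] assms(3) by simp

lemma insertion_scale_vec:
  assumes "set us \<subseteq> S" "mlinear S Z \<beta>" "\<And>xs. set xs \<subseteq> S \<Longrightarrow> X xs \<in> S"
  shows "insertion k (\<lambda>xs. c *\<^sub>R X xs) \<beta> us = c *\<^sub>R insertion k X \<beta> us"
  using insertion_lin_vec[where k=k and a=c and b=0, OF assms(1,2,3,3)] by simp

section \<open>Multilinearity, skew symmetry and degree of wedge and insertion\<close>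

lemma wedge_mlinear:
  assumes S: "subspace S" and Z: "subspace Z" and F: "linear_op S Z F" "\<And>z. z \<in> Z \<Longrightarrow> mlinear S Z (\<lambda>xs. F xs z)"
    and B: "mlinear S Z \<beta>"
  shows "mlinear S Z (wedge k F \<beta>)"
proof -
  \<comment> \<open>The induction runs over the arguments before the distinguished slot. Once that
    slot is the head, it enters one factor at a time, and linearity in the first slot of each factor
    suffices.\<close>
  have "wedge k F \<beta> (xs @ (a *\<^sub>R v + b *\<^sub>R w) # ys) = a *\<^sub>R wedge k F \<beta> (xs @ v # ys) + b *\<^sub>R wedge k F \<beta> (xs @ w # ys)"
    if "set xs \<subseteq> S" "set ys \<subseteq> S" "v \<in> S" "w \<in> S" for a b v w xs ys
    using that F B
  proof (induction xs arbitrary: k F \<beta>)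
    case Nil
    note [simp] = Nil
    have t: "a *\<^sub>R v + b *\<^sub>R w \<in> S" using Nil S by (simp add: subspace_add subspace_scale)
    have "wedge (Suc k) (\<lambda>vs. F ((a *\<^sub>R v + b *\<^sub>R w) # vs)) \<beta> ys =
       wedge (Suc k) (\<lambda>vs z. a *\<^sub>R F (v # vs) z + b *\<^sub>R F (w # vs) z) \<beta> ys"
      by (rule wedge_cong[of _ S Z]) (simp_all add: mlinear_in[OF Nil(7)] mlinear_lin_hd[OF Nil(6)])
    moreover have "wedge k F (\<lambda>vs. \<beta> ((a *\<^sub>R v + b *\<^sub>R w) # vs)) ys =
       wedge k F (\<lambda>vs. a *\<^sub>R \<beta> (v # vs) + b *\<^sub>R \<beta> (w # vs)) ys"
      by (rule wedge_cong[of _ S Z]) (simp_all add: t mlinear_in[OF Nil(7)] mlinear_lin_hd[OF Nil(7)] subspace_add[OF Z] subspace_scale[OF Z])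
    moreover have "\<dots> = a *\<^sub>R wedge k F (\<lambda>vs. \<beta> (v # vs)) ys + b *\<^sub>R wedge k F (\<lambda>vs. \<beta> (w # vs)) ys"
      by (rule wedge_lin_form[of _ S Z]) (simp_all add: mlinear_in[OF Nil(7)])
    ultimately show ?case by (simp add: wedge_add_op wedge_scale_op algebra_simps)
  next
    case (Cons c xs)
    note P = Cons.prems
    let ?t = "a *\<^sub>R v + b *\<^sub>R w"
    have c: "c \<in> S" and xs: "set xs \<subseteq> S" using P by auto
    have "wedge (Suc k) (\<lambda>vs. F (c # vs)) \<beta> (xs @ ?t # ys) = a *\<^sub>R wedge (Suc k) (\<lambda>vs. F (c # vs)) \<beta> (xs @ v # ys)
          + b *\<^sub>R wedge (Suc k) (\<lambda>vs. F (c # vs)) \<beta> (xs @ w # ys)"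
      by (rule Cons.IH[OF xs P(2-4) linear_op_Cons[OF P(5) c] mlinear_Cons[OF P(6) c] P(7)])
    moreover have "wedge k F (\<lambda>vs. \<beta> (c # vs)) (xs @ ?t # ys) = a *\<^sub>R wedge k F (\<lambda>vs. \<beta> (c # vs)) (xs @ v # ys)
          + b *\<^sub>R wedge k F (\<lambda>vs. \<beta> (c # vs)) (xs @ w # ys)"
      by (rule Cons.IH[OF xs P(2-6) mlinear_Cons[OF P(7) c]])
    ultimately show ?case by (simp add: algebra_simps)
  qed
  moreover have "wedge k F \<beta> us \<in> Z" if "set us \<subseteq> S" for us
    by (rule wedge_in[of _ S _ Z]) (use that Z in \<open>simp_all add: mlinear_in[OF B] linear_op_in[OF F(1)]\<close>)
  ultimately show ?thesis unfolding mlinear_def by blast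
qed

lemma insertion_mlinear:
  assumes S: "subspace S" and Z: "subspace Z" and Y: "mlinear S S Y"
    and B: "mlinear S Z \<beta>"
  shows "mlinear S Z (insertion k Y \<beta>)"
proof -
  have "insertion k Y \<beta> (xs @ (a *\<^sub>R v + b *\<^sub>R w) # ys) = a *\<^sub>R insertion k Y \<beta> (xs @ v # ys) + b *\<^sub>R insertion k Y \<beta> (xs @ w # ys)"
    if "set xs \<subseteq> S" "set ys \<subseteq> S" "v \<in> S" "w \<in> S" for a b v w xs ys
    using that Y B
  proof (induction xs arbitrary: k Y \<beta>)
    case Nil
    note [simp] = Nil
    have t: "a *\<^sub>R v + b *\<^sub>R w \<in> S" using Nil S by (simp add: subspace_add subspace_scale)
    have "insertion (Suc k) (\<lambda>vs. Y ((a *\<^sub>R v + b *\<^sub>R w) # vs)) \<beta> ys =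
       insertion (Suc k) (\<lambda>vs. a *\<^sub>R Y (v # vs) + b *\<^sub>R Y (w # vs)) \<beta> ys"
      by (rule insertion_cong[of _ S]) (simp_all add: t mlinear_in[OF Nil(5)] mlinear_lin_hd[OF Nil(5)] subspace_add[OF S] subspace_scale[OF S])
    moreover have "\<dots> = a *\<^sub>R insertion (Suc k) (\<lambda>vs. Y (v # vs)) \<beta> ys + b *\<^sub>R insertion (Suc k) (\<lambda>vs. Y (w # vs)) \<beta> ys"
      by (rule insertion_lin_vec[of _ S Z]) (simp_all add: mlinear_in[OF Nil(5)])
    moreover have "insertion k Y (\<lambda>vs. \<beta> ((a *\<^sub>R v + b *\<^sub>R w) # vs)) ys =
       insertion k Y (\<lambda>vs. a *\<^sub>R \<beta> (v # vs) + b *\<^sub>R \<beta> (w # vs)) ys"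
      by (rule insertion_cong[of _ S]) (simp_all add: mlinear_in[OF Nil(5)] mlinear_lin_hd[OF Nil(6)])
    ultimately show ?case by (simp add: insertion_add_form insertion_scale_form algebra_simps)
  next
    case (Cons c xs)
    note P = Cons.prems
    let ?t = "a *\<^sub>R v + b *\<^sub>R w"
    have c: "c \<in> S" and xs: "set xs \<subseteq> S" using P by auto
    have "insertion (Suc k) (\<lambda>vs. Y (c # vs)) \<beta> (xs @ ?t # ys) = a *\<^sub>R insertion (Suc k) (\<lambda>vs. Y (c # vs)) \<beta> (xs @ v # ys)
          + b *\<^sub>R insertion (Suc k) (\<lambda>vs. Y (c # vs)) \<beta> (xs @ w # ys)"
      by (rule Cons.IH[OF xs P(2-4) mlinear_Cons[OF P(5) c] P(6)])
    moreover have "insertion k Y (\<lambda>vs. \<beta> (c # vs)) (xs @ ?t # ys) = a *\<^sub>R insertion k Y (\<lambda>vs. \<beta> (c # vs)) (xs @ v # ys)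
          + b *\<^sub>R insertion k Y (\<lambda>vs. \<beta> (c # vs)) (xs @ w # ys)"
      by (rule Cons.IH[OF xs P(2-5) mlinear_Cons[OF P(6) c]])
    ultimately show ?case by (simp add: algebra_simps)
  qed
  moreover have "insertion k Y \<beta> us \<in> Z" if "set us \<subseteq> S" for us
    by (rule insertion_in[of _ S]) (use that Z in \<open>simp_all add: mlinear_in[OF B] mlinear_in[OF Y]\<close>)
  ultimately show ?thesis unfolding mlinear_def by blast
qed

lemma neg_one_pow_cases:
  obtains "even m" "(-1::real) ^ m = 1" | "odd m" "(-1::real) ^ m = -1"
  by (cases "even m") auto

text \<open>With the two arguments in front there are four terms. Those with both arguments in one
  factor change sign by hypothesis. The two mixed terms are exchanged, and they carry opposite signs
  because the index goes up by one when an argument enters \<open>F\<close> first.\<close>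

lemma wedge_skewf:
  assumes F: "linear_op S Z F" "\<And>z. z \<in> Z \<Longrightarrow> skewf S (\<lambda>xs. F xs z)"
    and B: "skewf S \<beta>" "\<And>xs. set xs \<subseteq> S \<Longrightarrow> \<beta> xs \<in> Z" and Z: "subspace Z"
  shows "skewf S (wedge k F \<beta>)"
proof -
  have "wedge k F \<beta> (xs @ v # w # ys) = - wedge k F \<beta> (xs @ w # v # ys)"
    if "set xs \<subseteq> S" "set ys \<subseteq> S" "v \<in> S" "w \<in> S" for xs v w ys
    using that F B
  proof (induction xs arbitrary: k F \<beta>)
    case Nil
    note [simp] = Nil
    have "wedge (Suc (Suc k)) (\<lambda>vs. F (v # w # vs)) \<beta> ys =
       wedge (Suc (Suc k)) (\<lambda>vs z. (-1) *\<^sub>R F (w # v # vs) z) \<beta> ys"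
      by (rule wedge_cong[of _ S Z]) (simp_all add: skewf_hd[OF Nil(6), of _ v w])
    moreover have "wedge k F (\<lambda>vs. \<beta> (v # w # vs)) ys = wedge k F (\<lambda>vs. (-1) *\<^sub>R \<beta> (w # v # vs)) ys"
      by (rule wedge_cong[of _ S Z]) (simp_all add: skewf_hd[OF Nil(7), of v w] subspace_neg[OF Z])
    moreover have "\<dots> = (-1) *\<^sub>R wedge k F (\<lambda>vs. \<beta> (w # v # vs)) ys"
      by (rule wedge_scale_form[of _ S Z]) simp_all
    ultimately show ?case
      unfolding wedge_scale_op by (cases k rule: neg_one_pow_cases) simp_all
  next
    case (Cons c xs)
    note P = Cons.prems
    have c: "c \<in> S" and xs: "set xs \<subseteq> S" using P by auto
    have "wedge (Suc k) (\<lambda>vs. F (c # vs)) \<beta> (xs @ v # w # ys) = - wedge (Suc k) (\<lambda>vs. F (c # vs)) \<beta> (xs @ w # v # ys)"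
      by (rule Cons.IH[OF xs P(2-4) linear_op_Cons[OF P(5) c] skewf_Cons[OF P(6) c] P(7-8)])
    moreover have "wedge k F (\<lambda>vs. \<beta> (c # vs)) (xs @ v # w # ys) = - wedge k F (\<lambda>vs. \<beta> (c # vs)) (xs @ w # v # ys)"
      by (rule Cons.IH[OF xs P(2-6) skewf_Cons[OF P(7) c]]) (use P c in auto)
    ultimately show ?case by simp
  qed
  then show ?thesis unfolding skewf_def by blast
qed

lemma insertion_skewf:
  assumes S: "subspace S" and Y: "skewf S Y" "\<And>xs. set xs \<subseteq> S \<Longrightarrow> Y xs \<in> S"
    and B: "skewf S \<beta>" "mlinear S Z \<beta>"
  shows "skewf S (insertion k Y \<beta>)"
proof -
  have "insertion k Y \<beta> (xs @ v # w # ys) = - insertion k Y \<beta> (xs @ w # v # ys)"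
    if "set xs \<subseteq> S" "set ys \<subseteq> S" "v \<in> S" "w \<in> S" for xs v w ys
    using that Y B
  proof (induction xs arbitrary: k Y \<beta>)
    case Nil
    note [simp] = Nil
    have "insertion (Suc (Suc k)) (\<lambda>vs. Y (v # w # vs)) \<beta> ys =
       insertion (Suc (Suc k)) (\<lambda>vs. (-1) *\<^sub>R Y (w # v # vs)) \<beta> ys"
      by (rule insertion_cong[of _ S]) (simp_all add: skewf_hd[OF Nil(5), of v w] subspace_neg[OF S])
    moreover have "\<dots> = (-1) *\<^sub>R insertion (Suc (Suc k)) (\<lambda>vs. Y (w # v # vs)) \<beta> ys"
      by (rule insertion_scale_vec[of _ S Z]) simp_all
    moreover have "insertion k Y (\<lambda>vs. \<beta> (v # w # vs)) ys = insertion k Y (\<lambda>vs. (-1) *\<^sub>R \<beta> (w # v # vs)) ys"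
      by (rule insertion_cong[of _ S]) (simp_all add: skewf_hd[OF Nil(7), of v w])
    ultimately show ?case
      unfolding insertion_scale_form by (cases k rule: neg_one_pow_cases) simp_all
  next
    case (Cons c xs)
    note P = Cons.prems
    have c: "c \<in> S" and xs: "set xs \<subseteq> S" using P by auto
    have "insertion (Suc k) (\<lambda>vs. Y (c # vs)) \<beta> (xs @ v # w # ys) = - insertion (Suc k) (\<lambda>vs. Y (c # vs)) \<beta> (xs @ w # v # ys)"
      by (rule Cons.IH[OF xs P(2-4) skewf_Cons[OF P(5) c]]) (use P c in auto)
    moreover have "insertion k Y (\<lambda>vs. \<beta> (c # vs)) (xs @ v # w # ys) = - insertion k Y (\<lambda>vs. \<beta> (c # vs)) (xs @ w # v # ys)"
      by (rule Cons.IH[OF xs P(2-6) skewf_Cons[OF P(7) c] mlinear_Cons[OF P(8) c]])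
    ultimately show ?case by simp
  qed
  then show ?thesis unfolding skewf_def by blast
qed

lemma wedge_supported:
  assumes "linear_op S Z F" "0 \<in> Z" "\<And>z. z \<in> Z \<Longrightarrow> supported S P (\<lambda>xs. F xs z)"
    and "supported S Q \<beta>" "\<And>xs. set xs \<subseteq> S \<Longrightarrow> \<beta> xs \<in> Z"
    and "\<And>i j. P i \<Longrightarrow> Q j \<Longrightarrow> R (i + j)"
  shows "supported S R (wedge k F \<beta>)"
proof -
  have "R (length us)" if "set us \<subseteq> S" "wedge k F \<beta> us \<noteq> 0" for us
    using that assms
  proof (induction us arbitrary: k F \<beta> P Q R)
    case Nil
    then have "\<beta> [] \<noteq> 0" using linear_op_zero[of S Z F "[]"] by auto
    moreover have "F [] (\<beta> []) \<noteq> 0" using Nil by simp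
    ultimately have "P 0" "Q 0"
      using Nil(5)[unfolded supported_def, OF Nil(7)[of "[]"], rule_format, of "[]"]
        Nil(6)[unfolded supported_def, rule_format, of "[]"] by simp_all
    then show ?case using Nil(8)[of 0 0] by simp
  next
    case (Cons a us)
    note P = Cons.prems
    have a: "a \<in> S" and us: "set us \<subseteq> S" using P by auto
    consider "wedge (Suc k) (\<lambda>vs. F (a # vs)) \<beta> us \<noteq> 0" | "wedge k F (\<lambda>vs. \<beta> (a # vs)) us \<noteq> 0"
      using P(2) by fastforce
    then show ?case
    proof cases
      case 1
      show ?thesis using Cons.IH[where R="\<lambda>i. R (Suc i)", OF us 1 linear_op_Cons[OF P(3) a] P(4) supported_Cons[OF P(5) a] P(6,7)] P(8)
        by force
    next
      case 2
      show ?thesis using Cons.IH[where R="\<lambda>i. R (Suc i)", OF us 2 P(3-5) supported_Cons[OF P(6) a] P(7)] P(8) a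
        by force
    qed
  qed
  then show ?thesis unfolding supported_def by blast
qed

text \<open>The value of \<open>Y\<close> fills one slot of \<open>\<beta>\<close>, whence
  \<open>Q (Suc j)\<close>. If \<open>\<beta>\<close> has degree 0, no such \<open>j\<close> exists;
  taking \<open>R\<close> false then shows that the insertion vanishes.\<close>

lemma insertion_supported:
  assumes "mlinear S Z \<beta>" "0 \<in> S" "supported S P Y" "\<And>xs. set xs \<subseteq> S \<Longrightarrow> Y xs \<in> S"
    and "supported S Q \<beta>" and "\<And>i j. P i \<Longrightarrow> Q (Suc j) \<Longrightarrow> R (i + j)"
  shows "supported S R (insertion k Y \<beta>)"
proof -
  have "R (length us)" if "set us \<subseteq> S" "insertion k Y \<beta> us \<noteq> 0" for us
    using that assms
  proof (induction us arbitrary: k Y \<beta> P Q R)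
    case Nil
    then have "Y [] \<noteq> 0" using mlinear_zero_hd[of S Z \<beta> "[]"] by auto
    moreover have "\<beta> [Y []] \<noteq> 0" "set [Y []] \<subseteq> S" using Nil by simp_all
    ultimately have "P 0" "Q (Suc 0)" 
      using Nil(5)[unfolded supported_def, rule_format, of "[]"]
        Nil(7)[unfolded supported_def, rule_format, of "[Y []]"] by simp_all
    then show ?case using Nil by force
  next
    case (Cons a us)
    note P = Cons.prems
    have a: "a \<in> S" and us: "set us \<subseteq> S" using P by auto
    consider "insertion (Suc k) (\<lambda>vs. Y (a # vs)) \<beta> us \<noteq> 0" | "insertion k Y (\<lambda>vs. \<beta> (a # vs)) us \<noteq> 0"
      using P(2) by fastforce
    then show ?case
    proof cases
      case 1
      show ?thesis using Cons.IH[where R="\<lambda>i. R (Suc i)", OF us 1 P(3,4) supported_Cons[OF P(5) a] _ P(7)] P(6,8) a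
        by force
    next
      case 2
      show ?thesis using Cons.IH[where R="\<lambda>i. R (Suc i)", OF us 2 mlinear_Cons[OF P(3) a] P(4-6) supported_Cons[OF P(7) a]] P(8)
        by force
    qed
  qed
  then show ?thesis unfolding supported_def by blast
qed

section \<open>Associativity, the derivation rule and the symmetry of insertions\<close>

lemma wedge_assoc:
  assumes "set us \<subseteq> S" "linear_op S Z F" "linear_op S Z G" "\<And>xs. set xs \<subseteq> S \<Longrightarrow> \<beta> xs \<in> Z" and Z: "subspace Z"
  shows "wedge (k + l) (\<lambda>vs z. wedge k F (\<lambda>xs. G xs z) vs) \<beta> us = wedge k F (wedge l G \<beta>) us"
  using assms(1-4)
proof (induction us arbitrary: k l F G \<beta>)
  case Nil
  then show ?case by simp
next
  case (Cons a us)
  note P = Cons.prems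
  have a: "a \<in> S" and us: "set us \<subseteq> S" using P by auto
  note Fa = linear_op_Cons[OF P(2) a] and Ga = linear_op_Cons[OF P(3) a]
  \<comment> \<open>The head enters \<open>F\<close> in 1, \<open>G\<close> in 2 and
    \<open>\<beta>\<close> in 3. On both sides it passes no argument, k arguments and k + l
    arguments respectively.\<close>
  have 1: "wedge (Suc (k + l)) (\<lambda>vs z. wedge (Suc k) (\<lambda>vs. F (a # vs)) (\<lambda>xs. G xs z) vs) \<beta> us =
     wedge (Suc k) (\<lambda>vs. F (a # vs)) (wedge l G \<beta>) us"
    using Cons.IH[where k="Suc k" and l=l, OF us Fa P(3,4)] by simp
  have 2: "wedge (Suc (k + l)) (\<lambda>vs z. wedge k F (\<lambda>xs. G (a # xs) z) vs) \<beta> us =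
     wedge k F (wedge (Suc l) (\<lambda>vs. G (a # vs)) \<beta>) us"
    using Cons.IH[where k=k and l="Suc l", OF us P(2) Ga P(4)] by simp
  have 3: "wedge (k + l) (\<lambda>vs z. wedge k F (\<lambda>xs. G xs z) vs) (\<lambda>xs. \<beta> (a # xs)) us =
     wedge k F (wedge l G (\<lambda>vs. \<beta> (a # vs))) us"
    by (rule Cons.IH[OF us P(2,3)]) (use P a in auto)
  have "wedge k F (\<lambda>vs. wedge (Suc l) (\<lambda>vs. G (a # vs)) \<beta> vs + (-1) ^ l *\<^sub>R wedge l G (\<lambda>vs. \<beta> (a # vs)) vs) us
    = wedge k F (wedge (Suc l) (\<lambda>vs. G (a # vs)) \<beta>) us + (-1) ^ l *\<^sub>R wedge k F (wedge l G (\<lambda>vs. \<beta> (a # vs))) us"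
    using wedge_lin_form[where a=1 and k=k and b="(-1)^l", OF us P(2),
        of "wedge (Suc l) (\<lambda>vs. G (a # vs)) \<beta>" "wedge l G (\<lambda>vs. \<beta> (a # vs))"]
      wedge_in[OF _ Z, of _ S Z] P a by (simp add: linear_op_in)
  then show ?case
    using 1 2 3 by (simp add: wedge_add_op wedge_scale_op algebra_simps power_add)
qed

text \<open>\<open>Y\<close> consumes k arguments and returns one, so inserting it is an operation
  of degree k - 1; this is the \<open>k + 1\<close> in the sign for passing \<open>F\<close>. The
  step for a nonempty list is formal, and the parity of \<open>Y\<close> decides only at the empty
  list.\<close>

lemma insertion_wedge:
  assumes "set us \<subseteq> S" "linear_op S Z F" "mlinear S Z \<beta>" "parity_supported S k Y" "\<And>xs. set xs \<subseteq> S \<Longrightarrow> Y xs \<in> S"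
    and S: "subspace S" and Z: "subspace Z"
    and "\<And>z. z \<in> Z \<Longrightarrow> mlinear S Z (\<lambda>xs. F xs z)"
  shows "insertion k Y (wedge m F \<beta>) us = wedge (m + k + 1) (\<lambda>vs z. insertion k Y (\<lambda>xs. F xs z) vs) \<beta> us
     + (-1) ^ (m * (k + 1)) *\<^sub>R wedge m F (insertion k Y \<beta>) us"
  using assms(1-5,8)
proof (induction us arbitrary: k m F Y \<beta>)
  case Nil
  show ?case
  \<comment> \<open>The term in which \<open>\<beta>\<close> receives \<open>Y []\<close> has sign
    \<open>(-1) ^ m\<close> on the left and \<open>(-1) ^ (m * (k + 1))\<close> on the right. These
    agree for even \<open>k\<close>; for odd \<open>k\<close> the parity of \<open>Y\<close> forces
    \<open>Y [] = 0\<close>.\<close>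
  proof (cases "even k")
    case True
    then show ?thesis by (cases m rule: neg_one_pow_cases) (simp_all add: power_add power_mult)
  next
    case False
    then have "Y [] = 0" using Nil(4)[unfolded supported_def, rule_format, of "[]"] by auto
    then have "\<beta> [Y []] = 0" using mlinear_zero_hd[OF Nil(3), of "[]"] subspace_0[OF S] by simp
    then show ?thesis using linear_op_zero[OF Nil(2), of "[]"] subspace_0[OF Z] by simp
  qed
next
  case (Cons a us)
  note P = Cons.prems
  have a: "a \<in> S" and us: "set us \<subseteq> S" using P by auto
  have Fam: "\<And>z. z \<in> Z \<Longrightarrow> mlinear S Z (\<lambda>xs. F (a # xs) z)" using mlinear_Cons[OF P(6) a] .
  note Fa = linear_op_Cons[OF P(2) a] and Ba = mlinear_Cons[OF P(3) a]
  have Ya: "\<And>xs. set xs \<subseteq> S \<Longrightarrow> Y (a # xs) \<in> S" using P a by simp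
  note IH1 = Cons.IH[OF us P(2,3) parity_supported_Cons[OF P(4) a] Ya P(6), where m=m]
    and IH2 = Cons.IH[OF us Fa P(3-5) Fam, where m="Suc m"]
    and IH3 = Cons.IH[OF us P(2) Ba P(4,5,6), where m=m]
  have lin: "wedge m F (\<lambda>vs. insertion (Suc k) (\<lambda>vs. Y (a # vs)) \<beta> vs - (-1) ^ k *\<^sub>R insertion k Y (\<lambda>vs. \<beta> (a # vs)) vs) us
    = wedge m F (insertion (Suc k) (\<lambda>vs. Y (a # vs)) \<beta>) us - (-1) ^ k *\<^sub>R wedge m F (insertion k Y (\<lambda>vs. \<beta> (a # vs))) us"
    using wedge_lin_form[where a=1 and k=m and b="-((-1)^k)", OF us P(2),
        of "insertion (Suc k) (\<lambda>vs. Y (a # vs)) \<beta>" "insertion k Y (\<lambda>vs. \<beta> (a # vs))"]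
      insertion_in[OF _ Z, of _ S] P a by (simp add: mlinear_in)
  show ?case
    unfolding insertion_Cons wedge_Cons lin insertion_add_form insertion_scale_form wedge_diff_op wedge_scale_op
    using IH1 IH2 IH3
    by (cases m rule: neg_one_pow_cases; cases k rule: neg_one_pow_cases)
      (simp_all add: algebra_simps power_add)
qed

text \<open>Subtracting the nested insertion removes the terms in which one field sits inside the
  other. What is left on each side is \<open>\<beta>\<close> with \<open>X\<close> and
  \<open>Y\<close> in two different slots, and skew symmetry of \<open>\<beta>\<close> exchanges
  these slots.\<close>

lemma insertion_insertion_sym:
  assumes "set us \<subseteq> S" "mlinear S Z \<beta>" "skewf S \<beta>"
    and "parity_supported S k X" "\<And>xs. set xs \<subseteq> S \<Longrightarrow> X xs \<in> S"
    and "parity_supported S l Y" "\<And>xs. set xs \<subseteq> S \<Longrightarrow> Y xs \<in> S"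
    and S: "subspace S"
  shows "insertion k X (insertion l Y \<beta>) us - insertion (k + l + 1) (insertion k X Y) \<beta> us =
     (-1) ^ ((k + 1) * (l + 1)) *\<^sub>R (insertion l Y (insertion k X \<beta>) us - insertion (k + l + 1) (insertion l Y X) \<beta> us)"
  using assms(1-7)
proof (induction us arbitrary: k l X Y \<beta>)
  case Nil
  have 0: "X [] \<in> S" "Y [] \<in> S" using Nil by simp_all
  have *: "\<beta> [0, y] = 0" "\<beta> [y, 0] = 0" if "y \<in> S" for y
    using mlinear_zero_hd[OF Nil(2), of "[y]"] mlinear_zero_hd[OF mlinear_Cons[OF Nil(2) that], of "[]"]
     subspace_0[OF S] that by simp_all
  \<comment> \<open>Up to sign the left side is \<open>\<beta> [X [], Y []]\<close> and the right
    side is \<open>\<beta> [Y [], X []]\<close>. Unless both degrees are even, one of the two values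
    is 0; for even degrees the sign in the claim is -1, as skew symmetry requires.\<close>
  consider "X [] = 0" | "Y [] = 0" | "even k" "even l"

    using Nil(4)[unfolded supported_def, rule_format, of "[]"] Nil(6)[unfolded supported_def, rule_format, of "[]"]
    by auto
  then show ?case
    by cases (use 0 * skewf_hd[OF Nil(3) 0, of "[]"] in simp_all)
next
  case (Cons a us)
  note P = Cons.prems
  have a: "a \<in> S" and us: "set us \<subseteq> S" using P by auto
  note Ba = mlinear_Cons[OF P(2) a] skewf_Cons[OF P(3) a]
  have Xa: "\<And>xs. set xs \<subseteq> S \<Longrightarrow> X (a # xs) \<in> S" and Ya: "\<And>xs. set xs \<subseteq> S \<Longrightarrow> Y (a # xs) \<in> S" using P a by simp_all
  have lin: "insertion i (\<lambda>vs. insertion (Suc k) (\<lambda>vs. X (a # vs)) Y vs - (-1) ^ k *\<^sub>R insertion k X (\<lambda>vs. Y (a # vs)) vs) \<beta> us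
    = insertion i (insertion (Suc k) (\<lambda>vs. X (a # vs)) Y) \<beta> us - (-1) ^ k *\<^sub>R insertion i (insertion k X (\<lambda>vs. Y (a # vs))) \<beta> us"
    if "\<And>xs. set xs \<subseteq> S \<Longrightarrow> X xs \<in> S" "\<And>xs. set xs \<subseteq> S \<Longrightarrow> Y xs \<in> S" for X Y :: "'a list \<Rightarrow> 'a" and k i
    using insertion_lin_vec[where a=1 and k=i and b="-((-1)^k)", OF us P(2),
        of "insertion (Suc k) (\<lambda>vs. X (a # vs)) Y" "insertion k X (\<lambda>vs. Y (a # vs))"]
      insertion_in[OF _ S, of _ S] that a by simp
  note IH1 = Cons.IH[OF us P(2,3) parity_supported_Cons[OF P(4) a] Xa P(6,7)]
    and IH2 = Cons.IH[OF us P(2-5) parity_supported_Cons[OF P(6) a] Ya]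
    and IH3 = Cons.IH[OF us Ba P(4-7)]
  have lin1: "insertion i (\<lambda>vs. insertion (Suc k) (\<lambda>vs. X (a # vs)) Y vs - (-1) ^ k *\<^sub>R insertion k X (\<lambda>vs. Y (a # vs)) vs) \<beta> us
    = insertion i (insertion (Suc k) (\<lambda>vs. X (a # vs)) Y) \<beta> us - (-1) ^ k *\<^sub>R insertion i (insertion k X (\<lambda>vs. Y (a # vs))) \<beta> us"
    and lin2: "insertion i (\<lambda>vs. insertion (Suc l) (\<lambda>vs. Y (a # vs)) X vs - (-1) ^ l *\<^sub>R insertion l Y (\<lambda>vs. X (a # vs)) vs) \<beta> us
    = insertion i (insertion (Suc l) (\<lambda>vs. Y (a # vs)) X) \<beta> us - (-1) ^ l *\<^sub>R insertion i (insertion l Y (\<lambda>vs. X (a # vs))) \<beta> us" for i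
    by (rule lin; use P in simp)+
  show ?case
    unfolding insertion_Cons lin1 lin2 insertion_diff_form insertion_scale_form
    by (cases l rule: neg_one_pow_cases; cases k rule: neg_one_pow_cases)
      (simp_all add: IH1[unfolded diff_eq_eq] IH2[unfolded diff_eq_eq] IH3[unfolded diff_eq_eq]
        algebra_simps power_add)
qed

section \<open>The bracket of operators\<close>

definition alternating :: "'s::real_vector set \<Rightarrow> ('s list \<Rightarrow> 's) \<Rightarrow> bool" where
  "alternating S \<beta> \<longleftrightarrow> mlinear S S \<beta> \<and> skewf S \<beta>"

text \<open>What remains of a multiderivation of degree \<open>n\<close>, with its last argument
  separated, when multiplication by functions is forgotten. The identities for the bracket need no
  more.\<close>

definition alt_op :: "'s::real_vector set \<Rightarrow> nat \<Rightarrow> ('s list \<Rightarrow> 's \<Rightarrow> 's) \<Rightarrow> bool" where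
  "alt_op S n F \<longleftrightarrow> linear_op S S F \<and>
     (\<forall>y\<in>S. alternating S (\<lambda>xs. F xs y) \<and> supported S (\<lambda>i. i = n) (\<lambda>xs. F xs y))"

definition vfield :: "nat \<Rightarrow> ('s list \<Rightarrow> 's \<Rightarrow> 's) \<Rightarrow> 's list \<Rightarrow> 's::real_vector" where
  "vfield n F = wedge n F id_form"

text \<open>The index \<open>Suc n\<close> arises because the inserted field takes one argument more
  than \<open>F\<close> has before its last.\<close>

definition act :: "nat \<Rightarrow> ('s list \<Rightarrow> 's \<Rightarrow> 's) \<Rightarrow> ('s list \<Rightarrow> 's) \<Rightarrow> 's list \<Rightarrow> 's::real_vector" where
  "act n F \<beta> us = wedge n F \<beta> us - insertion (Suc n) (vfield n F) \<beta> us"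

definition op_bracket :: "nat \<Rightarrow> nat \<Rightarrow> ('s list \<Rightarrow> 's \<Rightarrow> 's) \<Rightarrow> ('s list \<Rightarrow> 's \<Rightarrow> 's) \<Rightarrow> 's list \<Rightarrow> 's \<Rightarrow> 's::real_vector" where
  "op_bracket n m F G us y = (-1) ^ (m * n) *\<^sub>R act n F (\<lambda>vs. G vs y) us - act m G (\<lambda>vs. F vs y) us"

lemma alternatingD: "alternating S \<beta> \<Longrightarrow> mlinear S S \<beta>" "alternating S \<beta> \<Longrightarrow> skewf S \<beta>"
  "alternating S \<beta> \<Longrightarrow> set us \<subseteq> S \<Longrightarrow> \<beta> us \<in> S"
  by (auto simp: alternating_def mlinear_in)

lemma alt_opD: "alt_op S n F \<Longrightarrow> linear_op S S F" "alt_op S n F \<Longrightarrow> y \<in> S \<Longrightarrow> alternating S (\<lambda>xs. F xs y)"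
  "alt_op S n F \<Longrightarrow> y \<in> S \<Longrightarrow> supported S (\<lambda>i. i = n) (\<lambda>xs. F xs y)"
  by (auto simp: alt_op_def)

lemma alternating_id_form: assumes "subspace S" shows "alternating S id_form"
proof -
  have "id_form (xs @ v # w # ys) = (0::'a)" for xs ys :: "'a list" and v w
    by (auto simp: id_form_def append_eq_Cons_conv split: list.splits)
  moreover have "id_form us \<in> S" if "set us \<subseteq> S" for us
    using that subspace_0[OF assms] by (auto simp: id_form_def split: list.splits)
  moreover have "id_form (xs @ v # ys) = (if xs = [] \<and> ys = [] then v else 0)" for xs ys :: "'a list" and v
    by (cases xs rule: rev_cases; cases ys) (auto simp: id_form_def append_eq_Cons_conv split: list.splits)
  ultimately show ?thesis unfolding alternating_def mlinear_def skewf_def by auto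
qed

lemma supported_id_form: "supported S (\<lambda>i. i = Suc 0) id_form"
  by (auto simp: supported_def id_form_def split: list.splits)

text \<open>A form of degree 0 has no slot to fill.\<close>

lemma insertion_const_Nil: "insertion k Y (\<lambda>us. if us = [] then a else 0) us = 0"
  by (induction us arbitrary: k Y) (auto simp: insertion_zero_form)

lemma insertion_id_form: "insertion k Y id_form = Y"
proof
  have *: "(\<lambda>vs. id_form (a # vs)) = (\<lambda>us. if us = [] then a else 0)" for a :: 'a
    by (auto simp: fun_eq_iff id_form_def split: list.splits)
  show "insertion k Y id_form us = Y us" for us
  proof (induction us arbitrary: k Y)
    case Nil
    then show ?case by simp
  next
    case (Cons a us)
    have "insertion (Suc k) (\<lambda>vs. Y (a # vs)) id_form us = Y (a # us)" by (rule Cons.IH)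
    then show ?case unfolding insertion_Cons * insertion_const_Nil by simp
  qed
qed

lemma supported_mono: "supported S P \<beta> \<Longrightarrow> (\<And>i. P i \<Longrightarrow> Q i) \<Longrightarrow> supported S Q \<beta>"
  unfolding supported_def by blast

lemma alternating_lin:
  assumes S: "subspace S" and "alternating S \<beta>" "alternating S \<gamma>"
  shows "alternating S (\<lambda>us. a *\<^sub>R \<beta> us + b *\<^sub>R \<gamma> us)"
  unfolding alternating_def mlinear_def skewf_def
proof (intro conjI allI impI ballI)
  fix xs ys v w assume *: "set xs \<subseteq> S" "set ys \<subseteq> S" "v \<in> S" "w \<in> S"
  have "\<beta> (xs @ v # w # ys) = - \<beta> (xs @ w # v # ys)" "\<gamma> (xs @ v # w # ys) = - \<gamma> (xs @ w # v # ys)"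
    using alternatingD(2)[OF assms(2)] alternatingD(2)[OF assms(3)] * unfolding skewf_def by blast+
  then show "a *\<^sub>R \<beta> (xs @ v # w # ys) + b *\<^sub>R \<gamma> (xs @ v # w # ys) =
    - (a *\<^sub>R \<beta> (xs @ w # v # ys) + b *\<^sub>R \<gamma> (xs @ w # v # ys))" by simp
  show "a *\<^sub>R \<beta> (xs @ (c *\<^sub>R v + d *\<^sub>R w) # ys) + b *\<^sub>R \<gamma> (xs @ (c *\<^sub>R v + d *\<^sub>R w) # ys) =
    c *\<^sub>R (a *\<^sub>R \<beta> (xs @ v # ys) + b *\<^sub>R \<gamma> (xs @ v # ys)) +
    d *\<^sub>R (a *\<^sub>R \<beta> (xs @ w # ys) + b *\<^sub>R \<gamma> (xs @ w # ys))" for c d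
    unfolding mlinear_lin[OF alternatingD(1)[OF assms(2)] *] mlinear_lin[OF alternatingD(1)[OF assms(3)] *]
    by (simp add: algebra_simps)
qed (use assms in \<open>simp add: alternatingD(3) subspace_add[OF S] subspace_scale[OF S]\<close>)

lemma alternating_wedge:
  assumes S: "subspace S" and F: "alt_op S n F" and B: "alternating S \<beta>"
  shows "alternating S (wedge k F \<beta>)"
  unfolding alternating_def
  using wedge_mlinear[OF S S alt_opD(1)[OF F] alternatingD(1)[OF alt_opD(2)[OF F]] alternatingD(1)[OF B]]
    wedge_skewf[OF alt_opD(1)[OF F] alternatingD(2)[OF alt_opD(2)[OF F]] alternatingD(2)[OF B] alternatingD(3)[OF B] S] by blast

lemma alternating_insertion:
  assumes S: "subspace S" and Y: "alternating S Y" and B: "alternating S \<beta>"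
  shows "alternating S (insertion k Y \<beta>)"
  unfolding alternating_def
  using insertion_mlinear[OF S S alternatingD(1)[OF Y] alternatingD(1)[OF B]]
    insertion_skewf[OF S alternatingD(2)[OF Y] alternatingD(3)[OF Y] alternatingD(2)[OF B] alternatingD(1)[OF B]] by blast

lemma alternating_vfield: "subspace S \<Longrightarrow> alt_op S n F \<Longrightarrow> alternating S (vfield n F)"
  unfolding vfield_def by (intro alternating_wedge alternating_id_form)

lemma alternating_act: "subspace S \<Longrightarrow> alt_op S n F \<Longrightarrow> alternating S \<beta> \<Longrightarrow> alternating S (act n F \<beta>)"
  unfolding act_def [abs_def]
  using alternating_lin[OF _ alternating_wedge alternating_insertion[OF _ alternating_vfield], where a=1 and b="-1"] by simp

lemma supported_vfield: assumes "subspace S" "alt_op S n F" shows "supported S (\<lambda>i. i = Suc n) (vfield n F)"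
  unfolding vfield_def
  by (rule wedge_supported[OF alt_opD(1)[OF assms(2)] _ alt_opD(3)[OF assms(2)] supported_id_form])
    (use assms in \<open>auto simp: subspace_0 alternatingD(3)[OF alternating_id_form]\<close>)

lemma parity_supported_vfield: assumes "subspace S" "alt_op S n F" shows "parity_supported S (Suc n) (vfield n F)"
  by (rule supported_mono[OF supported_vfield[OF assms]]) simp

lemma supported_act:
  assumes "subspace S" "alt_op S n F" "alternating S \<beta>" "supported S (\<lambda>i. i = m) \<beta>"
  shows "supported S (\<lambda>i. i = n + m) (act n F \<beta>)"
proof -
  have "supported S (\<lambda>i. i = n + m) (wedge n F \<beta>)"
    by (rule wedge_supported[OF alt_opD(1)[OF assms(2)] _ alt_opD(3)[OF assms(2)] assms(4)])
      (use assms in \<open>auto simp: subspace_0 alternatingD(3)\<close>)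
  moreover have "supported S (\<lambda>i. i = n + m) (insertion (Suc n) (vfield n F) \<beta>)"
    by (rule insertion_supported[OF alternatingD(1)[OF assms(3)] _ supported_vfield[OF assms(1,2)] _ assms(4)])
      (use assms alternatingD(3)[OF alternating_vfield[OF assms(1,2)]] in \<open>auto simp: subspace_0\<close>)
  ultimately show ?thesis unfolding supported_def act_def by fastforce
qed

lemma act_lin:
  assumes "alt_op S n F" "set us \<subseteq> S"
    "\<And>xs. set xs \<subseteq> S \<Longrightarrow> \<beta> xs \<in> S" "\<And>xs. set xs \<subseteq> S \<Longrightarrow> \<gamma> xs \<in> S"
  shows "act n F (\<lambda>xs. a *\<^sub>R \<beta> xs + b *\<^sub>R \<gamma> xs) us = a *\<^sub>R act n F \<beta> us + b *\<^sub>R act n F \<gamma> us"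
proof -
  have "wedge n F (\<lambda>xs. a *\<^sub>R \<beta> xs + b *\<^sub>R \<gamma> xs) us = a *\<^sub>R wedge n F \<beta> us + b *\<^sub>R wedge n F \<gamma> us"
    by (rule wedge_lin_form[OF assms(2) alt_opD(1)[OF assms(1)]]) (simp_all add: assms)
  then show ?thesis
    unfolding act_def insertion_add_form insertion_scale_form by (simp add: algebra_simps)
qed

lemma act_diff:
  assumes "alt_op S n F" "set us \<subseteq> S"
    "\<And>xs. set xs \<subseteq> S \<Longrightarrow> \<beta> xs \<in> S" "\<And>xs. set xs \<subseteq> S \<Longrightarrow> \<gamma> xs \<in> S"
  shows "act n F (\<lambda>xs. a *\<^sub>R \<beta> xs - \<gamma> xs) us = a *\<^sub>R act n F \<beta> us - act n F \<gamma> us"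
  using act_lin[where a=a and b="-1", OF assms] by simp

lemma act_cong:
  assumes "alt_op S n F" "set us \<subseteq> S" "subspace S"
    "\<And>xs. set xs \<subseteq> S \<Longrightarrow> \<beta> xs = \<gamma> xs" "\<And>xs. set xs \<subseteq> S \<Longrightarrow> \<beta> xs \<in> S"
  shows "act n F \<beta> us = act n F \<gamma> us"
  unfolding act_def
  using wedge_cong[of us S S F F \<beta> \<gamma>, OF assms(2) _ assms(4,5)]
    insertion_cong[of us S "vfield n F" "vfield n F" \<beta> \<gamma>, OF assms(2) _ _ assms(4)]
    alternatingD(3)[OF alternating_vfield[OF assms(3,1)]] by auto

lemma alt_op_op_bracket:
  assumes S: "subspace S" and F: "alt_op S n F" and G: "alt_op S m G"
  shows "alt_op S (n + m) (op_bracket n m F G)"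
proof -
  have alt: "alternating S (\<lambda>us. op_bracket n m F G us y)" if "y \<in> S" for y
    unfolding op_bracket_def
    using alternating_lin[OF S alternating_act[OF S F alt_opD(2)[OF G that]] alternating_act[OF S G alt_opD(2)[OF F that]], where b="-1"]
    by simp
  moreover have "supported S (\<lambda>i. i = n + m) (\<lambda>us. op_bracket n m F G us y)" if "y \<in> S" for y
    using supported_act[OF S F alt_opD(2,3)[OF G that]] supported_act[OF S G alt_opD(2,3)[OF F that]]
    unfolding supported_def op_bracket_def by (fastforce simp: add.commute)
  moreover have "op_bracket n m F G us (a *\<^sub>R y + b *\<^sub>R z) = a *\<^sub>R op_bracket n m F G us y + b *\<^sub>R op_bracket n m F G us z"
    if "set us \<subseteq> S" "y \<in> S" "z \<in> S" for us a b y z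
  proof -
    have "act n F (\<lambda>vs. G vs (a *\<^sub>R y + b *\<^sub>R z)) us = a *\<^sub>R act n F (\<lambda>vs. G vs y) us + b *\<^sub>R act n F (\<lambda>vs. G vs z) us"
      if F: "alt_op S n F" and G: "alt_op S m G" for n m F G
    proof -
      note * = linear_op_lin[OF alt_opD(1)[OF G] _ \<open>y \<in> S\<close> \<open>z \<in> S\<close>] alternatingD(3)[OF alt_opD(2)[OF G \<open>y \<in> S\<close>]] alternatingD(3)[OF alt_opD(2)[OF G \<open>z \<in> S\<close>]]
      have "act n F (\<lambda>vs. G vs (a *\<^sub>R y + b *\<^sub>R z)) us = act n F (\<lambda>vs. a *\<^sub>R G vs y + b *\<^sub>R G vs z) us"
        by (rule act_cong[OF F \<open>set us \<subseteq> S\<close> S]) (simp_all add: * subspace_add[OF S] subspace_scale[OF S])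
      then show ?thesis using act_lin[OF F \<open>set us \<subseteq> S\<close> *(2,3)] by simp
    qed
    from this[OF F G] this[OF G F] show ?thesis
      unfolding op_bracket_def by (simp add: algebra_simps)
  qed
  ultimately show ?thesis unfolding alt_op_def linear_op_def by (auto simp: alternatingD(3)[OF alt])
qed

text \<open>Expanding L_F L_G \<beta> by associativity and the derivation rule yields, besides the
  wanted terms, the cross terms F \<and> i(Y) \<beta> and G \<and> i(X) \<beta>. These cancel in the
  graded commutator.\<close>

lemma wedge_op_bracket:
  assumes S: "subspace S" and F: "alt_op S n F" and G: "alt_op S m G" and B: "alternating S \<beta>" and us: "set us \<subseteq> S"
  shows "wedge (n + m) (op_bracket n m F G) \<beta> us =
    (-1) ^ (m * n) *\<^sub>R (act n F (act m G \<beta>) us - insertion (Suc n) (vfield n F) (insertion (Suc m) (vfield m G) \<beta>) us)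
    - (act m G (act n F \<beta>) us - insertion (Suc m) (vfield m G) (insertion (Suc n) (vfield n F) \<beta>) us)"
proof -
  let ?X = "vfield n F" and ?Y = "vfield m G"
  note X = alternating_vfield[OF S F] parity_supported_vfield[OF S F] and Y = alternating_vfield[OF S G] parity_supported_vfield[OF S G]
  have 1: "act n F (act m G \<beta>) us = wedge (n + m) (\<lambda>vs z. wedge n F (\<lambda>xs. G xs z) vs) \<beta> us
     - wedge n F (insertion (Suc m) (vfield m G) \<beta>) us
     - wedge (n + m) (\<lambda>vs z. insertion (Suc n) (vfield n F) (\<lambda>xs. G xs z) vs) \<beta> us
     - (-1) ^ (m * n) *\<^sub>R wedge m G (insertion (Suc n) (vfield n F) \<beta>) us
     + insertion (Suc n) (vfield n F) (insertion (Suc m) (vfield m G) \<beta>) us"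
    if F: "alt_op S n F" and G: "alt_op S m G" for n m F G
  proof -
    note X = alternating_vfield[OF S F] parity_supported_vfield[OF S F] and Y = alternating_vfield[OF S G]
    have "act n F (act m G \<beta>) us = wedge n F (\<lambda>xs. wedge m G \<beta> xs - insertion (Suc m) (vfield m G) \<beta> xs) us
       - insertion (Suc n) (vfield n F) (wedge m G \<beta>) us + insertion (Suc n) (vfield n F) (insertion (Suc m) (vfield m G) \<beta>) us"
      unfolding act_def [abs_def] insertion_diff_form by simp
    also have "wedge n F (\<lambda>xs. wedge m G \<beta> xs - insertion (Suc m) (vfield m G) \<beta> xs) us =
       wedge n F (wedge m G \<beta>) us - wedge n F (insertion (Suc m) (vfield m G) \<beta>) us"
      by (rule wedge_diff_form[OF us alt_opD(1)[OF F]])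
        (simp_all add: alternatingD(3)[OF alternating_wedge[OF S G B]] alternatingD(3)[OF alternating_insertion[OF S Y B]])
    also have "wedge n F (wedge m G \<beta>) us = wedge (n + m) (\<lambda>vs z. wedge n F (\<lambda>xs. G xs z) vs) \<beta> us"
      by (rule wedge_assoc[symmetric, OF us alt_opD(1)[OF F] alt_opD(1)[OF G] _ S]) (rule alternatingD(3)[OF B])
    also have "insertion (Suc n) (vfield n F) (wedge m G \<beta>) us =
      wedge (m + Suc n + 1) (\<lambda>vs z. insertion (Suc n) (vfield n F) (\<lambda>xs. G xs z) vs) \<beta> us
     + (-1) ^ (m * (Suc n + 1)) *\<^sub>R wedge m G (insertion (Suc n) (vfield n F) \<beta>) us"
      by (rule insertion_wedge[OF us alt_opD(1)[OF G] alternatingD(1)[OF B] X(2) _ S S])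
        (simp_all add: alternatingD(3)[OF X(1)] alternatingD(1)[OF alt_opD(2)[OF G]])
    also have "wedge (m + Suc n + 1) (\<lambda>vs z. insertion (Suc n) (vfield n F) (\<lambda>xs. G xs z) vs) \<beta> us
       = wedge (n + m) (\<lambda>vs z. insertion (Suc n) (vfield n F) (\<lambda>xs. G xs z) vs) \<beta> us"
      by (rule wedge_parity) presburger
    finally show ?thesis by (cases m rule: neg_one_pow_cases) (simp_all add: power_add power_mult)
  qed
  have "wedge (n + m) (op_bracket n m F G) \<beta> us = (-1) ^ (m * n) *\<^sub>R
     (wedge (n + m) (\<lambda>vs z. wedge n F (\<lambda>xs. G xs z) vs) \<beta> us
      - wedge (n + m) (\<lambda>vs z. insertion (Suc n) (vfield n F) (\<lambda>xs. G xs z) vs) \<beta> us)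
     - (wedge (n + m) (\<lambda>vs z. wedge m G (\<lambda>xs. F xs z) vs) \<beta> us
      - wedge (n + m) (\<lambda>vs z. insertion (Suc m) (vfield m G) (\<lambda>xs. F xs z) vs) \<beta> us)"
    unfolding op_bracket_def [abs_def] act_def wedge_diff_op wedge_scale_op ..
  then show ?thesis
    unfolding 1[OF F G] 1[OF G F]
    by (cases n rule: neg_one_pow_cases; cases m rule: neg_one_pow_cases)
      (simp_all add: algebra_simps power_mult)
qed

text \<open>By \<open>wedge_op_bracket\<close> it remains to see that inserting the field of the
  bracket gives the graded commutator of the two insertions. That field is found by taking
  \<open>id_form\<close> for \<open>\<beta>\<close> in the same rule.\<close>

lemma act_op_bracket:
  assumes S: "subspace S" and F: "alt_op S n F" and G: "alt_op S m G" and B: "alternating S \<beta>" and us: "set us \<subseteq> S"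
  shows "act (n + m) (op_bracket n m F G) \<beta> us =
    (-1) ^ (m * n) *\<^sub>R act n F (act m G \<beta>) us - act m G (act n F \<beta>) us"
proof -
  let ?X = "vfield n F" and ?Y = "vfield m G"
  note X = alternating_vfield[OF S F] parity_supported_vfield[OF S F] and Y = alternating_vfield[OF S G] parity_supported_vfield[OF S G]
  have l0: "act k H id_form = (\<lambda>us. 0)" for k and H :: "'a list \<Rightarrow> 'a \<Rightarrow> 'a"
    by (rule ext) (simp add: act_def insertion_id_form vfield_def)
  have l00: "act k H (\<lambda>us. 0) us = 0" if "alt_op S k H" "set us \<subseteq> S" for k H us
    unfolding act_def insertion_zero_form wedge_zero_form[OF that(2) alt_opD(1)[OF that(1)] subspace_0[OF S]] by simp
  \<comment> \<open>Both terms with \<open>act\<close> start from \<open>act\<close> of the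
    identity, which is 0; only the two insertions, applied to the identity, survive.\<close>
  have v: "vfield (n + m) (op_bracket n m F G) us =
    (- ((-1) ^ (m * n))) *\<^sub>R insertion (Suc n) ?X ?Y us + 1 *\<^sub>R insertion (Suc m) ?Y ?X us" if "set us \<subseteq> S" for us
    unfolding vfield_def[of "n + m"] wedge_op_bracket[OF S F G alternating_id_form[OF S] that] l0 insertion_id_form
      l00[OF F that] l00[OF G that] by simp
  have "insertion (Suc (n + m)) (vfield (n + m) (op_bracket n m F G)) \<beta> us =
     insertion (Suc (n + m)) (\<lambda>us. (- ((-1) ^ (m * n))) *\<^sub>R insertion (Suc n) ?X ?Y us + 1 *\<^sub>R insertion (Suc m) ?Y ?X us) \<beta> us"
    using v alternatingD(3)[OF alternating_lin[OF S alternating_insertion[OF S X(1) Y(1)] alternating_insertion[OF S Y(1) X(1)]]]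
    by (intro insertion_cong[OF us]) (simp_all only:)
  also have "\<dots> = (- ((-1) ^ (m * n))) *\<^sub>R insertion (Suc (n + m)) (insertion (Suc n) ?X ?Y) \<beta> us
      + 1 *\<^sub>R insertion (Suc (n + m)) (insertion (Suc m) ?Y ?X) \<beta> us"
    by (rule insertion_lin_vec[OF us alternatingD(1)[OF B]])
      (simp_all add: alternatingD(3)[OF alternating_insertion[OF S X(1) Y(1)]] alternatingD(3)[OF alternating_insertion[OF S Y(1) X(1)]])
  finally have v': "insertion (Suc (n + m)) (vfield (n + m) (op_bracket n m F G)) \<beta> us =
     (- ((-1) ^ (m * n))) *\<^sub>R insertion (Suc (n + m)) (insertion (Suc n) ?X ?Y) \<beta> us
      + insertion (Suc (n + m)) (insertion (Suc m) ?Y ?X) \<beta> us" by simp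
  \<comment> \<open>The fields have degrees n + 1 and m + 1, so the sign has exponent (n + 2)(m +
    2), which is nm modulo 2.\<close>
  have "insertion (Suc n) ?X (insertion (Suc m) ?Y \<beta>) us - insertion (Suc n + Suc m + 1) (insertion (Suc n) ?X ?Y) \<beta> us =
     (-1) ^ ((Suc n + 1) * (Suc m + 1)) *\<^sub>R (insertion (Suc m) ?Y (insertion (Suc n) ?X \<beta>) us
       - insertion (Suc n + Suc m + 1) (insertion (Suc m) ?Y ?X) \<beta> us)"
    by (rule insertion_insertion_sym[OF us alternatingD(1,2)[OF B] X(2) _ Y(2) _ S]) (simp_all add: alternatingD(3)[OF X(1)] alternatingD(3)[OF Y(1)])
  moreover have "insertion (Suc n + Suc m + 1) W \<beta> us = insertion (Suc (n + m)) W \<beta> us" for W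
    by (rule insertion_parity) presburger
  ultimately have s: "insertion (Suc n) ?X (insertion (Suc m) ?Y \<beta>) us =
     (-1) ^ (n * m) *\<^sub>R (insertion (Suc m) ?Y (insertion (Suc n) ?X \<beta>) us
       - insertion (Suc (n + m)) (insertion (Suc m) ?Y ?X) \<beta> us) + insertion (Suc (n + m)) (insertion (Suc n) ?X ?Y) \<beta> us"
    unfolding diff_eq_eq
    by (cases n rule: neg_one_pow_cases; cases m rule: neg_one_pow_cases) (simp_all add: power_mult power_add)
  show ?thesis
    unfolding act_def[of "n + m"] v' wedge_op_bracket[OF S F G B us] s
    by (cases n rule: neg_one_pow_cases; cases m rule: neg_one_pow_cases) (simp_all add: algebra_simps power_mult)
qed

text \<open>By \<open>act_op_bracket\<close> both sides are combinations of products such as L_F L_G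
  H_y. Two of the six products cancel on the right and the other four match. Splitting the exponents
  in \<open>sgn\<close> leaves eight sign patterns to check.\<close>

lemma op_bracket_jacobi:
  assumes S: "subspace S" and F: "alt_op S n F" and G: "alt_op S m G" and H: "alt_op S p H"
    and us: "set us \<subseteq> S" and y: "y \<in> S"
  shows "op_bracket n (m + p) F (op_bracket m p G H) us y =
    op_bracket (n + m) p (op_bracket n m F G) H us y + (-1) ^ (n * m) *\<^sub>R op_bracket m (n + p) G (op_bracket n p F H) us y"
proof -
  note alt = alt_opD(2)[OF F y] alt_opD(2)[OF G y] alt_opD(2)[OF H y]
  have *: "act i A (\<lambda>vs. op_bracket j k B C vs y) us = (-1) ^ (k * j) *\<^sub>R act i A (act j B (\<lambda>vs. C vs y)) us
      - act i A (act k C (\<lambda>vs. B vs y)) us" if "alt_op S i A" "alt_op S j B" "alt_op S k C" for i j k A B C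
    unfolding op_bracket_def
    by (rule act_diff[OF that(1) us])
      (simp_all add: alternatingD(3)[OF alternating_act[OF S that(2) alt_opD(2)[OF that(3) y]]]
        alternatingD(3)[OF alternating_act[OF S that(3) alt_opD(2)[OF that(2) y]]])
  have sgn: "(-1::real) ^ ((m + p) * n) = (-1) ^ (m * n) * (-1) ^ (p * n)"
    "(-1::real) ^ (p * (n + m)) = (-1) ^ (p * n) * (-1) ^ (p * m)"
    "(-1::real) ^ ((n + p) * m) = (-1) ^ (m * n) * (-1) ^ (p * m)"
    "(-1::real) ^ (n * m) = (-1) ^ (m * n)"
    by (simp_all add: algebra_simps power_add)
  show ?thesis
    unfolding op_bracket_def[of _ _ "op_bracket n m F G"] op_bracket_def[of _ _ _ "op_bracket m p G H"] op_bracket_def[of _ _ _ "op_bracket n p F H"]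
      *[OF F G H] *[OF G F H] *[OF H F G] act_op_bracket[OF S F G alt(3) us]
      act_op_bracket[OF S F H alt(2) us] act_op_bracket[OF S G H alt(1) us]
    sgn
    by (cases "m * n" rule: neg_one_pow_cases; cases "p * n" rule: neg_one_pow_cases;
        cases "p * m" rule: neg_one_pow_cases) (simp_all only: algebra_simps; simp)+
qed

section \<open>Sums over unshuffles\<close>

text \<open>An unshuffle takes the value 0 at the beginning \<open>p\<close> of some block. It factors as
  \<open>shift_up \<tau> \<circ> front_cycle p\<close>, where \<open>\<tau>\<close> is an unshuffle for the blocks with this entry removed.\<close>

definition front_cycle :: "nat \<Rightarrow> nat \<Rightarrow> nat" where
  "front_cycle p i = (if i < p then Suc i else if i = p then 0 else i)"

definition shift_up :: "(nat \<Rightarrow> nat) \<Rightarrow> nat \<Rightarrow> nat" where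
  "shift_up \<tau> i = (case i of 0 \<Rightarrow> 0 | Suc k \<Rightarrow> Suc (\<tau> k))"

lemma shift_up_simps [simp]: "shift_up \<tau> 0 = 0" "shift_up \<tau> (Suc k) = Suc (\<tau> k)"
  by (simp_all add: shift_up_def)

lemma front_cycle_Suc: "front_cycle (Suc p) = Transposition.transpose 0 (Suc p) \<circ> front_cycle p"
  by (auto simp: fun_eq_iff front_cycle_def Transposition.transpose_def)

text \<open>A cycle on \<open>p + 1\<close> points is a product of \<open>p\<close> transpositions,
  each exchanging 0 with the next point.\<close>

lemma front_cycle_sign: "front_cycle p permutes {..p} \<and> sign (front_cycle p) = (-1) ^ p"
proof (induction p)
  case 0
  have e: "front_cycle 0 = id" by (rule ext) (simp add: front_cycle_def)
  show ?case unfolding e using permutes_id[of "{..0}"] sign_id by (simp only: power_0)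
next
  case (Suc p)
  have t: "Transposition.transpose 0 (Suc p) permutes {..Suc p}" by (rule permutes_swap_id) auto
  have c: "front_cycle p permutes {..Suc p}" using Suc by (rule_tac permutes_subset) auto
  have "permutation (front_cycle p)" using c permutation_permutes by blast
  then have "sign (front_cycle (Suc p)) = - sign (front_cycle p)"
    unfolding front_cycle_Suc by (subst sign_compose) (auto simp: sign_swap_id permutation_swap_id)
  then have "sign (front_cycle (Suc p)) = (-1) ^ Suc p" using Suc by simp
  then show ?case using permutes_compose[OF c t] unfolding front_cycle_Suc by blast
qed

lemma shift_up_sign:
  assumes "\<tau> permutes {..<N}" shows "shift_up \<tau> permutes {..<Suc N} \<and> sign (shift_up \<tau>) = sign \<tau>"
  using assms finite_lessThan
proof (induction rule: permutes_induct)
  case id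
  have e: "shift_up id = id" by (auto simp: fun_eq_iff shift_up_def split: nat.splits)
  show ?case unfolding e by (intro conjI permutes_id refl)
next
  case (swap a b p)
  have e: "shift_up (Transposition.transpose a b \<circ> p) = Transposition.transpose (Suc a) (Suc b) \<circ> shift_up p"
    by (auto simp: fun_eq_iff shift_up_def Transposition.transpose_def split: nat.splits)
  have t: "Transposition.transpose (Suc a) (Suc b) permutes {..<Suc N}"
    using swap by (intro permutes_swap_id) auto
  have "permutation (shift_up p)" "permutation p" using swap permutation_permutes by blast+
  then have "sign (Transposition.transpose (Suc a) (Suc b) \<circ> shift_up p) = - sign p"
    "sign (Transposition.transpose a b \<circ> p) = - sign p"
    using swap by (subst sign_compose; simp add: sign_swap_id permutation_swap_id)+
  then show ?case
    unfolding e using swap permutes_compose[OF _ t] by metis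
qed

lemma shift_up_front_cycle: "(shift_up \<tau> \<circ> front_cycle p) i = (if i < p then Suc (\<tau> i) else if i = p then 0 else Suc (\<tau> (i - 1)))"
  by (auto simp: front_cycle_def shift_up_def split: nat.splits)

lemma shift_up_front_cycle_permutes:
  assumes "\<tau> permutes {..<N}" "p \<le> N"
  shows "shift_up \<tau> \<circ> front_cycle p permutes {..<Suc N}" "sign (shift_up \<tau> \<circ> front_cycle p) = (-1) ^ p * sign \<tau>"
proof -
  have c: "front_cycle p permutes {..<Suc N}" using front_cycle_sign[of p] assms by (rule_tac permutes_subset[of _ "{..p}"]) auto
  show "shift_up \<tau> \<circ> front_cycle p permutes {..<Suc N}" using shift_up_sign[OF assms(1)] c by (simp add: permutes_compose)
  have "permutation (front_cycle p)" "permutation (shift_up \<tau>)" using c shift_up_sign[OF assms(1)] permutation_permutes by blast+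
  then show "sign (shift_up \<tau> \<circ> front_cycle p) = (-1) ^ p * sign \<tau>"
    using front_cycle_sign[of p] shift_up_sign[OF assms(1)] by (simp add: sign_compose)
qed

lemma shift_up_front_cycle_inj: "shift_up \<tau> \<circ> front_cycle p = shift_up \<tau>' \<circ> front_cycle p' \<longleftrightarrow> p = p' \<and> \<tau> = \<tau>'"
proof
  assume *: "shift_up \<tau> \<circ> front_cycle p = shift_up \<tau>' \<circ> front_cycle p'"
  have p: "p = p'" using fun_cong[OF *, of p, unfolded shift_up_front_cycle] by (simp split: if_splits)
  have "\<tau> i = \<tau>' i" for i
    using fun_cong[OF *, of "if i < p then i else Suc i", unfolded shift_up_front_cycle] p by (simp split: if_splits)
  then show "p = p' \<and> \<tau> = \<tau>'" using p by auto
qed auto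

lemma permutes_shift_up_front_cycle_ex:
  assumes "\<sigma> permutes {..<Suc N}" "\<sigma> p = 0" "p \<le> N"
  obtains \<tau> where "\<tau> permutes {..<N}" "\<sigma> = shift_up \<tau> \<circ> front_cycle p"
proof -
  \<comment> \<open>The inverse cycle takes 0 to \<open>p\<close>, which \<open>\<sigma>\<close>
    takes back to 0. Thus \<open>?r\<close> fixes 0 and is a shifted permutation.\<close>
  let ?r = "\<sigma> \<circ> inv (front_cycle p)"
  have c: "front_cycle p permutes {..<Suc N}" using front_cycle_sign[of p] assms by (rule_tac permutes_subset[of _ "{..p}"]) auto
  have r: "?r permutes {..<Suc N}" by (rule permutes_compose[OF permutes_inv[OF c] assms(1)])
  have "inv (front_cycle p) 0 = p" using permutes_inv_eq[OF c] by (simp add: front_cycle_def)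
  then have r0: "?r 0 = 0" using assms by simp
  have inj: "inj ?r" using permutes_inj[OF r] .
  have rS: "?r (Suc i) \<noteq> 0" for i using injD[OF inj, of "Suc i" 0] r0 by auto
  define \<tau> where "\<tau> i = ?r (Suc i) - 1" for i
  have u: "shift_up \<tau> i = ?r i" for i using r0 rS[of "i - 1"] by (cases i) (simp_all add: \<tau>_def)
  have "\<tau> permutes {..<N}"
  proof -
    have "inj \<tau>"
    proof (rule injI)
      fix i j assume "\<tau> i = \<tau> j"
      then have "?r (Suc i) = ?r (Suc j)" using u[of "Suc i"] u[of "Suc j"] by simp
      then show "i = j" using injD[OF inj] by blast
    qed
    moreover have "\<exists>x. \<tau> x = y" for y
    proof -
      obtain z where z: "?r z = Suc y" using permutes_surj[OF r] by (metis surjD)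
      then have "z \<noteq> 0" using r0 by (cases z) auto
      then obtain x where "z = Suc x" using not0_implies_Suc by blast
      then have "\<tau> x = y" using z unfolding \<tau>_def by simp
      then show ?thesis ..
    qed
    moreover have "\<tau> x = x" if "x \<notin> {..<N}" for x
      using permutes_not_in[OF r, of "Suc x"] that unfolding \<tau>_def by simp
    ultimately show ?thesis unfolding permutes_def inj_def by metis
  qed
  moreover have "\<sigma> = shift_up \<tau> \<circ> front_cycle p"
  proof
    fix i
    have "inv (front_cycle p) (front_cycle p i) = i" using permutes_inverses(2)[OF c] .
    then show "\<sigma> i = (shift_up \<tau> \<circ> front_cycle p) i" using u[of "front_cycle p i"] by simp
  qed
  ultimately show ?thesis using that by blast
qed

section \<open>Block boundaries and the recursion for unshuffles\<close>

lemma sum_list_take_Suc: "j < length ks \<Longrightarrow> sum_list (take (Suc j) ks) = sum_list (take j ks) + (ks ! j :: nat)"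
  by (simp add: take_Suc_conv_app_nth)

lemma sum_list_take_mono: "i \<le> j \<Longrightarrow> sum_list (take i ks) \<le> sum_list (take j (ks :: nat list))"
proof -
  assume "i \<le> j"
  then have "take j ks = take i ks @ take (j - i) (drop i ks)" by (metis le_add_diff_inverse take_add)
  then show ?thesis by simp
qed

lemma sum_list_take_le: "sum_list (take i ks) \<le> sum_list (ks :: nat list)"
  using sum_list_take_mono[of i "max i (length ks)" ks] by simp

lemma sum_list_take_upd:
  assumes "j < length ks" "0 < ks ! j"
  shows "sum_list (take i (ks[j := ks ! j - 1])) =
    (if i \<le> j then sum_list (take i ks) else sum_list (take i ks) - (1::nat))"
proof (cases "i \<le> j")
  case True
  then show ?thesis by simp
next
  case False
  have "take i (ks[j := ks ! j - 1]) = (take i ks)[j := ks ! j - 1]" by (simp add: take_update_swap)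
  moreover have "ks ! j \<le> sum_list (take i ks)"
    using sum_list_take_Suc[OF assms(1)] sum_list_take_mono[of "Suc j" i ks] False by simp
  ultimately show ?thesis using False assms
    by (simp add: sum_list_update)
qed

lemma block_exists:
  "p < sum_list (ks :: nat list) \<Longrightarrow> \<exists>j<length ks. sum_list (take j ks) \<le> p \<and> p < sum_list (take (Suc j) ks)"
proof (induction ks arbitrary: p)
  case (Cons k ks)
  show ?case
  proof (cases "p < k")
    case True
    then show ?thesis by (intro exI[of _ 0]) simp
  next
    case False
    then have "p - k < sum_list ks" using Cons.prems by simp
    then obtain j where "j < length ks" "sum_list (take j ks) \<le> p - k" "p - k < sum_list (take (Suc j) ks)"
      using Cons.IH by blast
    then show ?thesis using False by (intro exI[of _ "Suc j"]) auto
  qed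
qed simp

text \<open>The first position of block \<open>j\<close> carries the value 0, below all shifted
  values, and so imposes no condition inside its block. Earlier blocks keep their positions, and
  later blocks start one position earlier for \<open>\<tau>\<close>.\<close>

lemma unshuffles_shift_up_front_cycle:
  assumes N: "sum_list ks = Suc N" and j: "j < length ks" "0 < ks ! j" and \<tau>: "\<tau> permutes {..<N}"
  shows "shift_up \<tau> \<circ> front_cycle (sum_list (take j ks)) \<in> unshuffles ks \<longleftrightarrow> \<tau> \<in> unshuffles (ks[j := ks ! j - 1])"
proof -
  define P where "P i = sum_list (take i ks)" for i
  let ?p = "P j" and ?ks = "ks[j := ks ! j - 1]"
  have PS: "P (Suc j) = ?p + ks ! j" unfolding P_def by (rule sum_list_take_Suc[OF j(1)])
  have mono: "i \<le> i' \<Longrightarrow> P i \<le> P i'" for i i' unfolding P_def by (rule sum_list_take_mono)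
  have P': "sum_list (take i ?ks) = (if i \<le> j then P i else P i - 1)" for i
    using sum_list_take_upd[OF j] by (simp add: P_def)
  have "P (Suc j) \<le> Suc N" using sum_list_take_le[of "Suc j" ks] N by (simp add: P_def)
  then have pN: "?p \<le> N" using PS j by simp
  have sN: "sum_list ?ks = N" using P'[of "length ks"] j N by (simp add: P_def)
  have "strict_mono_on {P i..<P (Suc i)} (shift_up \<tau> \<circ> front_cycle ?p) \<longleftrightarrow>
      strict_mono_on {sum_list (take i ?ks)..<sum_list (take (Suc i) ?ks)} \<tau>" if i: "i < length ks" for i
  proof -
    consider "i < j" | "i = j" | "i > j" by linarith
    then show ?thesis
    proof cases
      case 1
      then have "x < ?p" if "x < P (Suc i)" for x using mono[of "Suc i" j] that by simp
      then show ?thesis using 1 unfolding P' strict_mono_on_def shift_up_front_cycle by auto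
    next
      case 2
      have "strict_mono_on {?p..<P (Suc j)} (shift_up \<tau> \<circ> front_cycle ?p) \<longleftrightarrow> strict_mono_on {?p..<P (Suc j) - 1} \<tau>"
      proof
        assume *: "strict_mono_on {?p..<P (Suc j)} (shift_up \<tau> \<circ> front_cycle ?p)"
        show "strict_mono_on {?p..<P (Suc j) - 1} \<tau>"
        proof (rule strict_mono_onI)
          fix r s assume "r \<in> {?p..<P (Suc j) - 1}" "s \<in> {?p..<P (Suc j) - 1}" "r < s"
          then show "\<tau> r < \<tau> s" using strict_mono_onD[OF *, of "Suc r" "Suc s"] unfolding shift_up_front_cycle by simp
        qed
      next
        assume *: "strict_mono_on {?p..<P (Suc j) - 1} \<tau>"
        show "strict_mono_on {?p..<P (Suc j)} (shift_up \<tau> \<circ> front_cycle ?p)"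
        proof (rule strict_mono_onI)
          fix r s assume "r \<in> {?p..<P (Suc j)}" "s \<in> {?p..<P (Suc j)}" "r < s"
          then show "(shift_up \<tau> \<circ> front_cycle ?p) r < (shift_up \<tau> \<circ> front_cycle ?p) s"
            using strict_mono_onD[OF *, of "r - 1" "s - 1"] unfolding shift_up_front_cycle by auto
        qed
      qed
      then show ?thesis using 2 P'[of j] P'[of "Suc j"] by simp
    next
      case 3
      have g: "?p < P i" using mono[of "Suc j" i] PS j 3 by simp
      have "strict_mono_on {P i..<P (Suc i)} (shift_up \<tau> \<circ> front_cycle ?p) \<longleftrightarrow> strict_mono_on {P i - 1..<P (Suc i) - 1} \<tau>"
      proof
        assume *: "strict_mono_on {P i..<P (Suc i)} (shift_up \<tau> \<circ> front_cycle ?p)"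
        show "strict_mono_on {P i - 1..<P (Suc i) - 1} \<tau>"
        proof (rule strict_mono_onI)
          fix r s assume "r \<in> {P i - 1..<P (Suc i) - 1}" "s \<in> {P i - 1..<P (Suc i) - 1}" "r < s"
          then show "\<tau> r < \<tau> s" using g strict_mono_onD[OF *, of "Suc r" "Suc s"] unfolding shift_up_front_cycle by simp
        qed
      next
        assume *: "strict_mono_on {P i - 1..<P (Suc i) - 1} \<tau>"
        show "strict_mono_on {P i..<P (Suc i)} (shift_up \<tau> \<circ> front_cycle ?p)"
        proof (rule strict_mono_onI)
          fix r s assume "r \<in> {P i..<P (Suc i)}" "s \<in> {P i..<P (Suc i)}" "r < s"
          then show "(shift_up \<tau> \<circ> front_cycle ?p) r < (shift_up \<tau> \<circ> front_cycle ?p) s"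
            using g strict_mono_onD[OF *, of "r - 1" "s - 1"] unfolding shift_up_front_cycle by auto
        qed
      qed
      then show ?thesis unfolding P' using 3 by simp
    qed
  qed
  then show ?thesis
    unfolding unshuffles_def using shift_up_front_cycle_permutes(1)[OF \<tau> pN] \<tau> sN N by (auto simp: P_def)
qed

lemma unshuffles_Suc:
  assumes N: "sum_list ks = Suc N"
  shows "unshuffles ks = (\<Union>j\<in>{j. j < length ks \<and> 0 < ks ! j}.
     (\<lambda>\<tau>. shift_up \<tau> \<circ> front_cycle (sum_list (take j ks))) ` unshuffles (ks[j := ks ! j - 1]))" (is "_ = ?R")
proof -
  have perm: "\<tau> permutes {..<N}" if "\<tau> \<in> unshuffles (ks[j := ks ! j - 1])" "j < length ks" "0 < ks ! j" for j \<tau>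
    using that sum_list_take_upd[of j ks "length ks"] N unfolding unshuffles_def by simp
  have "\<sigma> \<in> ?R" if s: "\<sigma> \<in> unshuffles ks" for \<sigma>
  proof -
    have p: "\<sigma> permutes {..<Suc N}" using s N unfolding unshuffles_def by simp
    define p where "p = inv \<sigma> 0"
    have p0: "\<sigma> p = 0" unfolding p_def using permutes_inverses(1)[OF p] .
    then have "p < Suc N" using permutes_not_in[OF p, of p] by force
    then obtain j where j: "j < length ks" "sum_list (take j ks) \<le> p" "p < sum_list (take (Suc j) ks)"
      using block_exists[of p ks] N by auto
    have "p = sum_list (take j ks)"
    proof (rule ccontr)
      assume "p \<noteq> sum_list (take j ks)"
      moreover have "strict_mono_on {sum_list (take j ks)..<sum_list (take (Suc j) ks)} \<sigma>"
        using s j unfolding unshuffles_def by simp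
      ultimately have "\<sigma> (sum_list (take j ks)) < \<sigma> p"
        using j strict_mono_onD[of _ \<sigma> "sum_list (take j ks)" p] by force
      then show False using p0 by simp
    qed
    moreover have "0 < ks ! j" using j sum_list_take_Suc[OF j(1)] by simp
    moreover obtain \<tau> where "\<tau> permutes {..<N}" "\<sigma> = shift_up \<tau> \<circ> front_cycle p"
      using permutes_shift_up_front_cycle_ex[OF p p0] \<open>p < Suc N\<close> by auto
    ultimately show ?thesis using unshuffles_shift_up_front_cycle[OF N j(1)] s j(1) by auto
  qed
  then show ?thesis using unshuffles_shift_up_front_cycle[OF N] perm by blast
qed

lemma finite_unshuffles: "finite (unshuffles ks)"
  unfolding unshuffles_def by (rule finite_subset[OF _ finite_permutations[of "{..<sum_list ks}"]]) auto

text \<open>All blocks are handed to \<open>f\<close> as one list, so that sums with two and with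
  three blocks share one recursion.\<close>

definition unshuffle_sum :: "nat list \<Rightarrow> ('s list \<Rightarrow> 'b) \<Rightarrow> 's list \<Rightarrow> 'b::real_vector" where
  "unshuffle_sum ks f us = (\<Sum>\<sigma>\<in>unshuffles ks. of_int (sign \<sigma>) *\<^sub>R f (map (\<lambda>k. us ! \<sigma> k) [0..<sum_list ks]))"

lemma unshuffle_sum_Nil: "sum_list ks = 0 \<Longrightarrow> unshuffle_sum ks f us = f []"
proof -
  assume 0: "sum_list ks = 0"
  have "sum_list (take i ks) = 0" for i using sum_list_take_le[of i ks] 0 by simp
  then have "\<sigma> \<in> unshuffles ks \<longleftrightarrow> \<sigma> = id" for \<sigma>
    unfolding unshuffles_def mem_Collect_eq 0 by (auto simp: strict_mono_on_def)
  then have "unshuffles ks = {id}" by blast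
  then show ?thesis using 0 by (simp add: unshuffle_sum_def)
qed

lemma unshuffle_sum_cong:
  "(\<And>w. length w = sum_list ks \<Longrightarrow> f w = g w) \<Longrightarrow> unshuffle_sum ks f us = unshuffle_sum ks g us"
  unfolding unshuffle_sum_def by (intro sum.cong) auto

text \<open>The head has index 0, which an unshuffle places at the beginning of a nonempty block.
  Moving it there past all earlier blocks gives the sign.\<close>

lemma unshuffle_sum_Cons:
  assumes N: "sum_list ks = Suc (length us)"
  shows "unshuffle_sum ks f (a # us) = (\<Sum>j<length ks. if 0 < ks ! j then
     (-1) ^ sum_list (take j ks) *\<^sub>R unshuffle_sum (ks[j := ks ! j - 1])
        (\<lambda>w. f (take (sum_list (take j ks)) w @ a # drop (sum_list (take j ks)) w)) us else 0)"
proof -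
  let ?N = "length us"
  let ?P = "\<lambda>j. sum_list (take j ks)"
  let ?J = "{j. j < length ks \<and> 0 < ks ! j}"
  let ?g = "\<lambda>\<sigma>. of_int (sign \<sigma>) *\<^sub>R f (map (\<lambda>k. (a # us) ! \<sigma> k) [0..<Suc ?N])"
  \<comment> \<open>Different nonempty blocks begin at different positions, which makes the union
    over \<open>j\<close> disjoint.\<close>
  have less: "?P i < ?P j" if "i \<in> ?J" "i < j" for i j
    using that sum_list_take_mono[of "Suc i" j ks] sum_list_take_Suc[of i ks] by simp
  have disj: "i = j" if "?P i = ?P j" "i \<in> ?J" "j \<in> ?J" for i j
    using less[of i j] less[of j i] that by (metis less_irrefl nat_neq_iff)
  have sN: "sum_list (ks[j := ks ! j - 1]) = ?N" if "j \<in> ?J" for j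
    using sum_list_take_upd[of j ks "length ks"] that N by simp
  have le: "?P j \<le> ?N" if "j \<in> ?J" for j
    using sum_list_take_Suc[of j ks] sum_list_take_le[of "Suc j" ks] that N by simp
  have perm: "\<tau> permutes {..<?N}" if "\<tau> \<in> unshuffles (ks[j := ks ! j - 1])" "j \<in> ?J" for j \<tau>
    using that sN[of j] unfolding unshuffles_def by simp
  have "unshuffle_sum ks f (a # us) = sum ?g (unshuffles ks)" unfolding unshuffle_sum_def N ..
  also have "\<dots> = (\<Sum>j\<in>?J. sum ?g ((\<lambda>\<tau>. shift_up \<tau> \<circ> front_cycle (?P j)) ` unshuffles (ks[j := ks ! j - 1])))"
    unfolding unshuffles_Suc[OF N]
  proof (rule sum.UNION_disjoint)
    show "\<forall>i\<in>?J. \<forall>j\<in>?J. i \<noteq> j \<longrightarrow>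
       (\<lambda>\<tau>. shift_up \<tau> \<circ> front_cycle (?P i)) ` unshuffles (ks[i := ks ! i - 1]) \<inter>
       (\<lambda>\<tau>. shift_up \<tau> \<circ> front_cycle (?P j)) ` unshuffles (ks[j := ks ! j - 1]) = {}"
    proof (intro ballI impI equals0I)
      fix i j \<sigma> assume *: "i \<in> ?J" "j \<in> ?J" "i \<noteq> j"
        "\<sigma> \<in> (\<lambda>\<tau>. shift_up \<tau> \<circ> front_cycle (?P i)) ` unshuffles (ks[i := ks ! i - 1]) \<inter>
         (\<lambda>\<tau>. shift_up \<tau> \<circ> front_cycle (?P j)) ` unshuffles (ks[j := ks ! j - 1])"
      then obtain \<tau> \<tau>' where "shift_up \<tau> \<circ> front_cycle (?P i) = shift_up \<tau>' \<circ> front_cycle (?P j)" by blast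
      then show False using disj[OF _ *(1,2)] *(3) unfolding shift_up_front_cycle_inj by blast
    qed
  qed (simp_all add: finite_unshuffles)
  also have "\<dots> = (\<Sum>j\<in>?J. (-1) ^ ?P j *\<^sub>R unshuffle_sum (ks[j := ks ! j - 1]) (\<lambda>w. f (take (?P j) w @ a # drop (?P j) w)) us)"
  proof (rule sum.cong[OF refl])
    fix j assume j: "j \<in> ?J"
    let ?U = "unshuffles (ks[j := ks ! j - 1])"
    have m: "map (\<lambda>k. (a # us) ! (shift_up \<tau> \<circ> front_cycle (?P j)) k) [0..<Suc ?N] =
       take (?P j) (map (\<lambda>k. us ! \<tau> k) [0..<?N]) @ a # drop (?P j) (map (\<lambda>k. us ! \<tau> k) [0..<?N])" for \<tau>
      by (rule nth_equalityI) (use le[OF j] in \<open>auto simp: shift_up_front_cycle nth_append nth_Cons' simp del: upt_Suc o_apply\<close>)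
    have "sum ?g ((\<lambda>\<tau>. shift_up \<tau> \<circ> front_cycle (?P j)) ` ?U) = (\<Sum>\<tau>\<in>?U. ?g (shift_up \<tau> \<circ> front_cycle (?P j)))"
      by (subst sum.reindex) (auto simp: inj_on_def shift_up_front_cycle_inj)
    also have "\<dots> = (\<Sum>\<tau>\<in>?U. (-1) ^ ?P j *\<^sub>R (of_int (sign \<tau>) *\<^sub>R
        f (take (?P j) (map (\<lambda>k. us ! \<tau> k) [0..<?N]) @ a # drop (?P j) (map (\<lambda>k. us ! \<tau> k) [0..<?N]))))"
      by (rule sum.cong[OF refl]) (simp only: m shift_up_front_cycle_permutes(2)[OF perm[OF _ j] le[OF j]] of_int_mult of_int_power of_int_minus of_int_1 scaleR_scaleR)
    finally show "sum ?g ((\<lambda>\<tau>. shift_up \<tau> \<circ> front_cycle (?P j)) ` ?U) =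
      (-1) ^ ?P j *\<^sub>R unshuffle_sum (ks[j := ks ! j - 1]) (\<lambda>w. f (take (?P j) w @ a # drop (?P j) w)) us"
      unfolding unshuffle_sum_def sN[OF j] by (simp only: scaleR_right.sum)
  qed
  also have "\<dots> = (\<Sum>j<length ks. if 0 < ks ! j then
     (-1) ^ ?P j *\<^sub>R unshuffle_sum (ks[j := ks ! j - 1]) (\<lambda>w. f (take (?P j) w @ a # drop (?P j) w)) us else 0)"
    by (rule sum.mono_neutral_cong_left) auto
  finally show ?thesis .
qed

section \<open>Sums over unshuffles as wedges and insertions\<close>

lemma wedge_eq_0_op:
  assumes "set us \<subseteq> S" "\<And>xs z. set xs \<subseteq> S \<Longrightarrow> z \<in> Z \<Longrightarrow> F xs z = 0" "\<And>xs. set xs \<subseteq> S \<Longrightarrow> \<beta> xs \<in> Z"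
  shows "wedge k F \<beta> us = 0"
  using wedge_cong[of us S Z F "\<lambda>_ _. 0" \<beta> \<beta> k] assms by (simp add: wedge_zero_op)

lemma wedge_eq_0_form:
  assumes "set us \<subseteq> S" "linear_op S Z F" "subspace Z" "\<And>xs. set xs \<subseteq> S \<Longrightarrow> \<beta> xs = 0"
  shows "wedge k F \<beta> us = 0"
  using wedge_cong[of us S Z F F \<beta> "\<lambda>_. 0" k] assms wedge_zero_form[of us S Z F k]
  by (simp add: subspace_0)

lemma supported_eq_0: "supported S P \<beta> \<Longrightarrow> set us \<subseteq> S \<Longrightarrow> \<not> P (length us) \<Longrightarrow> \<beta> us = 0"
  unfolding supported_def by blast

text \<open>The recursion of the sum skips an empty block, while \<open>wedge\<close> always expands
  both terms. The additional term vanishes: the factor belonging to an empty block has degree 0 but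
  has received the head.\<close>

lemma unshuffle_sum_wedge:
  assumes "subspace S" "linear_op S S F" "\<And>z. z \<in> S \<Longrightarrow> supported S (\<lambda>i. i = n) (\<lambda>xs. F xs z)"
    "supported S (\<lambda>i. i = m) \<beta>" "\<And>xs. set xs \<subseteq> S \<Longrightarrow> \<beta> xs \<in> S"
    "set us \<subseteq> S" "length us = n + m"
  shows "unshuffle_sum [n, m] (\<lambda>w. F (take n w) (\<beta> (drop n w))) us = wedge n F \<beta> us"
  using assms(2-)
proof (induction us arbitrary: n m F \<beta>)
  case Nil
  then show ?case by (simp add: unshuffle_sum_Nil)
next
  case (Cons a us)
  note P = Cons.prems
  have a: "a \<in> S" and us: "set us \<subseteq> S" and l: "length us + 1 = n + m" using P by auto
  have 1: "(if 0 < n then unshuffle_sum [n - 1, m] (\<lambda>w. F (take n (a # w)) (\<beta> (drop n (a # w)))) us else 0)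
      = wedge (Suc n) (\<lambda>vs. F (a # vs)) \<beta> us"
  proof (cases n)
    case 0
    have "F (a # xs) z = 0" if "set xs \<subseteq> S" "z \<in> S" for xs z
      using supported_eq_0[OF P(2)[OF that(2)], of "a # xs"] that a 0 by simp
    then show ?thesis using 0 wedge_eq_0_op[OF us, of S "\<lambda>vs. F (a # vs)"] P(4) by simp
  next
    case (Suc k)
    have s: "supported S (\<lambda>i. i = k) (\<lambda>xs. F (a # xs) z)" if "z \<in> S" for z
      using supported_Cons[OF P(2)[OF that] a] Suc by simp
    have "unshuffle_sum [k, m] (\<lambda>w. F (a # take k w) (\<beta> (drop k w))) us = wedge k (\<lambda>vs. F (a # vs)) \<beta> us"
      by (rule Cons.IH[OF linear_op_Cons[OF P(1) a] s P(3,4) us]) (use l Suc in simp_all)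
    then show ?thesis using Suc wedge_parity[of k "Suc n"] by simp
  qed
  have 2: "(if 0 < m then unshuffle_sum [n, m - 1] (\<lambda>w. F (take n (take n w @ a # drop n w)) (\<beta> (drop n (take n w @ a # drop n w)))) us else 0)
      = wedge n F (\<lambda>vs. \<beta> (a # vs)) us"
  proof (cases m)
    case 0
    have "\<beta> (a # xs) = 0" if "set xs \<subseteq> S" for xs
      using supported_eq_0[OF P(3), of "a # xs"] that a 0 by simp
    then show ?thesis using 0 wedge_eq_0_form[OF us P(1) assms(1), of "\<lambda>vs. \<beta> (a # vs)"] by simp
  next
    case (Suc k)
    have s: "supported S (\<lambda>i. i = k) (\<lambda>xs. \<beta> (a # xs))"
      using supported_Cons[OF P(3) a] Suc by simp
    have "unshuffle_sum [n, k] (\<lambda>w. F (take n (take n w @ a # drop n w)) (\<beta> (drop n (take n w @ a # drop n w)))) us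
      = unshuffle_sum [n, k] (\<lambda>w. F (take n w) (\<beta> (a # drop n w))) us"
      by (rule unshuffle_sum_cong) simp
    also have "\<dots> = wedge n F (\<lambda>vs. \<beta> (a # vs)) us"
      by (rule Cons.IH[OF P(1,2) s _ us]) (use l Suc P a in simp_all)
    finally show ?thesis using Suc by simp
  qed
  have "sum_list [n, m] = Suc (length us)" using l by simp
  from unshuffle_sum_Cons[OF this, of "\<lambda>w. F (take n w) (\<beta> (drop n w))" a]
  have "unshuffle_sum [n, m] (\<lambda>w. F (take n w) (\<beta> (drop n w))) (a # us) =
     (if 0 < n then unshuffle_sum [n - 1, m] (\<lambda>w. F (take n (a # w)) (\<beta> (drop n (a # w)))) us else 0)
     + (-1) ^ n *\<^sub>R (if 0 < m then unshuffle_sum [n, m - 1] (\<lambda>w. F (take n (take n w @ a # drop n w)) (\<beta> (drop n (take n w @ a # drop n w)))) us else 0)"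
    by (simp add: numeral_2_eq_2 lessThan_Suc)
  then show ?case unfolding 1 2 wedge_Cons .
qed

text \<open>In the application the middle block has length 1 and \<open>\<gamma>\<close> is the
  identity. A general length is needed for the induction, which may take the head out of any
  block.\<close>

lemma unshuffle_sum_insertion:
  assumes S: "subspace S" and "linear_op S S G" "\<And>z. z \<in> S \<Longrightarrow> supported S (\<lambda>i. i = p) (\<lambda>xs. G xs z)"
    "supported S (\<lambda>i. i = r) \<gamma>" "\<And>xs. set xs \<subseteq> S \<Longrightarrow> \<gamma> xs \<in> S"
    "supported S (\<lambda>i. i = Suc q) \<beta>" "mlinear S S \<beta>" "skewf S \<beta>"
    "set us \<subseteq> S" "length us = p + r + q"
  shows "unshuffle_sum [p, r, q] (\<lambda>w. \<beta> (G (take p w) (\<gamma> (take r (drop p w))) # drop (p + r) w)) us =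
    insertion (p + r) (wedge p G \<gamma>) \<beta> us"
  using assms(2-)
proof (induction us arbitrary: p q r G \<gamma> \<beta>)
  case Nil
  then show ?case by (simp add: unshuffle_sum_Nil)
next
  case (Cons a us)
  note P = Cons.prems
  have a: "a \<in> S" and us: "set us \<subseteq> S" and l: "length us + 1 = p + r + q" using P by auto
  let ?I = "\<lambda>k w. take k w @ a # drop k w"
  let ?f = "\<lambda>w. \<beta> (G (take p w) (\<gamma> (take r (drop p w))) # drop (p + r) w)"
  have Y: "wedge k G' \<gamma>' xs \<in> S" if "linear_op S S G'" "\<And>xs. set xs \<subseteq> S \<Longrightarrow> \<gamma>' xs \<in> S" "set xs \<subseteq> S" for k G' \<gamma>' xs
    by (rule wedge_in[OF that(3) S, of S]) (use that in \<open>auto simp: linear_op_in\<close>)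
  have \<gamma>a: "\<And>xs. set xs \<subseteq> S \<Longrightarrow> \<gamma> (a # xs) \<in> S" using P(4) a by simp
  have 1: "(if 0 < p then unshuffle_sum [p - 1, r, q] (\<lambda>w. ?f (a # w)) us else 0)
      = insertion (Suc (p + r)) (wedge (Suc p) (\<lambda>vs. G (a # vs)) \<gamma>) \<beta> us"
  proof (cases p)
    case 0
    have "G (a # xs) z = 0" if "set xs \<subseteq> S" "z \<in> S" for xs z
      using supported_eq_0[OF P(2)[OF that(2)], of "a # xs"] that a 0 by simp
    then have "wedge (Suc p) (\<lambda>vs. G (a # vs)) \<gamma> xs = 0" if "set xs \<subseteq> S" for xs
      using wedge_eq_0_op[OF that, of S "\<lambda>vs. G (a # vs)" \<gamma>] P(4) by blast
    then have "insertion (Suc (p + r)) (wedge (Suc p) (\<lambda>vs. G (a # vs)) \<gamma>) \<beta> us = insertion (Suc (p + r)) (\<lambda>_. 0) \<beta> us"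
      by (intro insertion_cong[OF us]) (simp_all add: subspace_0[OF S])
    then show ?thesis using 0 insertion_zero_vec[OF us P(6) subspace_0[OF S]] by simp
  next
    case (Suc k)
    have s: "supported S (\<lambda>i. i = k) (\<lambda>xs. G (a # xs) z)" if "z \<in> S" for z
      using supported_Cons[OF P(2)[OF that] a] Suc by simp
    have "unshuffle_sum [k, r, q] (\<lambda>w. \<beta> (G (a # take k w) (\<gamma> (take r (drop k w))) # drop (k + r) w)) us
       = insertion (k + r) (wedge k (\<lambda>vs. G (a # vs)) \<gamma>) \<beta> us"
      by (rule Cons.IH[OF linear_op_Cons[OF P(1) a] s P(3-7) us]) (use l Suc in simp_all)
    also have "\<dots> = insertion (k + r) (wedge (Suc p) (\<lambda>vs. G (a # vs)) \<gamma>) \<beta> us"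
      using wedge_parity[of k "Suc p"] Suc by (intro insertion_cong[OF us]) (simp_all add: Y[OF linear_op_Cons[OF P(1) a] P(4)])
    finally show ?thesis using Suc insertion_parity[of "k + r" "Suc (p + r)"] by simp
  qed
  have 2: "(if 0 < r then unshuffle_sum [p, r - 1, q] (\<lambda>w. ?f (?I p w)) us else 0)
      = insertion (Suc (p + r)) (wedge p G (\<lambda>vs. \<gamma> (a # vs))) \<beta> us"
  proof (cases r)
    case 0
    have "\<gamma> (a # xs) = 0" if "set xs \<subseteq> S" for xs
      using supported_eq_0[OF P(3), of "a # xs"] that a 0 by simp
    then have "wedge p G (\<lambda>vs. \<gamma> (a # vs)) xs = 0" if "set xs \<subseteq> S" for xs
      using wedge_eq_0_form[OF that P(1) S, of "\<lambda>vs. \<gamma> (a # vs)"] by blast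
    then have "insertion (Suc (p + r)) (wedge p G (\<lambda>vs. \<gamma> (a # vs))) \<beta> us = insertion (Suc (p + r)) (\<lambda>_. 0) \<beta> us"
      by (intro insertion_cong[OF us]) (simp_all add: subspace_0[OF S])
    then show ?thesis using 0 insertion_zero_vec[OF us P(6) subspace_0[OF S]] by simp
  next
    case (Suc k)
    have s: "supported S (\<lambda>i. i = k) (\<lambda>xs. \<gamma> (a # xs))"
      using supported_Cons[OF P(3) a] Suc by simp
    have "unshuffle_sum [p, k, q] (\<lambda>w. ?f (?I p w)) us
      = unshuffle_sum [p, k, q] (\<lambda>w. \<beta> (G (take p w) (\<gamma> (a # take k (drop p w))) # drop (p + k) w)) us"
      by (rule unshuffle_sum_cong) (simp add: Suc drop_drop add.commute)
    also have "\<dots> = insertion (p + k) (wedge p G (\<lambda>vs. \<gamma> (a # vs))) \<beta> us"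
      by (rule Cons.IH[OF P(1,2) s \<gamma>a P(5-7) us]) (use l Suc in simp_all)
    finally show ?thesis using Suc insertion_parity[of "p + k" "Suc (p + r)"] by simp
  qed
  \<comment> \<open>The head lands right behind the value of \<open>G\<close>. Exchanging the two
    produces the minus sign built into \<open>insertion\<close>.\<close>
  have 3: "(if 0 < q then unshuffle_sum [p, r, q - 1] (\<lambda>w. ?f (?I (p + r) w)) us else 0)
      = - insertion (p + r) (wedge p G \<gamma>) (\<lambda>vs. \<beta> (a # vs)) us"
  proof (cases q)
    case 0
    \<comment> \<open>Here \<open>\<beta>\<close> has degree 1, so after receiving \<open>a\<close>
      it has degree 0 and nothing can be inserted.\<close>
    have "supported S (\<lambda>_. False) (insertion (p + r) (wedge p G \<gamma>) (\<lambda>vs. \<beta> (a # vs)))"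
      by (rule insertion_supported[where P="\<lambda>_. True" and Q="\<lambda>i. i = 0", OF mlinear_Cons[OF P(6) a] subspace_0[OF S] _ Y[OF P(1,4)]])
        (use supported_Cons[OF P(5) a] 0 in \<open>auto simp: supported_def\<close>)
    then show ?thesis using 0 us by (simp add: supported_def)
  next
    case (Suc k)
    have s: "supported S (\<lambda>i. i = Suc k) (\<lambda>xs. \<beta> (a # xs))"
      using supported_Cons[OF P(5) a] Suc by simp
    have "unshuffle_sum [p, r, k] (\<lambda>w. \<beta> (a # G (take p w) (\<gamma> (take r (drop p w))) # drop (p + r) w)) us
       = insertion (p + r) (wedge p G \<gamma>) (\<lambda>vs. \<beta> (a # vs)) us"
      by (rule Cons.IH[OF P(1-4) s mlinear_Cons[OF P(6) a] skewf_Cons[OF P(7) a] us]) (use l Suc in simp_all)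
    moreover have "unshuffle_sum [p, r, k] (\<lambda>w. ?f (?I (p + r) w)) us =
      - unshuffle_sum [p, r, k] (\<lambda>w. \<beta> (a # G (take p w) (\<gamma> (take r (drop p w))) # drop (p + r) w)) us"
      unfolding unshuffle_sum_def sum_negf[symmetric]
    proof (rule sum.cong[OF refl])
      fix \<sigma> assume "\<sigma> \<in> unshuffles [p, r, k]"
      then have perm: "\<sigma> permutes {..<length us}" using l Suc by (simp add: unshuffles_def add.assoc)
      let ?w = "map (\<lambda>k. us ! \<sigma> k) [0..<sum_list [p, r, k]]"
      have w: "set ?w \<subseteq> S" "length ?w = p + r + k"
        using us permutes_in_image[OF perm] l Suc nth_mem[of _ us] by auto
      have *: "set (take i ?w) \<subseteq> S" "set (drop i ?w) \<subseteq> S" "set (take i (drop j ?w)) \<subseteq> S" for i j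
        using w(1) by (meson set_take_subset set_drop_subset order_trans)+
      have "?f (?I (p + r) ?w) = \<beta> (G (take p ?w) (\<gamma> (take r (drop p ?w))) # a # drop (p + r) ?w)"
        using w(2) by (simp del: upt_conv_Cons upt_Suc add: take_map drop_map drop_take min_def)
      also have "\<dots> = - \<beta> (a # G (take p ?w) (\<gamma> (take r (drop p ?w))) # drop (p + r) ?w)"
        by (rule skewf_hd[OF P(7)]) (use a * P(4) linear_op_in[OF P(1)] in auto)
      finally show "of_int (sign \<sigma>) *\<^sub>R ?f (?I (p + r) ?w) =
         - (of_int (sign \<sigma>) *\<^sub>R \<beta> (a # G (take p ?w) (\<gamma> (take r (drop p ?w))) # drop (p + r) ?w))"
        by simp
    qed
    ultimately show ?thesis using Suc by simp
  qed
  have lin: "insertion (Suc (p + r)) (\<lambda>vs. wedge (Suc p) (\<lambda>vs. G (a # vs)) \<gamma> vs + (-1) ^ p *\<^sub>R wedge p G (\<lambda>vs. \<gamma> (a # vs)) vs) \<beta> us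
     = insertion (Suc (p + r)) (wedge (Suc p) (\<lambda>vs. G (a # vs)) \<gamma>) \<beta> us
      + (-1) ^ p *\<^sub>R insertion (Suc (p + r)) (wedge p G (\<lambda>vs. \<gamma> (a # vs))) \<beta> us"
    using insertion_lin_vec[where a=1 and b="(-1)^p", OF us P(6) Y[OF linear_op_Cons[OF P(1) a] P(4)] Y[OF P(1) \<gamma>a]] by simp
  have "sum_list [p, r, q] = Suc (length us)" using l by simp
  from unshuffle_sum_Cons[OF this, of ?f a] have "unshuffle_sum [p, r, q] ?f (a # us) =
     (if 0 < p then unshuffle_sum [p - 1, r, q] (\<lambda>w. ?f (a # w)) us else 0)
     + (-1) ^ p *\<^sub>R (if 0 < r then unshuffle_sum [p, r - 1, q] (\<lambda>w. ?f (?I p w)) us else 0)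
     + (-1) ^ (p + r) *\<^sub>R (if 0 < q then unshuffle_sum [p, r, q - 1] (\<lambda>w. ?f (?I (p + r) w)) us else 0)"
    by (simp add: numeral_3_eq_3 lessThan_Suc)
  then show ?case unfolding 1 2 3 insertion_Cons wedge_Cons lin by simp
qed

section \<open>Comparison with the bracket of the statement\<close>

definition curry_last :: "('s list \<Rightarrow> 's) \<Rightarrow> 's list \<Rightarrow> 's \<Rightarrow> 's" where
  "curry_last D us y = D (us @ [y])"

lemma mn_comp_curry_last:
  assumes S: "subspace S" and F: "alt_op S n (curry_last D1)" and G: "alt_op S m (curry_last D2)"
    and us: "set us \<subseteq> S" "length us = m + n" and y: "y \<in> S"
  shows "mn_comp S n m D1 D2 (us @ [y]) = insertion (Suc m) (vfield m (curry_last D2)) (\<lambda>vs. curry_last D1 vs y) us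
    + (-1) ^ (m * n) *\<^sub>R wedge n (curry_last D1) (\<lambda>vs. curry_last D2 vs y) us"
proof -
  let ?w = "\<lambda>\<sigma> i j. map (\<lambda>k. (us @ [y]) ! \<sigma> k) [i..<j]"
  have args: "us @ [y] \<in> args S (m + n + 1)" using us y by (simp add: args_def)
  note Fy = alt_opD(2,3)[OF F y] and Gy = alt_opD(2,3)[OF G y]
  \<comment> \<open>The permutation keeps indices below \<open>m + n\<close>, so the last argument
    \<open>y\<close> is never reached.\<close>
  have wl: "?w \<sigma> 0 N = map (\<lambda>k. us ! \<sigma> k) [0..<N]" if "\<sigma> permutes {..<N}" "N = m + n" for \<sigma> N
    using permutes_in_image[OF that(1)] us that(2) by (auto simp: nth_append)
  have sub: "?w \<sigma> i j = take (j - i) (drop i (?w \<sigma> 0 N))" if "j \<le> N" for \<sigma> i j N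
    using that by (intro nth_equalityI) auto
  have "(\<Sum>\<sigma>\<in>unshuffles [n, m]. of_int (sign \<sigma>) *\<^sub>R
      D1 (?w \<sigma> 0 n @ [D2 (?w \<sigma> n (m + n) @ [(us @ [y]) ! (m + n)])])) =
     unshuffle_sum [n, m] (\<lambda>w. curry_last D1 (take n w) (curry_last D2 (drop n w) y)) us"
    unfolding unshuffle_sum_def
  proof (rule sum.cong[OF refl])
    fix \<sigma> assume "\<sigma> \<in> unshuffles [n, m]"
    then have s: "\<sigma> permutes {..<m + n}" by (simp add: unshuffles_def add.commute)
    have "?w \<sigma> 0 n = take n (map (\<lambda>k. us ! \<sigma> k) [0..<m + n])"
      using sub[of n "m + n" \<sigma> 0] wl[OF s] by simp
    moreover have "?w \<sigma> n (m + n) = drop n (map (\<lambda>k. us ! \<sigma> k) [0..<m + n])"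
      using sub[of "m + n" "m + n" \<sigma> n] wl[OF s] by simp
    moreover have "(us @ [y]) ! (m + n) = y" using us by (simp add: nth_append)
    ultimately show "of_int (sign \<sigma>) *\<^sub>R D1 (?w \<sigma> 0 n @ [D2 (?w \<sigma> n (m + n) @ [(us @ [y]) ! (m + n)])]) =
       of_int (sign \<sigma>) *\<^sub>R curry_last D1 (take n (map (\<lambda>k. us ! \<sigma> k) [0..<sum_list [n, m]]))
         (curry_last D2 (drop n (map (\<lambda>k. us ! \<sigma> k) [0..<sum_list [n, m]])) y)"
      by (simp only: curry_last_def sum_list.Cons sum_list.Nil add_0_right add.commute[of n m])
  qed
  also have "\<dots> = wedge n (curry_last D1) (\<lambda>vs. curry_last D2 vs y) us"
    by (rule unshuffle_sum_wedge[OF S alt_opD(1)[OF F] alt_opD(3)[OF F] Gy(2) alternatingD(3)[OF Gy(1)] us(1)])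
      (use us in \<open>simp_all add: add.commute\<close>)
  finally have 1: "(\<Sum>\<sigma>\<in>unshuffles [n, m]. of_int (sign \<sigma>) *\<^sub>R
      D1 (?w \<sigma> 0 n @ [D2 (?w \<sigma> n (m + n) @ [(us @ [y]) ! (m + n)])])) = wedge n (curry_last D1) (\<lambda>vs. curry_last D2 vs y) us" .
  have 2: "(if n = 0 then 0 else \<Sum>\<sigma>\<in>unshuffles [m, 1, n - 1]. of_int (sign \<sigma>) *\<^sub>R
      D1 (D2 (?w \<sigma> 0 (m + 1)) # ?w \<sigma> (m + 1) (m + n) @ [(us @ [y]) ! (m + n)])) =
     insertion (Suc m) (vfield m (curry_last D2)) (\<lambda>vs. curry_last D1 vs y) us"
  proof (cases n)
    case 0
    \<comment> \<open>The sum is 0 by the convention for a block of length -1. The insertion is 0 as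
      well, since \<open>D1\<close> has no argument besides the last.\<close>
    have "supported S (\<lambda>_. False) (insertion (Suc m) (vfield m (curry_last D2)) (\<lambda>vs. curry_last D1 vs y))"
      by (rule insertion_supported[OF alternatingD(1)[OF Fy(1)] subspace_0[OF S] supported_vfield[OF S G]
        alternatingD(3)[OF alternating_vfield[OF S G]] Fy(2)]) (use 0 in auto)
    then show ?thesis using us 0 by (simp add: supported_def)
  next
    case (Suc q)
    have "(\<Sum>\<sigma>\<in>unshuffles [m, 1, q]. of_int (sign \<sigma>) *\<^sub>R
        D1 (D2 (?w \<sigma> 0 (m + 1)) # ?w \<sigma> (m + 1) (m + n) @ [(us @ [y]) ! (m + n)])) =
      unshuffle_sum [m, 1, q] (\<lambda>w. curry_last D1 (curry_last D2 (take m w) (id_form (take 1 (drop m w))) # drop (m + 1) w) y) us"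
      unfolding unshuffle_sum_def
    proof (rule sum.cong[OF refl])
      fix \<sigma> assume "\<sigma> \<in> unshuffles [m, 1, q]"
      then have s: "\<sigma> permutes {..<m + n}" using Suc by (simp add: unshuffles_def)
      let ?v = "map (\<lambda>k. us ! \<sigma> k) [0..<m + n]"
      have lv: "m < length ?v" using Suc by simp
      have "?w \<sigma> 0 (m + 1) = take (m + 1) ?v"
        using sub[of "m + 1" "m + n" \<sigma> 0] Suc unfolding wl[OF s refl] by (simp del: upt_Suc map_upt_Suc)
      also have "\<dots> = take m ?v @ [id_form (take 1 (drop m ?v))]"
        unfolding Cons_nth_drop_Suc[OF lv, symmetric] take_add by simp
      finally have a: "?w \<sigma> 0 (m + 1) = take m ?v @ [id_form (take 1 (drop m ?v))]" .
      have b: "?w \<sigma> (m + 1) (m + n) = drop (m + 1) ?v"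
        using sub[of "m + n" "m + n" \<sigma> "m + 1"] wl[OF s] by simp
      have c: "(us @ [y]) ! (m + n) = y" using us by (simp add: nth_append)
      have d: "sum_list [m, 1, q] = m + n" using Suc by simp
      show "of_int (sign \<sigma>) *\<^sub>R D1 (D2 (?w \<sigma> 0 (m + 1)) # ?w \<sigma> (m + 1) (m + n) @ [(us @ [y]) ! (m + n)]) =
        of_int (sign \<sigma>) *\<^sub>R curry_last D1 (curry_last D2 (take m (map (\<lambda>k. us ! \<sigma> k) [0..<sum_list [m, 1, q]]))
          (id_form (take 1 (drop m (map (\<lambda>k. us ! \<sigma> k) [0..<sum_list [m, 1, q]])))) #
            drop (m + 1) (map (\<lambda>k. us ! \<sigma> k) [0..<sum_list [m, 1, q]])) y"
        unfolding a b c d curry_last_def append_Cons ..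
    qed
    also have "\<dots> = insertion (m + 1) (wedge m (curry_last D2) id_form) (\<lambda>vs. curry_last D1 vs y) us"
      by (rule unshuffle_sum_insertion[OF S alt_opD(1)[OF G] alt_opD(3)[OF G] _ alternatingD(3)[OF alternating_id_form[OF S]] _
         alternatingD(1)[OF Fy(1)] alternatingD(2)[OF Fy(1)] us(1)]) (use us Suc Fy(2) in \<open>simp_all add: supported_id_form\<close>)
    finally show ?thesis using Suc by (simp add: vfield_def)
  qed
  show ?thesis
    unfolding mn_comp_def Let_def using args by (simp only: 1 2 not_True_eq_False if_False simp_thms)
qed

text \<open>Each \<open>act\<close> collects one term from either composition: the wedge with D1
  comes from the first and the insertion of its field from the second; for D2 it is the other way
  round.\<close>

lemma mn_bracket_curry_last:
  assumes S: "subspace S" and F: "alt_op S n (curry_last D1)" and G: "alt_op S m (curry_last D2)"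
    and us: "set us \<subseteq> S" "length us = n + m" and y: "y \<in> S"
  shows "mn_bracket S n m D1 D2 (us @ [y]) = op_bracket n m (curry_last D1) (curry_last D2) us y"
proof -
  have us': "length us = m + n" using us by simp
  show ?thesis
    unfolding mn_bracket_def minus_apply scaleR_fun_def mn_comp_curry_last[OF S F G us(1) us' y]
      mn_comp_curry_last[OF S G F us y] op_bracket_def act_def
    by (cases n rule: neg_one_pow_cases; cases m rule: neg_one_pow_cases)
      (simp_all add: algebra_simps power_mult)
qed

section \<open>Function linearity and symbols\<close>

lemma wedge_leibniz:
  fixes F :: "('m \<Rightarrow> 'v::real_vector) list \<Rightarrow> ('m \<Rightarrow> 'v) \<Rightarrow> 'm \<Rightarrow> 'v"
  assumes "set us \<subseteq> S" "\<And>xs. set xs \<subseteq> S \<Longrightarrow> \<beta> xs \<in> S"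
    and "\<And>xs z. set xs \<subseteq> S \<Longrightarrow> z \<in> S \<Longrightarrow> F xs (f \<odot> z) = f \<odot> F xs z + \<phi> xs \<odot> z"
  shows "wedge k F (\<lambda>xs. f \<odot> \<beta> xs) us = f \<odot> wedge k F \<beta> us + wedge k (\<lambda>xs. (\<odot>) (\<phi> xs)) \<beta> us"
  using assms
proof (induction us arbitrary: k F \<phi> \<beta>)
  case Nil
  then show ?case by simp
next
  case (Cons a us)
  note P = Cons.prems
  have a: "a \<in> S" and us: "set us \<subseteq> S" using P by auto
  have 1: "wedge (Suc k) (\<lambda>vs. F (a # vs)) (\<lambda>xs. f \<odot> \<beta> xs) us =
     f \<odot> wedge (Suc k) (\<lambda>vs. F (a # vs)) \<beta> us + wedge (Suc k) (\<lambda>xs. (\<odot>) (\<phi> (a # xs))) \<beta> us"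
    by (rule Cons.IH[OF us P(2)]) (use P(3) a in simp_all)
  have 2: "wedge k F (\<lambda>xs. f \<odot> \<beta> (a # xs)) us =
     f \<odot> wedge k F (\<lambda>xs. \<beta> (a # xs)) us + wedge k (\<lambda>xs. (\<odot>) (\<phi> xs)) (\<lambda>xs. \<beta> (a # xs)) us"
    by (rule Cons.IH[OF us]) (use P a in simp_all)
  show ?case unfolding wedge_Cons 1 2
    by (auto simp: fun_eq_iff fscale_def scaleR_fun_def algebra_simps)
qed

lemma wedge_fscale_op:
  fixes F :: "'s list \<Rightarrow> ('m \<Rightarrow> 'v::real_vector) \<Rightarrow> 'm \<Rightarrow> 'v"
  shows "wedge k (\<lambda>xs z. f \<odot> F xs z) \<beta> us = f \<odot> wedge k F \<beta> us"
  by (induction us arbitrary: k F \<beta>) (auto simp: fscale_def scaleR_fun_def fun_eq_iff algebra_simps)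

lemma insertion_fscale_form:
  fixes \<beta> :: "'s list \<Rightarrow> 'm \<Rightarrow> 'v::real_vector"
  shows "insertion k Y (\<lambda>xs. f \<odot> \<beta> xs) us = f \<odot> insertion k Y \<beta> us"
  by (induction us arbitrary: k Y \<beta>) (auto simp: fscale_def scaleR_fun_def fun_eq_iff algebra_simps)

lemma insertion_form_fscale:
  fixes \<phi> :: "'s list \<Rightarrow> 'm \<Rightarrow> real" and y :: "'m \<Rightarrow> 'v::real_vector"
  shows "insertion k Y (\<lambda>xs. \<phi> xs \<odot> y) us = insertion k Y \<phi> us \<odot> y"
  by (induction us arbitrary: k Y \<phi>) (auto simp: fscale_def scaleR_fun_def fun_eq_iff algebra_simps)

definition fun_linear :: "('m \<Rightarrow> 'v::real_vector) set \<Rightarrow> ('m \<Rightarrow> real) \<Rightarrow> (('m \<Rightarrow> 'v) list \<Rightarrow> 'm \<Rightarrow> 'v) \<Rightarrow> bool" where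
  "fun_linear S f \<beta> \<longleftrightarrow> (\<forall>xs ys v. set xs \<subseteq> S \<longrightarrow> set ys \<subseteq> S \<longrightarrow> v \<in> S \<longrightarrow>
     \<beta> (xs @ (f \<odot> v) # ys) = f \<odot> \<beta> (xs @ v # ys))"

lemma fun_linear_hd: "fun_linear S f \<beta> \<Longrightarrow> set ys \<subseteq> S \<Longrightarrow> v \<in> S \<Longrightarrow> \<beta> ((f \<odot> v) # ys) = f \<odot> \<beta> (v # ys)"
  unfolding fun_linear_def by (metis append_Nil empty_set empty_subsetI)

lemma fun_linear_Cons: "fun_linear S f \<beta> \<Longrightarrow> a \<in> S \<Longrightarrow> fun_linear S f (\<lambda>vs. \<beta> (a # vs))"
  unfolding fun_linear_def by (metis append_Cons insert_subset list.simps(15))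

lemma insertion_fscale_vec:
  fixes \<beta> :: "('m \<Rightarrow> 'v::real_vector) list \<Rightarrow> 'm \<Rightarrow> 'v"
  assumes "set us \<subseteq> S" "fun_linear S f \<beta>" "\<And>xs. set xs \<subseteq> S \<Longrightarrow> Y xs \<in> S"
  shows "insertion k (\<lambda>xs. f \<odot> Y xs) \<beta> us = f \<odot> insertion k Y \<beta> us"
  using assms
proof (induction us arbitrary: k Y \<beta>)
  case Nil
  then show ?case by (simp add: fun_linear_hd)
next
  case (Cons a us)
  note P = Cons.prems
  have a: "a \<in> S" and us: "set us \<subseteq> S" using P by auto
  have 1: "insertion (Suc k) (\<lambda>vs. f \<odot> Y (a # vs)) \<beta> us = f \<odot> insertion (Suc k) (\<lambda>vs. Y (a # vs)) \<beta> us"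
    by (rule Cons.IH[OF us P(2)]) (use P a in simp_all)
  have 2: "insertion k (\<lambda>vs. f \<odot> Y vs) (\<lambda>vs. \<beta> (a # vs)) us = f \<odot> insertion k Y (\<lambda>vs. \<beta> (a # vs)) us"
    by (rule Cons.IH[OF us fun_linear_Cons[OF P(2) a] P(3)])
  show ?case unfolding insertion_Cons 1 2
    by (auto simp: fun_eq_iff fscale_def scaleR_fun_def algebra_simps)
qed

text \<open>Function-linearity pulls \<open>\<phi>\<close> out of the slot of the inserted value and
  leaves \<open>a\<close> there. The sign for keeping \<open>a\<close> in front of the other
  arguments is the one already present in \<open>insertion\<close>.\<close>

lemma insertion_tensor:
  fixes \<beta> :: "('m \<Rightarrow> 'v::real_vector) list \<Rightarrow> 'm \<Rightarrow> 'v"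
  assumes "set us \<subseteq> S" "\<And>xs. set xs \<subseteq> S \<Longrightarrow> fun_linear S (\<phi> xs) \<beta>" "skewf S \<beta>" "a \<in> S"
    "\<And>xs. set xs \<subseteq> S \<Longrightarrow> \<phi> xs \<in> C"
  shows "insertion k (\<lambda>xs. \<phi> xs \<odot> a) \<beta> us = wedge k (\<lambda>xs. (\<odot>) (\<phi> xs)) (\<lambda>xs. \<beta> (a # xs)) us"
  using assms
proof (induction us arbitrary: k \<phi> \<beta>)
  case Nil
  then show ?case using fun_linear_hd[of S "\<phi> []" \<beta> "[]" a] by simp
next
  case (Cons b us)
  note P = Cons.prems
  have b: "b \<in> S" and us: "set us \<subseteq> S" using P by auto
  have 1: "insertion (Suc k) (\<lambda>vs. \<phi> (b # vs) \<odot> a) \<beta> us = wedge (Suc k) (\<lambda>xs. (\<odot>) (\<phi> (b # xs))) (\<lambda>xs. \<beta> (a # xs)) us"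
    by (rule Cons.IH[OF us]) (use P b in simp_all)
  have 2: "insertion k (\<lambda>xs. \<phi> xs \<odot> a) (\<lambda>vs. \<beta> (b # vs)) us = wedge k (\<lambda>xs. (\<odot>) (\<phi> xs)) (\<lambda>xs. \<beta> (b # a # xs)) us"
    by (rule Cons.IH[OF us fun_linear_Cons[OF P(2) b] skewf_Cons[OF P(3) b] P(4) P(5)])
  have "wedge k (\<lambda>xs. (\<odot>) (\<phi> xs)) (\<lambda>xs. \<beta> (b # a # xs)) us = wedge k (\<lambda>xs. (\<odot>) (\<phi> xs)) (\<lambda>xs. (-1) *\<^sub>R \<beta> (a # b # xs)) us"
    by (rule wedge_cong[of _ S UNIV]) (simp_all add: us skewf_hd[OF P(3) b P(4)])
  also have "\<dots> = (-1) *\<^sub>R wedge k (\<lambda>xs. (\<odot>) (\<phi> xs)) (\<lambda>xs. \<beta> (a # b # xs)) us"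
    by (rule wedge_scale_form[OF us, of UNIV])
      (auto simp: linear_op_def fscale_def scaleR_fun_def fun_eq_iff algebra_simps)
  finally show ?case unfolding insertion_Cons wedge_Cons 1 2 by simp
qed

text \<open>Pulling \<open>\<phi>\<close> out of \<open>F\<close> costs the symbol term, and the
  remaining sign is that of exchanging forms of degrees \<open>m\<close> and \<open>n\<close>. At
  the empty list this sign is 1 whenever it matters: a nonzero \<open>F [] y\<close> forces
  \<open>n\<close> to be even.\<close>

lemma wedge_symbol:
  fixes F :: "('m \<Rightarrow> 'v::real_vector) list \<Rightarrow> ('m \<Rightarrow> 'v) \<Rightarrow> 'm \<Rightarrow> 'v"
  assumes "set us \<subseteq> S" "parity_supported S n (\<lambda>xs. F xs y)" "\<And>xs. set xs \<subseteq> S \<Longrightarrow> \<phi> xs \<in> C"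
    and "\<And>xs g. set xs \<subseteq> S \<Longrightarrow> g \<in> C \<Longrightarrow> F xs (g \<odot> y) = g \<odot> F xs y + \<Sigma> xs g \<odot> y"
  shows "wedge n F (\<lambda>xs. \<phi> xs \<odot> y) us =
    (-1) ^ (m * n) *\<^sub>R wedge m (\<lambda>xs. (\<odot>) (\<phi> xs)) (\<lambda>xs. F xs y) us + wedge n \<Sigma> \<phi> us \<odot> y"
  using assms
proof (induction us arbitrary: n m F \<phi> \<Sigma>)
  case Nil
  show ?case
  proof (cases "even n")
    case True
    then show ?thesis using Nil by simp
  next
    case False
    then have "F [] y = 0" using supported_eq_0[OF Nil(2), of "[]"] by simp
    then show ?thesis using Nil by (simp add: fscale_def scaleR_fun_def fun_eq_iff)
  qed
next
  case (Cons a us)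
  note P = Cons.prems
  have a: "a \<in> S" and us: "set us \<subseteq> S" using P by auto
  have 1: "wedge (Suc n) (\<lambda>vs. F (a # vs)) (\<lambda>xs. \<phi> xs \<odot> y) us =
    (-1) ^ (m * Suc n) *\<^sub>R wedge m (\<lambda>xs. (\<odot>) (\<phi> xs)) (\<lambda>xs. F (a # xs) y) us
     + wedge (Suc n) (\<lambda>vs. \<Sigma> (a # vs)) \<phi> us \<odot> y"
    by (rule Cons.IH[where n="Suc n" and F="\<lambda>vs. F (a # vs)" and \<phi>=\<phi> and \<Sigma>="\<lambda>vs. \<Sigma> (a # vs)",
        OF us parity_supported_Cons[OF P(2) a]]) (use P(3,4) a in simp_all)
  have 2: "wedge n F (\<lambda>xs. \<phi> (a # xs) \<odot> y) us =
    (-1) ^ (Suc m * n) *\<^sub>R wedge (Suc m) (\<lambda>xs. (\<odot>) (\<phi> (a # xs))) (\<lambda>xs. F xs y) us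
     + wedge n \<Sigma> (\<lambda>vs. \<phi> (a # vs)) us \<odot> y"
    by (rule Cons.IH[where n=n and F=F and \<phi>="\<lambda>xs. \<phi> (a # xs)" and \<Sigma>=\<Sigma> and m="Suc m",
        OF us P(2)]) (use P(3,4) a in simp_all)
  show ?case unfolding wedge_Cons 1 2
    by (cases n rule: neg_one_pow_cases; cases m rule: neg_one_pow_cases)
      (auto simp: fun_eq_iff fscale_def scaleR_fun_def algebra_simps power_mult power_add)
qed

text \<open>Here \<open>\<sigma>\<close> is merely a map on lists of global sections; nothing says
  that it is local, let alone a bundle map. In this weak form the notion is stable under the bracket
  by algebra alone.\<close>

definition section_der :: "('m \<Rightarrow> 'v::real_vector) set \<Rightarrow> ('m \<Rightarrow> real) set \<Rightarrow> nat \<Rightarrow>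
    (('m \<Rightarrow> 'v) list \<Rightarrow> ('m \<Rightarrow> 'v) \<Rightarrow> 'm \<Rightarrow> 'v) \<Rightarrow>
    (('m \<Rightarrow> 'v) list \<Rightarrow> ('m \<Rightarrow> real) \<Rightarrow> 'm \<Rightarrow> real) \<Rightarrow> bool" where
  "section_der S C n F \<sigma> \<longleftrightarrow> alt_op S n F \<and> (\<forall>f\<in>C. \<forall>y\<in>S. fun_linear S f (\<lambda>xs. F xs y)) \<and>
     (\<forall>xs. set xs \<subseteq> S \<longrightarrow> (\<forall>f\<in>C. \<sigma> xs f \<in> C \<and>
        (\<forall>y\<in>S. F xs (f \<odot> y) = f \<odot> F xs y + \<sigma> xs f \<odot> y)))"

lemma section_derD:
  assumes "section_der S C n F \<sigma>"
  shows "alt_op S n F" "f \<in> C \<Longrightarrow> y \<in> S \<Longrightarrow> fun_linear S f (\<lambda>xs. F xs y)"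
    "set xs \<subseteq> S \<Longrightarrow> f \<in> C \<Longrightarrow> \<sigma> xs f \<in> C"
    "set xs \<subseteq> S \<Longrightarrow> f \<in> C \<Longrightarrow> y \<in> S \<Longrightarrow> F xs (f \<odot> y) = f \<odot> F xs y + \<sigma> xs f \<odot> y"
  using assms unfolding section_der_def by auto

lemma id_form_Cons: "(\<lambda>vs. id_form (a # vs)) = (\<lambda>us. if us = [] then a else 0)"
  by (auto simp: fun_eq_iff id_form_def split: list.splits)

lemma wedge_const_Nil:
  assumes "set us \<subseteq> S" "linear_op S S F" "subspace S" "a \<in> S"
  shows "wedge k F (\<lambda>us. if us = [] then a else 0) us = F us a"
  using assms(1,2)
proof (induction us arbitrary: k F)
  case (Cons b us)
  have "wedge k F (\<lambda>xs. 0) us = 0"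
    by (rule wedge_zero_form[of _ S S]) (use Cons.prems assms in \<open>auto simp: subspace_0\<close>)
  then show ?case using Cons.IH[OF _ linear_op_Cons[OF Cons.prems(2)], of b "Suc k"] Cons.prems by simp
qed simp

text \<open>Both parts of \<open>act\<close> fail to be function-linear by the same term,
  \<open>(-1) ^ n\<close> times the wedge of \<open>?\<phi>\<close> with \<beta>(a, ...): the wedge
  because of the Leibniz rule for \<open>F\<close>, the insertion because of the field
  \<open>?X\<close>. In the difference these cancel.\<close>

lemma act_fun_linear_hd:
  assumes S: "subspace S" and F: "section_der S C n F \<sigma>" and f: "f \<in> C" and B: "alternating S \<beta>" "\<And>g. g \<in> C \<Longrightarrow> fun_linear S g \<beta>"
    and CS: "\<And>f y. f \<in> C \<Longrightarrow> y \<in> S \<Longrightarrow> f \<odot> y \<in> S"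
    and a: "a \<in> S" and us: "set us \<subseteq> S"
  shows "act n F \<beta> ((f \<odot> a) # us) = f \<odot> act n F \<beta> (a # us)"
proof -
  let ?\<phi> = "\<lambda>xs. \<sigma> xs f" and ?X = "vfield n F" and ?c = "(-1) ^ n :: real"
  note mF = section_derD(1)[OF F] and lF = alt_opD(1)[OF section_derD(1)[OF F]] and X = alternating_vfield[OF S section_derD(1)[OF F]]
  have fa: "f \<odot> a \<in> S" by (rule CS[OF f a])
  have Ff: "F ((f \<odot> a) # vs) z = f \<odot> F (a # vs) z" if "set vs \<subseteq> S" "z \<in> S" for vs z
    using fun_linear_hd[OF section_derD(2)[OF F f that(2)] that(1) a] .
  have Ffz: "wedge (Suc n) (\<lambda>vs. F ((f \<odot> a) # vs)) \<gamma> vs = f \<odot> wedge (Suc n) (\<lambda>vs. F (a # vs)) \<gamma> vs"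
    if "alternating S \<gamma>" "set vs \<subseteq> S" for \<gamma> vs
  proof -
    have "wedge (Suc n) (\<lambda>vs. F ((f \<odot> a) # vs)) \<gamma> vs = wedge (Suc n) (\<lambda>vs z. f \<odot> F (a # vs) z) \<gamma> vs"
      by (rule wedge_cong[of _ S S]) (use that Ff in \<open>simp_all add: alternatingD(3)\<close>)
    then show ?thesis by (simp add: wedge_fscale_op)
  qed
  \<comment> \<open>In the field, \<open>f \<odot> a\<close> either is among the first arguments of
    \<open>F\<close>, where it is treated linearly, or becomes the last one, where the symbol
    appears with the sign for passing \<open>n\<close> arguments.\<close>
  have Xf: "?X ((f \<odot> a) # vs) = f \<odot> ?X (a # vs) + ?c *\<^sub>R (?\<phi> vs \<odot> a)" if "set vs \<subseteq> S" for vs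
    unfolding vfield_def wedge_Cons id_form_Cons Ffz[OF alternating_id_form[OF S] that]
      wedge_const_Nil[OF that lF S fa] wedge_const_Nil[OF that lF S a] section_derD(4)[OF F that f a]
    by (auto simp: fun_eq_iff fscale_def scaleR_fun_def algebra_simps)
  have \<phi>: "?\<phi> xs \<in> C" if "set xs \<subseteq> S" for xs using section_derD(3)[OF F that f] .
  have Xa: "?X (a # xs) \<in> S" if "set xs \<subseteq> S" for xs using alternatingD(3)[OF X] a that by simp
  have i1: "insertion (Suc (Suc n)) (\<lambda>vs. ?X ((f \<odot> a) # vs)) \<beta> us =
     f \<odot> insertion (Suc (Suc n)) (\<lambda>vs. ?X (a # vs)) \<beta> us + ?c *\<^sub>R wedge n (\<lambda>xs. (\<odot>) (?\<phi> xs)) (\<lambda>xs. \<beta> (a # xs)) us"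
  proof -
    have "insertion (Suc (Suc n)) (\<lambda>vs. ?X ((f \<odot> a) # vs)) \<beta> us =
       insertion (Suc (Suc n)) (\<lambda>vs. 1 *\<^sub>R (f \<odot> ?X (a # vs)) + ?c *\<^sub>R (?\<phi> vs \<odot> a)) \<beta> us"
      by (rule insertion_cong[OF us])
        (simp_all add: Xf CS f a Xa \<phi> subspace_add[OF S] subspace_scale[OF S] del: plus_fun_apply)
    also have "\<dots> = 1 *\<^sub>R insertion (Suc (Suc n)) (\<lambda>vs. f \<odot> ?X (a # vs)) \<beta> us
       + ?c *\<^sub>R insertion (Suc (Suc n)) (\<lambda>vs. ?\<phi> vs \<odot> a) \<beta> us"
      by (rule insertion_lin_vec[OF us alternatingD(1)[OF B(1)]]) (simp_all add: CS f a Xa \<phi>)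
    also have "insertion (Suc (Suc n)) (\<lambda>vs. f \<odot> ?X (a # vs)) \<beta> us = f \<odot> insertion (Suc (Suc n)) (\<lambda>vs. ?X (a # vs)) \<beta> us"
      by (rule insertion_fscale_vec[OF us B(2)[OF f] Xa])
    also have "insertion (Suc (Suc n)) (\<lambda>vs. ?\<phi> vs \<odot> a) \<beta> us =
        wedge (Suc (Suc n)) (\<lambda>xs. (\<odot>) (?\<phi> xs)) (\<lambda>xs. \<beta> (a # xs)) us"
      by (rule insertion_tensor[OF us B(2)[OF \<phi>] alternatingD(2)[OF B(1)] a \<phi>])
    also have "\<dots> = wedge n (\<lambda>xs. (\<odot>) (?\<phi> xs)) (\<lambda>xs. \<beta> (a # xs)) us" by (rule wedge_parity) simp
    finally show ?thesis unfolding scaleR_one .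
  qed
  have bf: "wedge n F (\<lambda>vs. \<beta> ((f \<odot> a) # vs)) us =
     f \<odot> wedge n F (\<lambda>vs. \<beta> (a # vs)) us + wedge n (\<lambda>xs. (\<odot>) (?\<phi> xs)) (\<lambda>xs. \<beta> (a # xs)) us"
  proof -
    have "wedge n F (\<lambda>vs. \<beta> ((f \<odot> a) # vs)) us = wedge n F (\<lambda>vs. f \<odot> \<beta> (a # vs)) us"
      by (rule wedge_cong[of _ S S]) (use us fa a CS[OF f] alternatingD(3)[OF B(1)] fun_linear_hd[OF B(2)[OF f] _ a] in simp_all)
    also have "\<dots> = f \<odot> wedge n F (\<lambda>vs. \<beta> (a # vs)) us + wedge n (\<lambda>xs. (\<odot>) (?\<phi> xs)) (\<lambda>xs. \<beta> (a # xs)) us"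
      by (rule wedge_leibniz[OF us]) (use a alternatingD(3)[OF B(1)] section_derD(4)[OF F _ f] in simp_all)
    finally show ?thesis .
  qed
  have i2: "insertion (Suc n) ?X (\<lambda>vs. \<beta> ((f \<odot> a) # vs)) us = f \<odot> insertion (Suc n) ?X (\<lambda>vs. \<beta> (a # vs)) us"
  proof -
    have "insertion (Suc n) ?X (\<lambda>vs. \<beta> ((f \<odot> a) # vs)) us = insertion (Suc n) ?X (\<lambda>vs. f \<odot> \<beta> (a # vs)) us"
      by (rule insertion_cong[OF us]) (use alternatingD(3)[OF X] fun_linear_hd[OF B(2)[OF f] _ a] in simp_all)
    then show ?thesis by (simp add: insertion_fscale_form)
  qed
  show ?thesis
    unfolding act_def insertion_Cons wedge_Cons i1 i2 bf Ffz[OF B(1) us]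
    by (auto simp: fun_eq_iff fscale_def scaleR_fun_def algebra_simps)
qed

lemma skewf_move:
  assumes "skewf S \<beta>" "set xs \<subseteq> S" "set ys \<subseteq> S" "v \<in> S"
  shows "\<beta> (xs @ v # ys) = (-1) ^ length xs *\<^sub>R \<beta> (v # xs @ ys)"
  using assms(2,3)
proof (induction xs arbitrary: ys rule: rev_induct)
  case (snoc x xs)
  have "\<beta> (xs @ x # v # ys) = - \<beta> (xs @ v # x # ys)"
    using assms(1)[unfolded skewf_def, rule_format, of xs ys x v] snoc.prems assms(4) by simp
  then show ?case using snoc.IH[of "x # ys"] snoc.prems by simp
qed simp

text \<open>Skew symmetry allows any argument to be moved to the front, with the same sign before
  and after multiplication by \<open>f\<close>.\<close>

lemma fun_linearI:
  fixes \<beta> :: "('m \<Rightarrow> 'v::real_vector) list \<Rightarrow> 'm \<Rightarrow> 'v"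
  assumes "skewf S \<beta>" "\<And>us a. set us \<subseteq> S \<Longrightarrow> a \<in> S \<Longrightarrow> \<beta> ((f \<odot> a) # us) = f \<odot> \<beta> (a # us)"
    and "\<And>y. y \<in> S \<Longrightarrow> f \<odot> y \<in> S"
  shows "fun_linear S f \<beta>"
  unfolding fun_linear_def
proof (intro allI impI)
  fix xs ys v assume *: "set xs \<subseteq> S" "set ys \<subseteq> S" "v \<in> S"
  show "\<beta> (xs @ (f \<odot> v) # ys) = f \<odot> \<beta> (xs @ v # ys)"
    unfolding skewf_move[OF assms(1) *(1,2) assms(3)[OF *(3)]] skewf_move[OF assms(1) *]
    using assms(2)[of "xs @ ys" v] * by (simp add: fun_eq_iff fscale_def scaleR_fun_def)
qed

text \<open>The counterpart of L on function-valued forms: \<open>F\<close> acts on values through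
  its symbol and on arguments through the same field.\<close>

definition symbol_act :: "nat \<Rightarrow> (('m \<Rightarrow> 'v) list \<Rightarrow> ('m \<Rightarrow> 'v) \<Rightarrow> 'm \<Rightarrow> 'v::real_vector) \<Rightarrow>
    (('m \<Rightarrow> 'v) list \<Rightarrow> ('m \<Rightarrow> real) \<Rightarrow> 'm \<Rightarrow> real) \<Rightarrow>
    (('m \<Rightarrow> 'v) list \<Rightarrow> 'm \<Rightarrow> real) \<Rightarrow> ('m \<Rightarrow> 'v) list \<Rightarrow> 'm \<Rightarrow> real" where
  "symbol_act n F \<sigma> \<psi> us = wedge n \<sigma> \<psi> us - insertion (Suc n) (vfield n F) \<psi> us"

text \<open>Of the three correction terms only the last is a function times \<open>y\<close>. The
  other two cancel in the bracket against those obtained with \<open>F\<close> and \<open>G\<close>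
  exchanged.\<close>

lemma act_symbol:
  assumes S: "subspace S" and F: "section_der S C n F \<sigma>" and G: "section_der S C m G \<tau>" and f: "f \<in> C" and y: "y \<in> S"
    and CS: "\<And>f y. f \<in> C \<Longrightarrow> y \<in> S \<Longrightarrow> f \<odot> y \<in> S" and us: "set us \<subseteq> S"
  shows "act n F (\<lambda>vs. G vs (f \<odot> y)) us = f \<odot> act n F (\<lambda>vs. G vs y) us
     + wedge n (\<lambda>xs. (\<odot>) (\<sigma> xs f)) (\<lambda>vs. G vs y) us
     + (-1) ^ (m * n) *\<^sub>R wedge m (\<lambda>xs. (\<odot>) (\<tau> xs f)) (\<lambda>xs. F xs y) us
     + symbol_act n F \<sigma> (\<lambda>vs. \<tau> vs f) us \<odot> y"
proof -
  note mF = section_derD(1)[OF F] and mG = section_derD(1)[OF G]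
  have Gy: "G xs y \<in> S" if "set xs \<subseteq> S" for xs using alternatingD(3)[OF alt_opD(2)[OF mG y] that] .
  have \<tau>: "\<tau> xs f \<in> C" if "set xs \<subseteq> S" for xs using section_derD(3)[OF G that f] .
  have e: "G xs (f \<odot> y) = f \<odot> G xs y + \<tau> xs f \<odot> y" if "set xs \<subseteq> S" for xs using section_derD(4)[OF G that f y] .
  have "wedge n F (\<lambda>vs. G vs (f \<odot> y)) us = wedge n F (\<lambda>vs. f \<odot> G vs y + \<tau> vs f \<odot> y) us"
    by (rule wedge_cong[of _ S S]) (use us e in \<open>simp_all add: subspace_add[OF S] CS f Gy \<tau> y\<close>)
  also have "\<dots> = wedge n F (\<lambda>vs. f \<odot> G vs y) us + wedge n F (\<lambda>vs. \<tau> vs f \<odot> y) us"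
    by (rule wedge_add_form[OF us alt_opD(1)[OF mF]]) (simp_all add: CS f Gy \<tau> y)
  also have "wedge n F (\<lambda>vs. f \<odot> G vs y) us = f \<odot> wedge n F (\<lambda>vs. G vs y) us
      + wedge n (\<lambda>xs. (\<odot>) (\<sigma> xs f)) (\<lambda>vs. G vs y) us"
    by (rule wedge_leibniz[where S=S and \<phi>="\<lambda>xs. \<sigma> xs f", OF us]) (use Gy section_derD(4)[OF F _ f] in simp_all)
  also have "wedge n F (\<lambda>vs. \<tau> vs f \<odot> y) us =
     (-1) ^ (m * n) *\<^sub>R wedge m (\<lambda>xs. (\<odot>) (\<tau> xs f)) (\<lambda>xs. F xs y) us + wedge n \<sigma> (\<lambda>vs. \<tau> vs f) us \<odot> y"
  proof (rule wedge_symbol[where F=F and C=C and \<Sigma>=\<sigma> and S=S and n=n and \<phi>="\<lambda>vs. \<tau> vs f", OF us])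
    show "parity_supported S n (\<lambda>xs. F xs y)" by (rule supported_mono[OF alt_opD(3)[OF mF y]]) simp
  qed (use \<tau> section_derD(4)[OF F _ _ y] in simp_all)
  finally have 1: "wedge n F (\<lambda>vs. G vs (f \<odot> y)) us = f \<odot> wedge n F (\<lambda>vs. G vs y) us
      + wedge n (\<lambda>xs. (\<odot>) (\<sigma> xs f)) (\<lambda>vs. G vs y) us
      + ((-1) ^ (m * n) *\<^sub>R wedge m (\<lambda>xs. (\<odot>) (\<tau> xs f)) (\<lambda>xs. F xs y) us + wedge n \<sigma> (\<lambda>vs. \<tau> vs f) us \<odot> y)" .
  have "insertion (Suc n) (vfield n F) (\<lambda>vs. G vs (f \<odot> y)) us =
     insertion (Suc n) (vfield n F) (\<lambda>vs. f \<odot> G vs y + \<tau> vs f \<odot> y) us"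
    by (rule insertion_cong[OF us]) (use e alternatingD(3)[OF alternating_vfield[OF S mF]] in simp_all)
  also have "\<dots> = f \<odot> insertion (Suc n) (vfield n F) (\<lambda>vs. G vs y) us + insertion (Suc n) (vfield n F) (\<lambda>vs. \<tau> vs f) us \<odot> y"
    unfolding insertion_add_form insertion_fscale_form insertion_form_fscale ..
  finally show ?thesis unfolding act_def symbol_act_def 1
    by (auto simp: fun_eq_iff fscale_def scaleR_fun_def algebra_simps)
qed

lemma section_der_op_bracket:
  assumes S: "subspace S" and C: "subspace C" and F: "section_der S C n F \<sigma>" and G: "section_der S C m G \<tau>"
    and CS: "\<And>f y. f \<in> C \<Longrightarrow> y \<in> S \<Longrightarrow> f \<odot> y \<in> S"
  shows "section_der S C (n + m) (op_bracket n m F G)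
    (\<lambda>us f. (-1) ^ (m * n) *\<^sub>R symbol_act n F \<sigma> (\<lambda>vs. \<tau> vs f) us - symbol_act m G \<tau> (\<lambda>vs. \<sigma> vs f) us)"
proof -
  note mF = section_derD(1)[OF F] and mG = section_derD(1)[OF G]
  have fun_linear: "fun_linear S f (\<lambda>xs. op_bracket n m F G xs y)" if f: "f \<in> C" and y: "y \<in> S" for f y
  proof (rule fun_linearI[OF alternatingD(2)[OF alt_opD(2)[OF alt_op_op_bracket[OF S mF mG] y]] _ CS[OF f]])
    fix us a assume *: "set us \<subseteq> S" "a \<in> S"
    have "act n F (\<lambda>vs. G vs y) ((f \<odot> a) # us) = f \<odot> act n F (\<lambda>vs. G vs y) (a # us)"
      by (rule act_fun_linear_hd[OF S F f alt_opD(2)[OF mG y] section_derD(2)[OF G _ y] CS *(2,1)])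
    moreover have "act m G (\<lambda>vs. F vs y) ((f \<odot> a) # us) = f \<odot> act m G (\<lambda>vs. F vs y) (a # us)"
      by (rule act_fun_linear_hd[OF S G f alt_opD(2)[OF mF y] section_derD(2)[OF F _ y] CS *(2,1)])
    ultimately show "op_bracket n m F G ((f \<odot> a) # us) y = f \<odot> op_bracket n m F G (a # us) y"
      unfolding op_bracket_def by (auto simp: fun_eq_iff fscale_def scaleR_fun_def algebra_simps)
  qed
  have sym: "symbol_act n F \<sigma> (\<lambda>vs. \<tau> vs f) us \<in> C"
    if "section_der S C n F \<sigma>" "section_der S C m G \<tau>" "set us \<subseteq> S" "f \<in> C" for n m F G \<sigma> \<tau> us f
  proof -
    have "wedge n \<sigma> (\<lambda>vs. \<tau> vs f) us \<in> C"
      by (rule wedge_in[OF that(3) C, of C]) (use section_derD(3)[OF that(1)] section_derD(3)[OF that(2) _ that(4)] in auto)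
    moreover have "insertion (Suc n) (vfield n F) (\<lambda>vs. \<tau> vs f) us \<in> C"
      by (rule insertion_in[OF that(3) C alternatingD(3)[OF alternating_vfield[OF S section_derD(1)[OF that(1)]]] section_derD(3)[OF that(2) _ that(4)]])
    ultimately show ?thesis unfolding symbol_act_def by (rule subspace_diff[OF C])
  qed
  have "op_bracket n m F G us (f \<odot> y) = f \<odot> op_bracket n m F G us y +
    ((-1) ^ (m * n) *\<^sub>R symbol_act n F \<sigma> (\<lambda>vs. \<tau> vs f) us - symbol_act m G \<tau> (\<lambda>vs. \<sigma> vs f) us) \<odot> y"
    if "set us \<subseteq> S" "f \<in> C" "y \<in> S" for us f y
  proof -
    have a: "act n F (\<lambda>vs. G vs (f \<odot> y)) us = f \<odot> act n F (\<lambda>vs. G vs y) us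
     + wedge n (\<lambda>xs. (\<odot>) (\<sigma> xs f)) (\<lambda>vs. G vs y) us
     + (-1) ^ (m * n) *\<^sub>R wedge m (\<lambda>xs. (\<odot>) (\<tau> xs f)) (\<lambda>xs. F xs y) us
     + symbol_act n F \<sigma> (\<lambda>vs. \<tau> vs f) us \<odot> y"
      by (rule act_symbol[OF S F G that(2,3) CS that(1)])
    have b: "act m G (\<lambda>vs. F vs (f \<odot> y)) us = f \<odot> act m G (\<lambda>vs. F vs y) us
     + wedge m (\<lambda>xs. (\<odot>) (\<tau> xs f)) (\<lambda>vs. F vs y) us
     + (-1) ^ (n * m) *\<^sub>R wedge n (\<lambda>xs. (\<odot>) (\<sigma> xs f)) (\<lambda>xs. G xs y) us
     + symbol_act m G \<tau> (\<lambda>vs. \<sigma> vs f) us \<odot> y"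
      by (rule act_symbol[OF S G F that(2,3) CS that(1)])
    show ?thesis
    unfolding op_bracket_def a b
    by (cases n rule: neg_one_pow_cases; cases m rule: neg_one_pow_cases)
     (auto simp: fun_eq_iff fscale_def scaleR_fun_def algebra_simps power_mult)
  qed
  then show ?thesis
    unfolding section_der_def using alt_op_op_bracket[OF S mF mG] fun_linear sym[OF F G] sym[OF G F]
    by (simp add: subspace_diff[OF C] subspace_scale[OF C])
qed

section \<open>Smooth functions and bump functions\<close>

lemma frechet_derivative_cong:
  assumes "open S" "x \<in> S" "\<And>y. y \<in> S \<Longrightarrow> f y = g y"
  shows "frechet_derivative f (at x) = frechet_derivative g (at x)"
proof -
  have "(f has_derivative D) (at x) \<longleftrightarrow> (g has_derivative D) (at x)" for D
    using assms has_derivative_transform_within_open[of f D x UNIV S g]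
      has_derivative_transform_within_open[of g D x UNIV S f] by auto
  then show ?thesis unfolding frechet_derivative_def by simp
qed

lemma differentiable_cong_open:
  assumes "open S" "x \<in> S" "\<And>y. y \<in> S \<Longrightarrow> f y = g y" "f differentiable (at x)"
  shows "g differentiable (at x)"
  using assms has_derivative_transform_within_open[of f _ x UNIV S g] unfolding differentiable_def by blast

lemma Ck_on_cong:
  assumes "open S" "\<And>y. y \<in> S \<Longrightarrow> f y = g y" "Ck_on k S f"
  shows "Ck_on k S g"
  using assms(2,3)
proof (induction k arbitrary: f g)
  case 0
  then show ?case using continuous_on_cong[of S S f g] by simp
next
  case (Suc k)
  have "Ck_on k S (\<lambda>x. frechet_derivative g (at x) v)" for v
    by (rule Suc.IH[of "\<lambda>x. frechet_derivative f (at x) v"])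
      (use Suc.prems frechet_derivative_cong[OF assms(1) _ Suc.prems(1)] in auto)
  then show ?case using Suc.prems differentiable_cong_open[OF assms(1) _ Suc.prems(1)] by auto
qed

lemma Ck_on_subset: "Ck_on k S f \<Longrightarrow> S' \<subseteq> S \<Longrightarrow> Ck_on k S' f"
  by (induction k arbitrary: f) (auto intro: continuous_on_subset)

lemma Ck_on_local:
  assumes "\<And>x. x \<in> S \<Longrightarrow> \<exists>U. open U \<and> x \<in> U \<and> Ck_on k (S \<inter> U) f" "open S"
  shows "Ck_on k S f"
  using assms(1)
proof (induction k arbitrary: f)
  case 0
  have "continuous_on S f"
  proof (rule continuous_at_imp_continuous_on, rule ballI)
    fix x assume "x \<in> S"
    then obtain U where U: "open U" "x \<in> U" "continuous_on (S \<inter> U) f" using 0 by auto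
    then show "continuous (at x) f" using continuous_on_eq_continuous_at[of "S \<inter> U" f] \<open>x \<in> S\<close> assms(2) by auto
  qed
  then show ?case by simp
next
  case (Suc k)
  have "f differentiable at x" if "x \<in> S" for x using Suc.prems[OF that] that by auto
  moreover have "Ck_on k S (\<lambda>x. frechet_derivative f (at x) v)" for v
    by (rule Suc.IH) (use Suc.prems in fastforce)
  ultimately show ?case by simp
qed

lemma Ck_on_SucD: "Ck_on (Suc k) S f \<Longrightarrow> Ck_on k S f"
proof (induction k arbitrary: f)
  case 0
  then show ?case
    by (auto intro!: continuous_at_imp_continuous_on differentiable_imp_continuous_within)
next
  case (Suc k)
  note d = Suc.prems[unfolded Ck_on.simps(2)[of "Suc k"]]
  show ?case unfolding Ck_on.simps(2)[of k]
    using d Suc.IH by blast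
qed

text \<open>Permits an explicit derivative in place of the chosen \<open>frechet_derivative\<close>,
  so that closure properties reduce to differentiation rules.\<close>

lemma Ck_on_SucI:
  assumes "open S" "\<And>x. x \<in> S \<Longrightarrow> (f has_derivative D x) (at x)" "\<And>v. Ck_on k S (\<lambda>x. D x v)"
  shows "Ck_on (Suc k) S f"
proof -
  have "Ck_on k S (\<lambda>x. frechet_derivative f (at x) v)" for v
    by (rule Ck_on_cong[OF assms(1) _ assms(3)]) (use frechet_derivative_at[OF assms(2)] in simp)
  then show ?thesis using assms(2) by (auto simp: differentiable_def)
qed

lemma Ck_on_SucE:
  assumes "Ck_on (Suc k) S f" "x \<in> S"
  shows "(f has_derivative frechet_derivative f (at x)) (at x)"
  using assms frechet_derivative_works[of f "at x"] by simp

lemma Ck_on_const: "Ck_on k S (\<lambda>x. c)"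
  by (induction k arbitrary: c) (auto simp: frechet_derivative_const)

lemma Ck_on_bounded_linear:
  assumes "open S" "bounded_linear L" "Ck_on k S f"
  shows "Ck_on k S (\<lambda>x. L (f x))"
  using assms(3)
proof (induction k arbitrary: f)
  case 0
  then show ?case using bounded_linear.continuous_on[OF assms(2)] by simp
next
  case (Suc k)
  show ?case
    by (rule Ck_on_SucI[OF assms(1) bounded_linear.has_derivative[OF assms(2) Ck_on_SucE[OF Suc.prems]]])
      (use Suc in auto)
qed

lemma Ck_on_add:
  assumes "open S" "Ck_on k S f" "Ck_on k S g"
  shows "Ck_on k S (\<lambda>x. f x + g x)"
  using assms(2,3)
proof (induction k arbitrary: f g)
  case 0
  then show ?case by (simp add: continuous_on_add)
next
  case (Suc k)
  show ?case
    by (rule Ck_on_SucI[OF assms(1) has_derivative_add[OF Ck_on_SucE[OF Suc.prems(1)] Ck_on_SucE[OF Suc.prems(2)]]])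
      (use Suc in auto)
qed

lemma Ck_on_bilinear:
  assumes "open S" "bounded_bilinear p" "Ck_on k S f" "Ck_on k S g"
  shows "Ck_on k S (\<lambda>x. p (f x) (g x))"
  using assms(3,4)
proof (induction k arbitrary: f g)
  case 0
  then show ?case using bounded_bilinear.continuous_on[OF assms(2)] by simp
next
  case (Suc k)
  show ?case
    by (rule Ck_on_SucI[OF assms(1) bounded_bilinear.FDERIV[OF assms(2) Ck_on_SucE[OF Suc.prems(1)] Ck_on_SucE[OF Suc.prems(2)]]])
      (use Suc.IH Suc.prems Ck_on_SucD[OF Suc.prems(1)] Ck_on_SucD[OF Suc.prems(2)] in \<open>auto intro!: Ck_on_add[OF assms(1)]\<close>)
qed

lemmas Ck_on_scaleR = Ck_on_bilinear[OF _ bounded_bilinear_scaleR]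
lemmas Ck_on_mult = Ck_on_bilinear[OF _ bounded_bilinear_mult]
lemmas Ck_on_inner = Ck_on_bilinear[OF _ bounded_bilinear_inner]

lemma Ck_on_inverse:
  fixes f :: "'a::real_normed_vector \<Rightarrow> real"
  assumes "open S" "\<And>x. x \<in> S \<Longrightarrow> f x \<noteq> 0" "Ck_on k S f"
  shows "Ck_on k S (\<lambda>x. inverse (f x))"
  using assms(3)
proof (induction k)
  case 0
  then show ?case using assms(2) by (simp add: continuous_on_inverse)
next
  case (Suc k)
  note I = Suc.IH[OF Ck_on_SucD[OF Suc.prems]]
  show ?case
  proof (rule Ck_on_SucI[OF assms(1)])
    fix x assume x: "x \<in> S"
    show "((\<lambda>x. inverse (f x)) has_derivative
       (\<lambda>v. (-1) *\<^sub>R (inverse (f x) * (frechet_derivative f (at x) v * inverse (f x))))) (at x)"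
      using Deriv.has_derivative_inverse[OF assms(2)[OF x] Ck_on_SucE[OF Suc.prems x]] by (simp add: mult.assoc)
  next
    show "Ck_on k S (\<lambda>x. (-1) *\<^sub>R (inverse (f x) * (frechet_derivative f (at x) v * inverse (f x))))" for v
      by (rule Ck_on_scaleR[OF assms(1) Ck_on_const Ck_on_mult[OF assms(1) I Ck_on_mult[OF assms(1) _ I]]])
        (use Suc.prems in simp)
  qed
qed

text \<open>The family \<open>t\<^bsup>-k\<^esup> exp(-1/t)\<close>, extended by 0, is closed under differentiation up to linear
  combinations, so its smoothness follows by induction on the order for all \<open>k\<close> simultaneously.\<close>

definition flat :: "nat \<Rightarrow> real \<Rightarrow> real" where
  "flat k t = (if t > 0 then inverse t ^ k * exp (- inverse t) else 0)"

lemma power_le_exp: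
  fixes x :: real assumes "0 \<le> x" shows "x ^ n \<le> fact n * exp x"
proof -
  have "inverse (fact n) *\<^sub>R x ^ n \<le> (\<Sum>n. inverse (fact n) *\<^sub>R x ^ n)"
    using sum_le_suminf[OF summable_exp_generic[of x], of "{n}"] assms by simp
  then show ?thesis unfolding exp_def by (simp add: field_simps)
qed

text \<open>The exponential dominates two more powers of \<open>inverse t\<close> than
  \<open>flat k\<close> contains. They leave the factor \<open>t ^ 2\<close>, by which the
  difference quotient at 0 tends to 0.\<close>

lemma flat_bound: "\<bar>flat k t\<bar> \<le> fact (k + 2) * t ^ 2"
proof (cases "t > 0")
  case True
  have "inverse t ^ (k + 2) \<le> fact (k + 2) * exp (inverse t)" by (rule power_le_exp) (use True in simp)
  then have "inverse t ^ (k + 2) * exp (- inverse t) \<le> fact (k + 2) * exp (inverse t) * exp (- inverse t)"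
    by (rule mult_right_mono) simp
  also have "\<dots> = fact (k + 2)" by (simp only: mult.assoc flip: exp_add) simp
  finally have "inverse t ^ (k + 2) * exp (- inverse t) * t ^ 2 \<le> fact (k + 2) * t ^ 2"
    by (rule mult_right_mono) simp
  moreover have "inverse t ^ (k + 2) * exp (- inverse t) * t ^ 2 = flat k t"
    using True by (simp add: flat_def power_add power2_eq_square field_simps)
  moreover have "0 \<le> flat k t" using True by (simp add: flat_def)
  ultimately show ?thesis by (simp only: abs_of_nonneg)
qed (simp add: flat_def)

lemma flat_deriv: "(flat k has_field_derivative flat (k + 2) t - real k * flat (k + 1) t) (at t)"
proof -
  consider "t > 0" | "t < 0" | "t = 0" by linarith
  then show ?thesis
  proof cases
    case 1
    have d: "(inverse has_field_derivative - (inverse t ^ 2)) (at t)"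
      using 1 by (auto intro!: derivative_eq_intros simp: power2_eq_square)
    have "((\<lambda>t. inverse t ^ k * exp (- inverse t)) has_field_derivative
       (flat (k + 2) t - real k * flat (k + 1) t)) (at t)"
      using DERIV_mult[OF DERIV_power[OF d, of k] DERIV_fun_exp[OF DERIV_minus[OF d]]] 1
      by (cases k) (simp_all add: flat_def power2_eq_square algebra_simps)
    then show ?thesis
      by (rule has_field_derivative_transform_within_open[where S="{0<..}"]) (use 1 in \<open>auto simp: flat_def\<close>)
  next
    case 2
    have "((\<lambda>t. 0) has_field_derivative (flat (k + 2) t - real k * flat (k + 1) t)) (at t)"
      using 2 by (simp add: flat_def)
    then show ?thesis
      by (rule has_field_derivative_transform_within_open[where S="{..<0}"]) (use 2 in \<open>auto simp: flat_def\<close>)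
  next
    case 3
    have "((\<lambda>h. flat k h / h) \<longlongrightarrow> 0) (at 0)"
    proof (rule Lim_null_comparison[where g="\<lambda>h. fact (k + 2) * \<bar>h\<bar>"])
      show "\<forall>\<^sub>F h in at 0. norm (flat k h / h) \<le> fact (k + 2) * \<bar>h\<bar>"
        unfolding eventually_at_filter
      proof (rule always_eventually, intro allI impI)
        fix h :: real assume "h \<noteq> 0"
        have "\<bar>flat k h\<bar> / \<bar>h\<bar> \<le> fact (k + 2) * h ^ 2 / \<bar>h\<bar>"
          by (rule divide_right_mono[OF flat_bound]) simp
        also have "\<dots> = fact (k + 2) * \<bar>h\<bar>"
          using \<open>h \<noteq> 0\<close> by (cases "h \<ge> 0") (simp_all add: power2_eq_square)
        finally show "norm (flat k h / h) \<le> fact (k + 2) * \<bar>h\<bar>" by simp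
      qed
      show "((\<lambda>h. fact (k + 2) * \<bar>h\<bar>) \<longlongrightarrow> (0::real)) (at 0)"
        by (auto intro!: tendsto_eq_intros)
    qed
    then show ?thesis using 3 by (simp add: has_field_derivative_iff flat_def)
  qed
qed

lemma Ck_on_flat:
  assumes "open S" "Ck_on n S s"
  shows "Ck_on n S (\<lambda>x. flat k (s x))"
  using assms(2)
proof (induction n arbitrary: k)
  case 0
  have "continuous_on UNIV (flat k)"
    by (rule DERIV_continuous_on[OF flat_deriv])
  then show ?case using 0 continuous_on_compose2[of UNIV "flat k" S s] by auto
next
  case (Suc n)
  note IH = Suc.IH[OF Ck_on_SucD[OF Suc.prems]]
  show ?case
  proof (rule Ck_on_SucI[OF assms(1)])
    fix x assume x: "x \<in> S"
    show "((\<lambda>x. flat k (s x)) has_derivative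
      (\<lambda>v. (flat (k + 2) (s x) + (- real k) * flat (k + 1) (s x)) * frechet_derivative s (at x) v)) (at x)"
      using DERIV_compose_FDERIV[OF flat_deriv Ck_on_SucE[OF Suc.prems x]] by (simp add: mult.commute)
  next
    show "Ck_on n S (\<lambda>x. (flat (k + 2) (s x) + (- real k) * flat (k + 1) (s x)) * frechet_derivative s (at x) v)" for v
      by (rule Ck_on_mult[OF assms(1) Ck_on_add[OF assms(1) IH Ck_on_mult[OF assms(1) Ck_on_const IH]]])
        (use Suc.prems in simp)
  qed
qed

text \<open>The denominator never vanishes, since t and 1 - t are not both nonpositive. The
  numerator is 0 for t \<le> 0, and the second summand is 0 for t \<ge> 1.\<close>

definition smooth_step :: "real \<Rightarrow> real" where
  "smooth_step t = flat 0 t * inverse (flat 0 t + flat 0 (1 - t))"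

lemma flat0_pos: "flat 0 t + flat 0 (1 - t) \<noteq> 0"
proof -
  have "0 < t \<or> 0 < 1 - t" by linarith
  then have "0 < flat 0 t + flat 0 (1 - t)" by (auto simp: flat_def add_pos_nonneg add_nonneg_pos)
  then show ?thesis by simp
qed

lemma smooth_step_simps: "t \<le> 0 \<Longrightarrow> smooth_step t = 0" "1 \<le> t \<Longrightarrow> smooth_step t = 1"
  by (auto simp: smooth_step_def flat_def)

lemma Ck_on_smooth_step:
  assumes "open S" "Ck_on n S s"
  shows "Ck_on n S (\<lambda>x. smooth_step (s x))"
proof -
  have "Ck_on n S (\<lambda>x. 1 + (-1) *\<^sub>R s x)"
    by (rule Ck_on_add[OF assms(1) Ck_on_const Ck_on_scaleR[OF assms(1) Ck_on_const assms(2)]])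
  then have c: "Ck_on n S (\<lambda>x. 1 - s x)" by simp
  note f = Ck_on_flat[OF assms] Ck_on_flat[OF assms(1) c]
  show ?thesis unfolding smooth_step_def
    by (rule Ck_on_mult[OF assms(1) f(1) Ck_on_inverse[OF assms(1) flat0_pos Ck_on_add[OF assms(1) f]]])
qed

text \<open>The model spaces need not be of class \<^class>\<open>euclidean_space\<close>, so the library results on bases and
  compactness do not apply to them directly.\<close>

lemma finite_dim_orthogonal_basis:
  assumes "finite_dim TYPE('a::real_inner)"
  obtains B :: "'a::real_inner set" where "finite B" "0 \<notin> B" "\<And>x. x = (\<Sum>b\<in>B. ((x \<bullet> b) / (b \<bullet> b)) *\<^sub>R b)"
proof -
  obtain B0 :: "'a set" where "finite B0" "span B0 = UNIV" using assms unfolding finite_dim_def by blast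
  then obtain C :: "'a set" where C: "finite C" "span C = UNIV" "pairwise orthogonal C"
    using basis_orthogonal[of B0] by auto
  \<comment> \<open>Orthogonality alone admits the zero vector, for which the coefficient formula
    would divide by 0; removing it does not change the span.\<close>
  let ?B = "C - {0}"
  have B: "finite ?B" "span ?B = UNIV" "pairwise orthogonal ?B"
    using C by (auto simp: span_delete_0 pairwise_def)
  have eq: "x = (\<Sum>b\<in>?B. ((x \<bullet> b) / (b \<bullet> b)) *\<^sub>R b)" for x
  proof -
    have "x \<in> span ?B" using B(2) by simp
    then obtain c where c: "x = (\<Sum>b\<in>?B. c b *\<^sub>R b)" unfolding span_finite[OF B(1)] by blast
    have "x \<bullet> b = c b * (b \<bullet> b)" if b: "b \<in> ?B" for b
    proof -
      have "x \<bullet> b = (\<Sum>b'\<in>?B. c b' * (b' \<bullet> b))" by (subst c) (simp add: inner_sum_left)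
      also have "\<dots> = (\<Sum>b'\<in>?B. if b' = b then c b * (b \<bullet> b) else 0)"
        by (rule sum.cong) (use B(3) b in \<open>auto simp: pairwise_def orthogonal_def\<close>)
      also have "\<dots> = c b * (b \<bullet> b)" using B(1) b by simp
      finally show ?thesis .
    qed
    then have "(\<Sum>b\<in>?B. ((x \<bullet> b) / (b \<bullet> b)) *\<^sub>R b) = (\<Sum>b\<in>?B. c b *\<^sub>R b)"
      by (intro sum.cong) auto
    then show ?thesis by (rule trans[OF c sym])
  qed
  show ?thesis by (rule that[OF B(1) _ eq]) simp
qed

text \<open>The ball is a closed subset of a box of coefficients with respect to an orthogonal
  basis. The box is compact as a continuous image of intervals, built up one basis vector at a
  time.\<close>

lemma finite_dim_compact_cball:
  assumes "finite_dim TYPE('a::real_inner)"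
  shows "compact (cball (c::'a::real_inner) r)"
proof -
  obtain B :: "'a set" where B: "finite B" "0 \<notin> B" "\<And>x. x = (\<Sum>b\<in>B. ((x \<bullet> b) / (b \<bullet> b)) *\<^sub>R b)"
    using finite_dim_orthogonal_basis[OF assms] by metis
  define K where "K B R = {\<Sum>b\<in>B. f b *\<^sub>R b |f. \<forall>b\<in>B. \<bar>f b\<bar> \<le> R b}" for B and R :: "'a \<Rightarrow> real"
  have K: "compact (K B R)" if "finite B" for B R
    using that
  proof (induction B)
    case empty
    then show ?case by (simp add: K_def)
  next
    case (insert b B)
    have "K (insert b B) R = (\<lambda>(t, k). t *\<^sub>R b + k) ` ({- R b..R b} \<times> K B R)" (is "?L = ?R")
    proof (intro set_eqI iffI)
      fix x assume "x \<in> ?L"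
      then obtain f where f: "x = (\<Sum>b\<in>insert b B. f b *\<^sub>R b)" "\<forall>b\<in>insert b B. \<bar>f b\<bar> \<le> R b"
        unfolding K_def by blast
      then have "x = (\<lambda>(t, k). t *\<^sub>R b + k) (f b, \<Sum>b\<in>B. f b *\<^sub>R b)" using insert by simp
      moreover have "(f b, \<Sum>b\<in>B. f b *\<^sub>R b) \<in> {- R b..R b} \<times> K B R"
        using f(2) unfolding K_def by (auto simp: abs_le_iff)
      ultimately show "x \<in> ?R" by blast
    next
      fix x assume "x \<in> ?R"
      then obtain t f where f: "x = t *\<^sub>R b + (\<Sum>b\<in>B. f b *\<^sub>R b)" "\<bar>t\<bar> \<le> R b" "\<forall>b\<in>B. \<bar>f b\<bar> \<le> R b"
        unfolding K_def by (auto simp: abs_le_iff)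
      have "(\<Sum>c\<in>B. (f(b := t)) c *\<^sub>R c) = (\<Sum>b\<in>B. f b *\<^sub>R b)"
        by (rule sum.cong) (use insert in auto)
      then have "x = (\<Sum>c\<in>insert b B. (f(b := t)) c *\<^sub>R c)" using f insert by simp
      then show "x \<in> ?L" unfolding K_def using f by (intro CollectI exI[of _ "f(b := t)"]) auto
    qed
    moreover have "compact ?R"
      by (intro compact_continuous_image compact_Times insert.IH compact_Icc)
        (auto intro!: continuous_intros simp: case_prod_unfold)
    ultimately show ?case by simp
  qed
  \<comment> \<open>By Cauchy-Schwarz the coefficient of \<open>x\<close> at \<open>b\<close> is at
    most norm x / norm b, and norm x is bounded on the ball.\<close>
  define R where "R b = (norm c + \<bar>r\<bar>) / norm b" for b :: 'a
  have "cball c r \<subseteq> K B R"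
  proof
    fix x assume "x \<in> cball c r"
    then have n: "norm x \<le> norm c + \<bar>r\<bar>"
      using norm_triangle_sub[of x c] by (simp add: dist_norm norm_minus_commute)
    have "\<bar>(x \<bullet> b) / (b \<bullet> b)\<bar> \<le> R b" if "b \<in> B" for b
    proof -
      have b: "norm b > 0" using that B(2) by auto
      have "\<bar>x \<bullet> b\<bar> \<le> norm x * norm b" by (rule Cauchy_Schwarz_ineq2)
      also have "\<dots> \<le> (norm c + \<bar>r\<bar>) * norm b" using n b by simp
      finally have "\<bar>x \<bullet> b\<bar> \<le> (norm c + \<bar>r\<bar>) * norm b" .
      then show ?thesis using b by (simp add: R_def dot_square_norm field_simps power2_eq_square abs_mult)
    qed
    then show "x \<in> K B R" unfolding K_def using B(3)[of x]
      by (intro CollectI exI[of _ "\<lambda>b. (x \<bullet> b) / (b \<bullet> b)"] conjI ballI)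
  qed
  then have "cball c r = K B R \<inter> cball c r" by blast
  then show ?thesis using compact_Int_closed[OF K[OF B(1)] closed_cball, of R c r] by simp
qed

section \<open>Manifolds and vector bundles\<close>

locale manifold =
  fixes A :: "('m::{t2_space,second_countable_topology}, 'e::real_inner) chart set"
  assumes mfd: "smooth_manifold A"
begin

lemma chartD:
  assumes "(U, \<phi>) \<in> A"
  shows "open U" "open (\<phi> ` U)" "homeomorphism U (\<phi> ` U) \<phi> (inv_into U \<phi>)"
proof -
  have "\<forall>(U, \<phi>)\<in>A. open U \<and> open (\<phi> ` U) \<and> homeomorphism U (\<phi> ` U) \<phi> (inv_into U \<phi>)"
    using mfd unfolding smooth_manifold_def by (elim conjE)
  from bspec[OF this assms] show "open U" "open (\<phi> ` U)" "homeomorphism U (\<phi> ` U) \<phi> (inv_into U \<phi>)"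
    by simp_all
qed

lemma transition:
  assumes "(U, \<phi>) \<in> A" "(V, \<psi>) \<in> A" shows "Cinf_on (\<phi> ` (U \<inter> V)) (\<psi> \<circ> inv_into U \<phi>)"
proof -
  have "\<forall>(U, \<phi>)\<in>A. \<forall>(V, \<psi>)\<in>A. Cinf_on (\<phi> ` (U \<inter> V)) (\<psi> \<circ> inv_into U \<phi>)"
    using mfd unfolding smooth_manifold_def by (elim conjE)
  from bspec[OF this assms(1), unfolded split_conv, rule_format, OF assms(2)] show ?thesis by simp
qed

lemma chart_ex: obtains U \<phi> where "(U, \<phi>) \<in> A" "p \<in> U"
proof -
  have "p \<in> (\<Union>(U, \<phi>)\<in>A. U)" using mfd unfolding smooth_manifold_def by simp
  then show ?thesis using that by auto
qed

lemma chart_inv: "(U, \<phi>) \<in> A \<Longrightarrow> x \<in> U \<Longrightarrow> inv_into U \<phi> (\<phi> x) = x"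
  using homeomorphism_apply1[OF chartD(3)] .

lemma chart_open:
  assumes "(U, \<phi>) \<in> A" "open W" shows "open (\<phi> ` (U \<inter> W))"
proof -
  have "openin (top_of_set U) (U \<inter> W)" using assms(2) by (rule openin_open_Int)
  then have "openin (top_of_set (\<phi> ` U)) (\<phi> ` (U \<inter> W))"
    using homeomorphism_imp_open_map[OF chartD(3)[OF assms(1)]] by blast
  then show ?thesis using openin_open_trans[OF _ chartD(2)[OF assms(1)]] by blast
qed

definition smooth :: "'m set \<Rightarrow> ('m \<Rightarrow> 'b::real_normed_vector) \<Rightarrow> bool" where
  "smooth W f \<longleftrightarrow> (\<forall>k. \<forall>(U, \<phi>)\<in>A. Ck_on k (\<phi> ` (U \<inter> W)) (\<lambda>z. f (inv_into U \<phi> z)))"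

lemma smooth_map_on_smooth: "smooth_map_on A W f \<longleftrightarrow> smooth W f"
  unfolding smooth_map_on_def smooth_def Cinf_on_def comp_def by auto

lemma smoothI:
  "(\<And>k U \<phi>. (U, \<phi>) \<in> A \<Longrightarrow> Ck_on k (\<phi> ` (U \<inter> W)) (\<lambda>z. f (inv_into U \<phi> z))) \<Longrightarrow> smooth W f"
  unfolding smooth_def by auto

lemma smoothD: "smooth W f \<Longrightarrow> (U, \<phi>) \<in> A \<Longrightarrow> Ck_on k (\<phi> ` (U \<inter> W)) (\<lambda>z. f (inv_into U \<phi> z))"
  unfolding smooth_def by auto

lemma smooth_cong:
  assumes "open W" "smooth W f" "\<And>x. x \<in> W \<Longrightarrow> f x = g x" shows "smooth W g"
proof (rule smoothI)
  fix k U \<phi> assume U: "(U, \<phi>) \<in> A"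
  show "Ck_on k (\<phi> ` (U \<inter> W)) (\<lambda>z. g (inv_into U \<phi> z))"
    by (rule Ck_on_cong[OF chart_open[OF U assms(1)] _ smoothD[OF assms(2) U]])
      (use assms(3) chart_inv[OF U] in auto)
qed

lemma smooth_subset:
  assumes "smooth W f" "W' \<subseteq> W" shows "smooth W' f"
proof (rule smoothI)
  fix k U \<phi> assume U: "(U, \<phi>) \<in> A"
  show "Ck_on k (\<phi> ` (U \<inter> W')) (\<lambda>z. f (inv_into U \<phi> z))"
    by (rule Ck_on_subset[OF smoothD[OF assms(1) U]]) (use assms(2) in blast)
qed

lemma smooth_local:
  assumes W: "open W" and loc: "\<And>p. p \<in> W \<Longrightarrow> \<exists>N. open N \<and> p \<in> N \<and> smooth (W \<inter> N) f"
  shows "smooth W f"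
proof (rule smoothI)
  fix k U \<phi> assume U: "(U, \<phi>) \<in> A"
  show "Ck_on k (\<phi> ` (U \<inter> W)) (\<lambda>z. f (inv_into U \<phi> z))"
  proof (rule Ck_on_local[OF _ chart_open[OF U W]])
    fix z assume "z \<in> \<phi> ` (U \<inter> W)"
    then obtain p where p: "z = \<phi> p" "p \<in> U" "p \<in> W" by blast
    then obtain N where N: "open N" "p \<in> N" "smooth (W \<inter> N) f" using loc by blast
    have "\<phi> ` (U \<inter> W) \<inter> \<phi> ` (U \<inter> N) \<subseteq> \<phi> ` (U \<inter> (W \<inter> N))"
    proof
      fix y assume "y \<in> \<phi> ` (U \<inter> W) \<inter> \<phi> ` (U \<inter> N)"
      then obtain a b where "y = \<phi> a" "a \<in> U" "a \<in> W" "y = \<phi> b" "b \<in> U" "b \<in> N" by blast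
      then show "y \<in> \<phi> ` (U \<inter> (W \<inter> N))" using chart_inv[OF U, of a] chart_inv[OF U, of b] by auto
    qed
    then have "Ck_on k (\<phi> ` (U \<inter> W) \<inter> \<phi> ` (U \<inter> N)) (\<lambda>z. f (inv_into U \<phi> z))"
      by (rule Ck_on_subset[OF smoothD[OF N(3) U]])
    then show "\<exists>O'. open O' \<and> z \<in> O' \<and> Ck_on k (\<phi> ` (U \<inter> W) \<inter> O') (\<lambda>z. f (inv_into U \<phi> z))"
      using chart_open[OF U N(1)] p N(2) by blast
  qed
qed

lemma smooth_const: "smooth W (\<lambda>x. c)"
  by (rule smoothI) (rule Ck_on_const)

lemma smooth_bounded_linear:
  assumes "open W" "bounded_linear L" "smooth W f" shows "smooth W (\<lambda>x. L (f x))"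
proof (rule smoothI)
  fix k U \<phi> assume U: "(U, \<phi>) \<in> A"
  show "Ck_on k (\<phi> ` (U \<inter> W)) (\<lambda>z. L (f (inv_into U \<phi> z)))"
    by (rule Ck_on_bounded_linear[OF chart_open[OF U assms(1)] assms(2) smoothD[OF assms(3) U]])
qed

lemma smooth_add:
  assumes "open W" "smooth W f" "smooth W g" shows "smooth W (\<lambda>x. f x + g x)"
proof (rule smoothI)
  fix k U \<phi> assume U: "(U, \<phi>) \<in> A"
  show "Ck_on k (\<phi> ` (U \<inter> W)) (\<lambda>z. f (inv_into U \<phi> z) + g (inv_into U \<phi> z))"
    by (rule Ck_on_add[OF chart_open[OF U assms(1)] smoothD[OF assms(2) U] smoothD[OF assms(3) U]])
qed

lemma smooth_scaleR:
  assumes "open W" "smooth W f" "smooth W g" shows "smooth W (\<lambda>x. f x *\<^sub>R g x)"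
proof (rule smoothI)
  fix k U \<phi> assume U: "(U, \<phi>) \<in> A"
  show "Ck_on k (\<phi> ` (U \<inter> W)) (\<lambda>z. f (inv_into U \<phi> z) *\<^sub>R g (inv_into U \<phi> z))"
    by (rule Ck_on_scaleR[OF chart_open[OF U assms(1)] smoothD[OF assms(2) U] smoothD[OF assms(3) U]])
qed

text \<open>\<open>K\<close> is the preimage in the chart of a compact ball. It is compact and
  hence, the manifold being Hausdorff, closed in the whole manifold and not only in the chart; this
  makes the extension by 0 smooth.\<close>

lemma bump:
  assumes W: "open W" and p: "p \<in> W"
  obtains \<eta> :: "'m \<Rightarrow> real" and N K where "smooth UNIV \<eta>" "open N" "p \<in> N" "N \<subseteq> W" "\<And>x. x \<in> N \<Longrightarrow> \<eta> x = 1"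
    "closed K" "K \<subseteq> W" "\<And>x. x \<notin> K \<Longrightarrow> \<eta> x = 0"
proof -
  obtain U \<phi> where U: "(U, \<phi>) \<in> A" "p \<in> U" by (rule chart_ex)
  note hom = chartD(3)[OF U(1)]
  have "open (\<phi> ` (U \<inter> W))" by (rule chart_open[OF U(1) W])
  moreover have "\<phi> p \<in> \<phi> ` (U \<inter> W)" using U p by blast
  ultimately obtain e where e: "e > 0" "cball (\<phi> p) e \<subseteq> \<phi> ` (U \<inter> W)"
    unfolding open_contains_cball by blast
  define r where "r = e / 2"
  have r: "r > 0" "cball (\<phi> p) (2 * r) \<subseteq> \<phi> ` (U \<inter> W)" using e by (simp_all add: r_def)
  \<comment> \<open>This is 2 - (distance / r)^2: at least 1 within distance \<open>r\<close>, and
    below 0 beyond \<open>2 * r\<close>, where it is less than 2 - 4. The squared norm keeps it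
    smooth at the centre.\<close>
  let ?q = "\<lambda>z. 2 + - inverse (r ^ 2) * ((z - \<phi> p) \<bullet> (z - \<phi> p))"
  define \<eta> where "\<eta> x = (if x \<in> U then smooth_step (?q (\<phi> x)) else 0)" for x
  define K where "K = inv_into U \<phi> ` cball (\<phi> p) (2 * r)"
  define N where "N = \<phi> -` ball (\<phi> p) r \<inter> U"
  have "finite_dim TYPE('e)" using mfd unfolding smooth_manifold_def by simp
  then have "compact (cball (\<phi> p) (2 * r))" by (rule finite_dim_compact_cball)
  moreover have "continuous_on (cball (\<phi> p) (2 * r)) (inv_into U \<phi>)"
    using r(2) by (intro continuous_on_subset[OF homeomorphism_cont2[OF hom]]) blast
  ultimately have "compact K" unfolding K_def by (intro compact_continuous_image)
  then have K: "closed K" by (rule compact_imp_closed)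
  have KUW: "K \<subseteq> U \<inter> W"
  proof
    fix x assume "x \<in> K"
    then obtain z where z: "z \<in> cball (\<phi> p) (2 * r)" "x = inv_into U \<phi> z" unfolding K_def by blast
    then obtain a where "a \<in> U" "a \<in> W" "z = \<phi> a" using r(2) by blast
    then show "x \<in> U \<inter> W" using z(2) chart_inv[OF U(1)] by simp
  qed
  then have KW: "K \<subseteq> W" by blast
  have memK: "x \<in> K" if "x \<in> U" "\<phi> x \<in> cball (\<phi> p) (2 * r)" for x
    unfolding K_def using that(2) chart_inv[OF U(1) that(1)] by (intro image_eqI[of _ _ "\<phi> x"]) simp_all
  have \<eta>0: "\<eta> x = 0" if "x \<notin> K" for x
  proof (cases "x \<in> U")
    case True
    have "\<phi> x \<notin> cball (\<phi> p) (2 * r)" using memK[OF True] that by blast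
    then have "2 * r < norm (\<phi> x - \<phi> p)" by (simp add: dist_norm norm_minus_commute)
    then have "(2 * r) ^ 2 < (norm (\<phi> x - \<phi> p)) ^ 2" using r(1) by (intro power_strict_mono) auto
    then have "4 < inverse (r ^ 2) * (norm (\<phi> x - \<phi> p)) ^ 2" using r(1) by (simp add: field_simps power2_eq_square)
    then have "?q (\<phi> x) \<le> 0" by (simp add: dot_square_norm)
    then show ?thesis using True by (simp add: \<eta>_def smooth_step_simps)
  qed (simp add: \<eta>_def)
  have \<eta>1: "\<eta> x = 1" if "x \<in> N" for x
  proof -
    have "norm (\<phi> x - \<phi> p) < r" using that by (auto simp: N_def dist_norm norm_minus_commute)
    then have "(norm (\<phi> x - \<phi> p)) ^ 2 \<le> r ^ 2" by (intro power_mono) auto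
    then have "inverse (r ^ 2) * (norm (\<phi> x - \<phi> p)) ^ 2 \<le> 1" using r(1) by (simp add: field_simps)
    then have "1 \<le> ?q (\<phi> x)" by (simp add: dot_square_norm)
    then show ?thesis using that by (simp add: \<eta>_def N_def smooth_step_simps)
  qed
  have "open N"
    unfolding N_def
    using iffD1[OF continuous_on_open_vimage[OF chartD(1)[OF U(1)]] homeomorphism_cont1[OF hom]] open_ball
    by blast
  have pN: "p \<in> N" using U r(1) by (simp add: N_def)
  have NK: "N \<subseteq> K"
  proof
    fix x assume "x \<in> N"
    then have "x \<in> U" "dist (\<phi> p) (\<phi> x) < r" by (simp_all add: N_def)
    then show "x \<in> K" using memK[of x] r(1) by simp
  qed
  then have NW: "N \<subseteq> W" using KW by (rule subset_trans)
  \<comment> \<open>The chart domain and the complement of \<open>K\<close> are open and cover the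
    manifold; on the latter the function is 0.\<close>
  have "smooth UNIV \<eta>"
  proof (rule smooth_local[OF open_UNIV])
    fix q :: 'm
    show "\<exists>N. open N \<and> q \<in> N \<and> smooth (UNIV \<inter> N) \<eta>"
    proof (cases "q \<in> U")
      case True
      have "smooth U (\<lambda>x. smooth_step (?q (\<phi> x)))"
      proof (rule smoothI)
        fix k V \<psi> assume V: "(V, \<psi>) \<in> A"
        let ?O = "\<psi> ` (V \<inter> U)"
        note O = chart_open[OF V chartD(1)[OF U(1)]]
        have "Ck_on k ?O (\<lambda>z. \<phi> (inv_into V \<psi> z))"
          using transition[OF V U(1)] unfolding Cinf_on_def comp_def by blast
        then have d: "Ck_on k ?O (\<lambda>z. \<phi> (inv_into V \<psi> z) + - \<phi> p)"
          by (rule Ck_on_add[OF O _ Ck_on_const])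
        have "Ck_on k ?O (\<lambda>z. ?q (\<phi> (inv_into V \<psi> z)))"
          using Ck_on_add[OF O Ck_on_const[where c=2] Ck_on_mult[OF O Ck_on_const[where c="- inverse (r ^ 2)"] Ck_on_inner[OF O d d]]] by simp
        then show "Ck_on k ?O (\<lambda>z. smooth_step (?q (\<phi> (inv_into V \<psi> z))))"
          by (rule Ck_on_smooth_step[OF O])
      qed
      then have "smooth U \<eta>" by (rule smooth_cong[OF chartD(1)[OF U(1)]]) (simp add: \<eta>_def)
      then show ?thesis using True chartD(1)[OF U(1)] by auto
    next
      case False
      then have "q \<in> - K" using KUW by blast
      moreover have "smooth (- K) \<eta>"
        by (rule smooth_cong[OF _ smooth_const[of _ 0]]) (use K \<eta>0 in auto)
      ultimately show ?thesis using K by (intro exI[of _ "- K"]) auto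
    qed
  qed
  then show ?thesis
    by (rule that[OF _ \<open>open N\<close> pN NW \<eta>1 K KW \<eta>0])
qed

text \<open>\<open>g\<close> is controlled on \<open>V \<inter> W\<close> only. Together
  \<open>W\<close> and the complement of \<open>K\<close> cover \<open>V\<close>, and on the
  complement of \<open>K\<close> the extended product is 0.\<close>

lemma smooth_extend:
  assumes "open V" "open W" "closed K" "K \<subseteq> W" "\<And>x. x \<notin> K \<Longrightarrow> \<eta> x = 0" "smooth UNIV \<eta>" "smooth (V \<inter> W) g"
  shows "smooth V (\<lambda>x. if x \<in> W then \<eta> x *\<^sub>R g x else 0)" (is "smooth V ?h")
proof (rule smooth_local[OF assms(1)])
  fix p assume p: "p \<in> V"
  show "\<exists>N. open N \<and> p \<in> N \<and> smooth (V \<inter> N) ?h"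
  proof (cases "p \<in> W")
    case True
    have "smooth (V \<inter> W) (\<lambda>x. \<eta> x *\<^sub>R g x)"
      by (rule smooth_scaleR[OF _ smooth_subset[OF assms(6)] assms(7)]) (use assms in auto)
    then have "smooth (V \<inter> W) ?h"
      by (rule smooth_cong[rotated]) (use assms in auto)
    then show ?thesis using True assms(2) by blast
  next
    case False
    have "smooth (V \<inter> - K) ?h"
      by (rule smooth_cong[OF _ smooth_const[of _ 0]]) (use assms in auto)
    then show ?thesis using False assms(3,4) by (intro exI[of _ "- K"]) auto
  qed
qed

lemma smooth_funs_smooth: "f \<in> smooth_funs A \<longleftrightarrow> smooth UNIV f"
  by (simp add: smooth_funs_def smooth_map_on_smooth)

lemma subspace_smooth_funs: "subspace (smooth_funs A)"
proof (rule subspaceI)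
  show "0 \<in> smooth_funs A" using smooth_const[of UNIV "0::real"] by (simp add: smooth_funs_smooth zero_fun_def)
  show "f + g \<in> smooth_funs A" if "f \<in> smooth_funs A" "g \<in> smooth_funs A" for f g
    using that smooth_add[OF open_UNIV, of f g] by (simp add: smooth_funs_smooth plus_fun_def)
  show "c *\<^sub>R f \<in> smooth_funs A" if "f \<in> smooth_funs A" for c f
    using that smooth_scaleR[OF open_UNIV smooth_const, of f c] by (simp add: smooth_funs_smooth scaleR_fun_def)
qed

lemma smooth_funs_mult: "f \<in> smooth_funs A \<Longrightarrow> g \<in> smooth_funs A \<Longrightarrow> f * g \<in> smooth_funs A"
  using smooth_scaleR[OF open_UNIV, of f g] by (simp add: smooth_funs_smooth times_fun_def)

end

section \<open>Sections of vector bundles and tensoriality\<close>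

locale vbundle = manifold A for A :: "('m::{t2_space,second_countable_topology}, 'e::real_inner) chart set" +
  fixes E :: "'m \<Rightarrow> 'v::real_vector set"
    and T :: "('m, 'v, 'f::real_inner) trivialization set"
  assumes vb: "vector_bundle A E T"
begin

abbreviation "\<Gamma> \<equiv> sections A E T"
abbreviation "C \<equiv> smooth_funs A"

lemma fibre: "subspace (E x)"
  using vb unfolding vector_bundle_def by simp

lemma triv_ex: obtains U \<Phi> where "(U, \<Phi>) \<in> T" "p \<in> U"
proof -
  have "p \<in> (\<Union>(U, \<Phi>)\<in>T. U)" using vb unfolding vector_bundle_def by simp
  then show ?thesis using that by auto
qed

lemma trivD:
  assumes "(U, \<Phi>) \<in> T"
  shows "open U" "x \<in> U \<Longrightarrow> bij_betw (\<Phi> x) (E x) UNIV"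
    "x \<in> U \<Longrightarrow> v \<in> E x \<Longrightarrow> w \<in> E x \<Longrightarrow> \<Phi> x (a *\<^sub>R v + b *\<^sub>R w) = a *\<^sub>R \<Phi> x v + b *\<^sub>R \<Phi> x w"
proof -
  have "\<forall>(U, \<Phi>)\<in>T. open U \<and> (\<forall>x\<in>U. bij_betw (\<Phi> x) (E x) UNIV \<and>
     (\<forall>v\<in>E x. \<forall>w\<in>E x. \<forall>a b. \<Phi> x (a *\<^sub>R v + b *\<^sub>R w) = a *\<^sub>R \<Phi> x v + b *\<^sub>R \<Phi> x w))"
    using vb unfolding vector_bundle_def by (elim conjE)
  from bspec[OF this assms] show "open U" "x \<in> U \<Longrightarrow> bij_betw (\<Phi> x) (E x) UNIV"
    "x \<in> U \<Longrightarrow> v \<in> E x \<Longrightarrow> w \<in> E x \<Longrightarrow> \<Phi> x (a *\<^sub>R v + b *\<^sub>R w) = a *\<^sub>R \<Phi> x v + b *\<^sub>R \<Phi> x w"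
    by simp_all
qed

lemma triv_lin:
  assumes "(U, \<Phi>) \<in> T" "x \<in> U"
  shows "v \<in> E x \<Longrightarrow> w \<in> E x \<Longrightarrow> \<Phi> x (v + w) = \<Phi> x v + \<Phi> x w"
    "v \<in> E x \<Longrightarrow> \<Phi> x (a *\<^sub>R v) = a *\<^sub>R \<Phi> x v" "\<Phi> x 0 = 0"
  using trivD(3)[OF assms, of v w 1 1] trivD(3)[OF assms, of v v a 0]
    trivD(3)[OF assms, of 0 0 0 0] subspace_0[OF fibre] by simp_all

lemma triv_transition:
  assumes "(U, \<Phi>) \<in> T" "(V, \<Psi>) \<in> T"
  shows "smooth (U \<inter> V) (\<lambda>x. \<Psi> x (inv_into (E x) (\<Phi> x) w))"
proof -
  have "\<forall>(U, \<Phi>)\<in>T. \<forall>(V, \<Psi>)\<in>T. \<forall>w. smooth_map_on A (U \<inter> V) (\<lambda>x. \<Psi> x (inv_into (E x) (\<Phi> x) w))"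
    using vb unfolding vector_bundle_def by (elim conjE)
  from bspec[OF this assms(1), unfolded split_conv, rule_format, OF assms(2)]
  show ?thesis by (simp add: smooth_map_on_smooth)
qed

lemma local_section_iff:
  "smooth_section_on A E T W u \<longleftrightarrow>
    (\<forall>x\<in>W. u x \<in> E x) \<and> (\<forall>(V, \<Psi>)\<in>T. smooth (V \<inter> W) (\<lambda>x. \<Psi> x (u x)))"
  unfolding smooth_section_on_def smooth_map_on_smooth ..

lemma sections_iff: "u \<in> \<Gamma> \<longleftrightarrow> (\<forall>x. u x \<in> E x) \<and> (\<forall>(V, \<Psi>)\<in>T. smooth V (\<lambda>x. \<Psi> x (u x)))"
  unfolding sections_def local_section_iff by simp

lemma section_smooth: "u \<in> \<Gamma> \<Longrightarrow> (V, \<Psi>) \<in> T \<Longrightarrow> smooth V (\<lambda>x. \<Psi> x (u x))"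
  unfolding sections_iff by auto

lemma section_in: "u \<in> \<Gamma> \<Longrightarrow> u x \<in> E x" unfolding sections_iff by blast

lemma sections_fscale: "f \<in> C \<Longrightarrow> u \<in> \<Gamma> \<Longrightarrow> f \<odot> u \<in> \<Gamma>"
proof -
  assume f: "f \<in> C" and u: "u \<in> \<Gamma>"
  have "smooth V (\<lambda>x. \<Psi> x ((f \<odot> u) x))" if V: "(V, \<Psi>) \<in> T" for V \<Psi>
  proof (rule smooth_cong[OF trivD(1)[OF V] smooth_scaleR[OF trivD(1)[OF V] smooth_subset section_smooth[OF u V]]])
    show "smooth UNIV f" using f by (simp add: smooth_funs_smooth)
  qed (simp_all add: triv_lin[OF V] section_in[OF u] fscale_def)
  then show ?thesis using section_in[OF u] fibre unfolding sections_iff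
    by (auto simp: fscale_def subspace_scale)
qed

lemma subspace_sections: "subspace \<Gamma>"
proof (rule subspaceI)
  show "0 \<in> \<Gamma>"
    unfolding sections_iff
  proof (intro conjI allI ballI, goal_cases)
    case (1 x) show ?case by (simp add: subspace_0[OF fibre])
  next
    case (2 t)
    obtain V \<Psi> where t: "t = (V, \<Psi>)" by (cases t)
    have "smooth V (\<lambda>x. \<Psi> x ((0 :: 'm \<Rightarrow> 'v) x))"
      by (rule smooth_cong[OF _ smooth_const[of _ 0]]) (use 2 t trivD(1) triv_lin(3) in auto)
    then show ?case using t by simp
  qed
  show "u + w \<in> \<Gamma>" if u: "u \<in> \<Gamma>" and w: "w \<in> \<Gamma>" for u w
  proof -
    have "smooth V (\<lambda>x. \<Psi> x ((u + w) x))" if V: "(V, \<Psi>) \<in> T" for V \<Psi>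
      by (rule smooth_cong[OF trivD(1)[OF V] smooth_add[OF trivD(1)[OF V] section_smooth[OF u V] section_smooth[OF w V]]])
        (simp add: triv_lin[OF V] section_in[OF u] section_in[OF w])
    then show ?thesis using section_in[OF u] section_in[OF w] fibre unfolding sections_iff
      by (auto simp: subspace_add)
  qed
  show "c *\<^sub>R u \<in> \<Gamma>" if "u \<in> \<Gamma>" for c u
  proof -
    have "(\<lambda>_. c) \<in> C" using smooth_const by (simp add: smooth_funs_smooth)
    from sections_fscale[OF this that] show ?thesis by (simp add: fscale_def scaleR_fun_def)
  qed
qed

lemma extend_section:
  assumes W: "open W" and u: "smooth_section_on A E T W u"
    and \<eta>: "smooth UNIV \<eta>" "closed K" "K \<subseteq> W" "\<And>x. x \<notin> K \<Longrightarrow> \<eta> x = 0"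
  shows "(\<lambda>x. if x \<in> W then \<eta> x *\<^sub>R u x else 0) \<in> \<Gamma>" (is "?u \<in> _")
proof -
  have uE: "u x \<in> E x" if "x \<in> W" for x using u that unfolding local_section_iff by blast
  have "smooth V (\<lambda>x. \<Psi> x (?u x))" if V: "(V, \<Psi>) \<in> T" for V \<Psi>
  proof -
    have "smooth (V \<inter> W) (\<lambda>x. \<Psi> x (u x))" using u V unfolding local_section_iff by auto
    from smooth_extend[OF trivD(1)[OF V] W \<eta>(2-4,1) this]
    show ?thesis
    proof (rule smooth_cong[OF trivD(1)[OF V]])
      fix x assume "x \<in> V"
      then show "(if x \<in> W then \<eta> x *\<^sub>R \<Psi> x (u x) else 0) = \<Psi> x (?u x)"
        using triv_lin(2)[OF V _ uE, of x] triv_lin(3)[OF V, of x] by (cases "x \<in> W") simp_all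
    qed
  qed
  moreover have "?u x \<in> E x" for x using uE subspace_0[OF fibre] subspace_scale[OF fibre] by simp
  ultimately show ?thesis unfolding sections_iff by auto
qed

text \<open>This section is constant in its own trivialization; its smoothness in the others is the
  condition on transition functions.\<close>

lemma local_frame:
  assumes "(U, \<Phi>) \<in> T"
  shows "smooth_section_on A E T U (\<lambda>x. inv_into (E x) (\<Phi> x) w)"
  unfolding local_section_iff
proof (intro conjI ballI)
  show "inv_into (E x) (\<Phi> x) w \<in> E x" if "x \<in> U" for x
    using trivD(2)[OF assms that] by (metis UNIV_I bij_betw_imp_surj_on inv_into_into)
  show "case t of (V, \<Psi>) \<Rightarrow> smooth (V \<inter> U) (\<lambda>x. \<Psi> x (inv_into (E x) (\<Phi> x) w))" if "t \<in> T" for t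
    using that triv_transition[OF assms, of "fst t" "snd t" w] by (simp add: case_prod_beta Int_commute)
qed

lemma section_through:
  assumes "v \<in> E x" obtains u where "u \<in> \<Gamma>" "u x = v"
proof -
  obtain U \<Phi> where U: "(U, \<Phi>) \<in> T" "x \<in> U" by (rule triv_ex)
  obtain \<eta> :: "'m \<Rightarrow> real" and N K where \<eta>: "smooth UNIV \<eta>" "open N" "x \<in> N" "N \<subseteq> U" "\<And>x. x \<in> N \<Longrightarrow> \<eta> x = 1"
    "closed K" "K \<subseteq> U" "\<And>x. x \<notin> K \<Longrightarrow> \<eta> x = 0"
    using bump[OF trivD(1)[OF U(1)] U(2)] by metis
  have "inv_into (E x) (\<Phi> x) (\<Phi> x v) = v"
    using trivD(2)[OF U] assms by (simp add: bij_betw_def)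
  then show ?thesis
    using that[OF extend_section[OF trivD(1)[OF U(1)] local_frame[OF U(1), of "\<Phi> x v"] \<eta>(1,6-8)]] U(2) \<eta>(3,5)
    by simp
qed

text \<open>With a bump function \<open>\<eta>\<close> supported where \<open>E\<close> is trivial and equal to 1 at \<open>x\<close>, the section
  \<open>\<eta>\<^sup>2 u\<close> is a combination of global sections whose coefficients vanish at \<open>x\<close>.\<close>

lemma tensorial:
  fixes t :: "('m \<Rightarrow> 'v) \<Rightarrow> 'z::real_vector"
  assumes add: "\<And>u w. u \<in> \<Gamma> \<Longrightarrow> w \<in> \<Gamma> \<Longrightarrow> t (u + w) = t u + t w"
    and sc: "\<And>f u. f \<in> C \<Longrightarrow> u \<in> \<Gamma> \<Longrightarrow> t (f \<odot> u) = f x *\<^sub>R t u"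
    and u: "u \<in> \<Gamma>" "u x = 0"
  shows "t u = 0"
proof -
  have z: "t 0 = 0" using add[of 0 0] subspace_0[OF subspace_sections] by simp
  have tsum: "t (\<Sum>b\<in>B. s b) = (\<Sum>b\<in>B. t (s b))" if "finite B" "\<And>b. s b \<in> \<Gamma>" for B and s :: "'f \<Rightarrow> 'm \<Rightarrow> 'v"
    using that(1)
  proof (induction B)
    case empty
    show ?case unfolding sum.empty by (rule z)
  next
    case (insert b B)
    have "(\<Sum>b\<in>B. s b) \<in> \<Gamma>" by (rule subspace_sum[OF subspace_sections that(2)])
    then show ?case unfolding sum.insert[OF insert(1,2)] insert(3)[symmetric] by (rule add[OF that(2)])
  qed
  obtain U \<Phi> where U: "(U, \<Phi>) \<in> T" "x \<in> U" by (rule triv_ex)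
  note oU = trivD(1)[OF U(1)]
  obtain \<eta> :: "'m \<Rightarrow> real" and N K where \<eta>: "smooth UNIV \<eta>" "open N" "x \<in> N" "N \<subseteq> U" "\<And>x. x \<in> N \<Longrightarrow> \<eta> x = 1"
    "closed K" "K \<subseteq> U" "\<And>x. x \<notin> K \<Longrightarrow> \<eta> x = 0"
    using bump[OF oU U(2)] by metis
  have "finite_dim TYPE('f)" using vb unfolding vector_bundle_def by simp
  then obtain B :: "'f set" where B: "finite B" "0 \<notin> B" "\<And>w. w = (\<Sum>b\<in>B. ((w \<bullet> b) / (b \<bullet> b)) *\<^sub>R b)"
    by (rule finite_dim_orthogonal_basis) auto
  \<comment> \<open>One factor \<open>\<eta>\<close> makes the coefficient global and another one
    the frame section, hence the square. The basis is orthogonal but not normalized, hence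
    \<open>inverse (b \<bullet> b)\<close>.\<close>
  define g where "g b y = (if y \<in> U then \<eta> y *\<^sub>R (\<Phi> y (u y) \<bullet> (inverse (b \<bullet> b) *\<^sub>R b)) else 0)" for b y
  define s where "s b y = (if y \<in> U then \<eta> y *\<^sub>R inv_into (E y) (\<Phi> y) b else 0)" for b y
  have gs: "smooth (UNIV \<inter> U) (\<lambda>x. \<Phi> x (u x) \<bullet> c)" for c
    unfolding Int_UNIV_left
    by (rule smooth_bounded_linear[OF oU bounded_linear_inner_left section_smooth[OF u(1) U(1)]])
  have g: "g b \<in> C" for b
    unfolding smooth_funs_smooth g_def [abs_def]
    by (rule smooth_extend[OF open_UNIV oU \<eta>(6-8,1) gs])
  have s: "s b \<in> \<Gamma>" for b
    unfolding s_def [abs_def] by (rule extend_section[OF oU local_frame[OF U(1)] \<eta>(1,6-8)])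
  have \<eta>C: "\<eta> \<in> C" using \<eta>(1) by (simp add: smooth_funs_smooth)
  have inv: "\<Phi> y (inv_into (E y) (\<Phi> y) w) = w" "inv_into (E y) (\<Phi> y) w \<in> E y" if "y \<in> U" for y w
    using trivD(2)[OF U(1) that] by (metis UNIV_I bij_betw_imp_surj_on f_inv_into_f inv_into_into)+
  have lin_sum: "\<Phi> y (\<Sum>b\<in>B'. c b *\<^sub>R e b) = (\<Sum>b\<in>B'. c b *\<^sub>R \<Phi> y (e b)) \<and> (\<Sum>b\<in>B'. c b *\<^sub>R e b) \<in> E y"
    if "y \<in> U" "finite B'" "\<And>b. e b \<in> E y" for y c B' and e :: "'f \<Rightarrow> 'v"
    using that(2)
  proof (induction B')
    case empty
    then show ?case using triv_lin(3)[OF U(1) that(1)] subspace_0[OF fibre] by simp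
  next
    case (insert b B')
    then show ?case using that(3) subspace_scale[OF fibre] subspace_add[OF fibre]
      by (simp add: triv_lin[OF U(1) that(1)])
  qed
  have uy: "u y = (\<Sum>b\<in>B. (\<Phi> y (u y) \<bullet> (inverse (b \<bullet> b) *\<^sub>R b)) *\<^sub>R inv_into (E y) (\<Phi> y) b)" (is "_ = ?r") if "y \<in> U" for y
  proof -
    have r: "\<Phi> y ?r = (\<Sum>b\<in>B. (\<Phi> y (u y) \<bullet> (inverse (b \<bullet> b) *\<^sub>R b)) *\<^sub>R b)" "?r \<in> E y"
      using lin_sum[OF that B(1) inv(2)[OF that]] inv(1)[OF that] by simp_all
    have "(\<Sum>b\<in>B. (\<Phi> y (u y) \<bullet> (inverse (b \<bullet> b) *\<^sub>R b)) *\<^sub>R b) = \<Phi> y (u y)"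
      using B(3)[of "\<Phi> y (u y)", symmetric] by (simp add: divide_inverse mult.commute)
    then have "\<Phi> y ?r = \<Phi> y (u y)" using r(1) by simp
    then show ?thesis
      using inj_onD[OF bij_betw_imp_inj_on[OF trivD(2)[OF U(1) that]] _ r(2) section_in[OF u(1)]] by simp
  qed
  have "\<eta> \<odot> (\<eta> \<odot> u) = (\<Sum>b\<in>B. g b \<odot> s b)"
  proof
    fix y
    have sum_app: "(\<Sum>b\<in>B. g b \<odot> s b) y = (\<Sum>b\<in>B. g b y *\<^sub>R s b y)"
      by (induction B rule: infinite_finite_induct) (auto simp: fscale_def)
    show "(\<eta> \<odot> (\<eta> \<odot> u)) y = (\<Sum>b\<in>B. g b \<odot> s b) y"
    proof (cases "y \<in> U")
      case True
      have "(\<eta> \<odot> (\<eta> \<odot> u)) y = \<eta> y *\<^sub>R \<eta> y *\<^sub>R u y" by (simp add: fscale_def)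
      also have "\<dots> = \<eta> y *\<^sub>R \<eta> y *\<^sub>R (\<Sum>b\<in>B. (\<Phi> y (u y) \<bullet> (inverse (b \<bullet> b) *\<^sub>R b)) *\<^sub>R inv_into (E y) (\<Phi> y) b)"
        using uy[OF True] by (rule arg_cong)
      also have "\<dots> = (\<Sum>b\<in>B. g b y *\<^sub>R s b y)"
        unfolding scaleR_sum_right by (rule sum.cong) (simp_all add: g_def s_def True)
      finally show ?thesis unfolding sum_app .
    next
      case False
      then have "\<eta> y = 0" using \<eta>(7,8) by blast
      then show ?thesis unfolding sum_app using False by (simp add: fscale_def g_def)
    qed
  qed
  then have "t (\<eta> \<odot> (\<eta> \<odot> u)) = (\<Sum>b\<in>B. t (g b \<odot> s b))"
    using tsum[OF B(1), of "\<lambda>b. g b \<odot> s b"] sections_fscale[OF g s] by simp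
  also have "\<dots> = (\<Sum>b\<in>B. g b x *\<^sub>R t (s b))" using sc[OF g s] by simp
  also have "\<dots> = 0"
  proof -
    have "\<Phi> x (u x) = 0" using u(2) triv_lin(3)[OF U] by simp
    then have "g b x = 0" for b unfolding g_def by simp
    then show ?thesis by simp
  qed
  \<comment> \<open>Multiplying twice by \<open>\<eta>\<close> does not change the value of
    \<open>t\<close>, since \<open>\<eta> x = 1\<close>.\<close>
  finally show ?thesis
    using sc[OF \<eta>C sections_fscale[OF \<eta>C u(1)]] sc[OF \<eta>C u(1)] \<eta>(3,5) by simp
qed

end

section \<open>Multiderivations\<close>

lemma multilinear_on_append:
  assumes "multilinear_on S n F" "length xs + length ys + 1 = n" "set xs \<subseteq> S" "set ys \<subseteq> S" "v \<in> S" "w \<in> S"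
  shows "F (xs @ (a *\<^sub>R v + b *\<^sub>R w) # ys) = a *\<^sub>R F (xs @ v # ys) + b *\<^sub>R F (xs @ w # ys)"
proof -
  have "xs @ v # ys \<in> args S n" using assms by (simp add: args_def)
  then show ?thesis
    using assms(1)[unfolded multilinear_on_def, rule_format, of "xs @ v # ys" "length xs" v w a b] assms(2,5,6)
    by simp
qed

text \<open>The two arguments are moved past \<open>ys\<close> in turn, which gives the same sign
  twice. Only the exchange of neighbours in between contributes.\<close>

lemma skewf_swap:
  assumes "skewf S \<beta>" "set xs \<subseteq> S" "set ys \<subseteq> S" "set zs \<subseteq> S" "v \<in> S" "w \<in> S"
  shows "\<beta> (xs @ v # ys @ w # zs) = - \<beta> (xs @ w # ys @ v # zs)"
proof -
  have sk: "skewf S (\<lambda>l. \<beta> (xs @ u # l))" if "u \<in> S" for u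
    unfolding skewf_def
  proof (intro allI impI ballI)
    fix ps qs a b assume "set ps \<subseteq> S" "set qs \<subseteq> S" "a \<in> S" "b \<in> S"
    then show "\<beta> (xs @ u # ps @ a # b # qs) = - \<beta> (xs @ u # ps @ b # a # qs)"
      using assms(1)[unfolded skewf_def, rule_format, of "xs @ u # ps" qs a b] assms(2) that by simp
  qed
  have "\<beta> (xs @ v # ys @ w # zs) = (-1) ^ length ys *\<^sub>R \<beta> (xs @ v # w # ys @ zs)"
    using skewf_move[OF sk[OF assms(5)] assms(3,4,6)] by simp
  also have "\<beta> (xs @ v # w # ys @ zs) = - \<beta> (xs @ w # v # ys @ zs)"
    using assms(1)[unfolded skewf_def, rule_format, of xs "ys @ zs" v w] assms by simp
  also have "(-1) ^ length ys *\<^sub>R - \<beta> (xs @ w # v # ys @ zs) = - \<beta> (xs @ w # ys @ v # zs)"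
    using skewf_move[OF sk[OF assms(6)] assms(3,4,5)] by simp
  finally show ?thesis .
qed

lemma skew_onI:
  assumes "\<And>xs ys zs v w. set xs \<subseteq> S \<Longrightarrow> set ys \<subseteq> S \<Longrightarrow> set zs \<subseteq> S \<Longrightarrow> v \<in> S \<Longrightarrow> w \<in> S \<Longrightarrow>
      length (xs @ v # ys @ w # zs) = n \<Longrightarrow> length (xs @ v # ys @ [w]) \<le> k \<Longrightarrow>
      F (xs @ v # ys @ w # zs) = - F (xs @ w # ys @ v # zs)" "k \<le> n"
  shows "skew_on S n k F"
proof -
  have main: "F (us[i := us ! j, j := us ! i]) = - F us" if us: "us \<in> args S n" and ij: "i < j" "j < k" for us i j
  proof -
    have jn: "j < length us" and iln: "i < length us" and l: "length us = n" "set us \<subseteq> S"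
      using us ij assms(2) by (auto simp: args_def)
    obtain xs v us' where 1: "us = xs @ v # us'" "length xs = i"
      using id_take_nth_drop[OF iln] iln by (metis length_take min.absorb4)
    have "j - Suc i < length us'" using 1 jn ij by simp
    then obtain ys w zs where 2: "us' = ys @ w # zs" "length ys = j - Suc i"
      using id_take_nth_drop by (metis length_take min.absorb4)
    have e: "us = xs @ v # ys @ w # zs" using 1 2 by simp
    have len: "j = i + Suc (length ys)" using 2 ij by simp
    have nth: "us ! i = v" "us ! j = w" unfolding e len by (simp_all add: nth_append 1(2)[symmetric])
    have "us[i := w, j := v] = xs @ w # ys @ v # zs"
      unfolding e len by (simp add: list_update_append 1(2)[symmetric])
    moreover have "F (xs @ v # ys @ w # zs) = - F (xs @ w # ys @ v # zs)"
      by (rule assms(1)) (use l ij len 1(2) e in auto)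
    ultimately show ?thesis unfolding nth using e by simp
  qed
  show ?thesis
    unfolding skew_on_def
  proof (intro ballI allI impI)
    fix us i j assume *: "us \<in> args S n" "i < k" "j < k" "i \<noteq> j"
    show "F (us[i := us ! j, j := us ! i]) = - F us"
    proof (cases "i < j")
      case True
      then show ?thesis using main * by blast
    next
      case False
      then have "F (us[j := us ! i, i := us ! j]) = - F us" using main * by simp
      then show ?thesis using *(4) by (simp add: list_update_swap)
    qed
  qed
qed

lemma skew_on_append:
  assumes "skew_on S n k F" "length (xs @ v # w # ys) = n" "length xs + 1 < k" "set xs \<subseteq> S" "set ys \<subseteq> S" "v \<in> S" "w \<in> S"
  shows "F (xs @ v # w # ys) = - F (xs @ w # v # ys)"
proof -
  have us: "xs @ w # v # ys \<in> args S n" using assms by (simp add: args_def)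
  have "F ((xs @ w # v # ys)[length xs := (xs @ w # v # ys) ! Suc (length xs),
        Suc (length xs) := (xs @ w # v # ys) ! length xs]) = - F (xs @ w # v # ys)"
    by (rule assms(1)[unfolded skew_on_def, rule_format, OF us]) (use assms(3) in simp_all)
  moreover have "(xs @ w # v # ys)[length xs := (xs @ w # v # ys) ! Suc (length xs),
        Suc (length xs) := (xs @ w # v # ys) ! length xs] = xs @ v # w # ys"
    by (simp add: list_update_append nth_append)
  ultimately show ?thesis by simp
qed

lemma multilinear_onI:
  assumes "\<And>xs ys v w a b. set xs \<subseteq> S \<Longrightarrow> set ys \<subseteq> S \<Longrightarrow> v \<in> S \<Longrightarrow> w \<in> S \<Longrightarrow> length xs + length ys + 1 = n \<Longrightarrow>
     F (xs @ (a *\<^sub>R v + b *\<^sub>R w) # ys) = a *\<^sub>R F (xs @ v # ys) + b *\<^sub>R F (xs @ w # ys)"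
  shows "multilinear_on S n F"
  unfolding multilinear_on_def
proof (intro ballI allI impI)
  fix us i v w a b assume *: "us \<in> args S n" "i < n" "v \<in> S" "w \<in> S"
  then have l: "i < length us" "length us = n" "set us \<subseteq> S" by (auto simp: args_def)
  have u: "us[i := x] = take i us @ x # drop (Suc i) us" for x
    by (rule upd_conv_take_nth_drop[OF l(1)])
  have s: "set (take i us) \<subseteq> S" "set (drop (Suc i) us) \<subseteq> S"
    using l(3) by (meson order_trans set_take_subset set_drop_subset)+
  show "F (us[i := a *\<^sub>R v + b *\<^sub>R w]) = a *\<^sub>R F (us[i := v]) + b *\<^sub>R F (us[i := w])"
    unfolding u by (rule assms[OF s *(3,4)]) (use l in simp)
qed

section \<open>Multiderivations as operators with a symbol on global sections\<close>

context vbundle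
begin

text \<open>The conditions on operators range over lists of every length. On those of the wrong
  length they hold because \<open>D\<close> is 0 there, and elsewhere they are the defining
  properties of a multiderivation.\<close>

lemma Der_section_der:
  assumes D: "D \<in> Der A E T n"
  obtains s where "section_der \<Gamma> C n (curry_last D) s"
proof -
  from D have vals: "\<And>us. us \<in> args \<Gamma> (n + 1) \<Longrightarrow> D us \<in> \<Gamma>"
    and zero: "\<And>us. us \<notin> args \<Gamma> (n + 1) \<Longrightarrow> D us = 0"
    and ml: "multilinear_on \<Gamma> (n + 1) D" and sk: "skew_on \<Gamma> (n + 1) n D"
    and fl: "\<And>us i f. us \<in> args \<Gamma> (n + 1) \<Longrightarrow> i < n \<Longrightarrow> f \<in> C \<Longrightarrow> D (us[i := f \<odot> us ! i]) = f \<odot> D us"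
    and ex: "\<exists>\<sigma>. is_symbol A E T n D \<sigma>"
    unfolding Der_def by simp_all
  obtain \<sigma> where sy: "is_symbol A E T n D \<sigma>" using ex by blast
  have S0: "0 \<in> \<Gamma>" by (rule subspace_0[OF subspace_sections])
  have DS: "D us \<in> \<Gamma>" for us using vals[of us] zero[of us] S0 by (cases "us \<in> args \<Gamma> (n + 1)") auto
  have zl: "D us = 0" if "length us \<noteq> n + 1" for us using zero[of us] that by (simp add: args_def)
  have supported: "supported \<Gamma> (\<lambda>i. i = n) (\<lambda>xs. curry_last D xs y)" for y
    unfolding supported_def curry_last_def
  proof (intro allI impI)
    fix us assume "D (us @ [y]) \<noteq> 0"
    then show "length us = n" using zl[of "us @ [y]"] by (cases "length us = n") simp_all
  qed
  have lin: "D (xs @ (a *\<^sub>R v + b *\<^sub>R w) # ys) = a *\<^sub>R D (xs @ v # ys) + b *\<^sub>R D (xs @ w # ys)"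
    if "set xs \<subseteq> \<Gamma>" "set ys \<subseteq> \<Gamma>" "v \<in> \<Gamma>" "w \<in> \<Gamma>" for xs ys v w a b
  proof (cases "length xs + length ys + 1 = n + 1")
    case True
    then show ?thesis using multilinear_on_append[OF ml _ that] by simp
  next
    case False
    then show ?thesis by (simp add: zl)
  qed
  have mf: "mlinear \<Gamma> \<Gamma> (\<lambda>xs. curry_last D xs y)" if "y \<in> \<Gamma>" for y
    unfolding mlinear_def curry_last_def using lin[of _ "_ @ [y]"] that DS by simp
  have skf: "skewf \<Gamma> (\<lambda>xs. curry_last D xs y)" if "y \<in> \<Gamma>" for y
    unfolding skewf_def curry_last_def
  proof (intro allI impI ballI)
    fix xs ys v w assume *: "set xs \<subseteq> \<Gamma>" "set ys \<subseteq> \<Gamma>" "v \<in> \<Gamma>" "w \<in> \<Gamma>"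
    show "D ((xs @ v # w # ys) @ [y]) = - D ((xs @ w # v # ys) @ [y])"
    proof (cases "length xs + length ys + 2 = n")
      case True
      then show ?thesis using skew_on_append[OF sk, of xs v w "ys @ [y]"] * that by simp
    next
      case False
      then show ?thesis by (simp add: zl)
    qed
  qed
  have linear_op: "linear_op \<Gamma> \<Gamma> (curry_last D)"
    unfolding linear_op_def curry_last_def using lin[of _ "[]"] DS by simp
  have alt_op: "alt_op \<Gamma> n (curry_last D)"
    unfolding alt_op_def alternating_def using linear_op mf skf supported by simp
  have fun_linear: "fun_linear \<Gamma> f (\<lambda>xs. curry_last D xs y)" if "f \<in> C" "y \<in> \<Gamma>" for f y
    unfolding fun_linear_def curry_last_def
  proof (intro allI impI)
    fix xs ys v assume *: "set xs \<subseteq> \<Gamma>" "set ys \<subseteq> \<Gamma>" "v \<in> \<Gamma>"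
    show "D ((xs @ (f \<odot> v) # ys) @ [y]) = f \<odot> D ((xs @ v # ys) @ [y])"
    proof (cases "length xs + length ys + 1 = n")
      case True
      then have "(xs @ v # ys) @ [y] \<in> args \<Gamma> (n + 1)" using * that by (simp add: args_def)
      from fl[OF this _ that(1), of "length xs"] True show ?thesis by (simp add: nth_append list_update_append)
    next
      case False
      then show ?thesis by (simp add: zl fscale_def fun_eq_iff)
    qed
  qed
  \<comment> \<open>The default 0 makes the Leibniz rule hold on lists of the wrong length
    too.\<close>
  define s where "s us f = (if length us = n then (\<lambda>x. \<sigma> x (map (\<lambda>u. u x) us) f) else 0)" for us f
  have sC: "s us f \<in> C" if "set us \<subseteq> \<Gamma>" "f \<in> C" for us f
  proof (cases "length us = n")
    case True
    have "us \<in> args {u. smooth_section_on A E T UNIV u} n"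
      using that True by (auto simp: args_def sections_def)
    then have "smooth_vector_field_on A UNIV (\<lambda>x. \<sigma> x (map (\<lambda>u. u x) us))"
      using sy unfolding is_symbol_def wedge_hom_sections_def by simp
    then show ?thesis
      using that True unfolding smooth_vector_field_on_def s_def by (simp add: smooth_funs_def)
  next
    case False
    then show ?thesis using subspace_0[OF subspace_smooth_funs] by (simp add: s_def)
  qed
  have sD: "curry_last D us (f \<odot> y) = f \<odot> curry_last D us y + s us f \<odot> y" if "set us \<subseteq> \<Gamma>" "f \<in> C" "y \<in> \<Gamma>" for us f y
  proof (cases "length us = n")
    case True
    have "us \<in> args \<Gamma> n" using that True by (simp add: args_def)
    then show ?thesis using sy that True unfolding is_symbol_def curry_last_def s_def by simp
  next
    case False
    then show ?thesis by (simp add: curry_last_def zl s_def fscale_def fun_eq_iff)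
  qed
  have "section_der \<Gamma> C n (curry_last D) s"
    unfolding section_der_def by (intro conjI ballI allI impI alt_op fun_linear sC sD)
  then show ?thesis by (rule that)
qed

text \<open>In rank 0 the defining equation does not determine the symbol, which may then be chosen to be 0.
  In positive rank all properties of the symbol at \<open>x\<close> are read off from \<open>D\<close> by means of a section that
  does not vanish at \<open>x\<close>.\<close>

lemma symbol_exists_rank0:
  assumes "\<And>w::'f. w = 0" "\<And>us. D us \<in> \<Gamma>"
  shows "\<exists>\<sigma>. is_symbol A E T n D \<sigma>"
proof -
  have "v = 0" if v: "v \<in> E x" for v x
  proof -
    obtain U \<Phi> where U: "(U, \<Phi>) \<in> T" "x \<in> U" by (rule triv_ex)
    have "\<Phi> x v = \<Phi> x 0" using assms(1)[of "\<Phi> x v"] assms(1)[of "\<Phi> x 0"] by simp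
    then show ?thesis
      using inj_onD[OF bij_betw_imp_inj_on[OF trivD(2)[OF U]] _ v subspace_0[OF fibre]] by simp
  qed
  then have 0: "u = 0" if "u \<in> \<Gamma>" for u
    using section_in[OF that] by (auto simp: fun_eq_iff)
  have D0: "D us = 0" for us by (rule 0[OF assms(2)])
  have "is_symbol A E T n D (\<lambda>_ _ _. 0)"
    unfolding is_symbol_def
  proof (intro conjI ballI)
    show "(\<lambda>_ _ _. 0) \<in> wedge_hom_sections A E T n"
      unfolding wedge_hom_sections_def
      by (simp add: tangent_space_def multilinear_on_def skew_on_def smooth_vector_field_on_def
          smooth_map_on_smooth smooth_const fun_eq_iff scaleR_fun_def)
    fix us u f assume "u \<in> \<Gamma>"
    then show "D (us @ [f \<odot> u]) = f \<odot> D (us @ [u]) + (\<lambda>x. 0) \<odot> u"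
      unfolding D0 by (simp add: fscale_def fun_eq_iff)
  qed
  then show ?thesis by blast
qed

lemma symbol_exists:
  assumes sd: "section_der \<Gamma> C n (curry_last D) s" and w: "(w::'f) \<noteq> 0"
  shows "\<exists>\<sigma>. is_symbol A E T n D \<sigma>"
proof -
  note alt_op = section_derD(1)[OF sd]
  have nz: "\<exists>y\<in>\<Gamma>. y x \<noteq> 0" for x
  proof -
    obtain U \<Phi> where U: "(U, \<Phi>) \<in> T" "x \<in> U" by (rule triv_ex)
    have "w \<in> \<Phi> x ` E x" using trivD(2)[OF U] by (simp add: bij_betw_def)
    then obtain v where v: "v \<in> E x" "w = \<Phi> x v" by blast
    obtain y where "y \<in> \<Gamma>" "y x = v" by (rule section_through[OF v(1)])
    then show ?thesis using v(2) w triv_lin(3)[OF U] by metis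
  qed
  \<comment> \<open>This expresses the symbol at \<open>x\<close> through \<open>D\<close>, from
    which it inherits multilinearity, skew symmetry and tensoriality.\<close>
  have seq: "s us f x *\<^sub>R y x = curry_last D us (f \<odot> y) x - f x *\<^sub>R curry_last D us y x"
    if "set us \<subseteq> \<Gamma>" "f \<in> C" "y \<in> \<Gamma>" for us f x y
    unfolding section_derD(4)[OF sd that] by (simp add: fscale_def)
  have cancel: "a = b" if "\<And>y. y \<in> \<Gamma> \<Longrightarrow> a *\<^sub>R y x = b *\<^sub>R y x" for a b x
    using nz[of x] that scaleR_cancel_right by blast
  have mf: "mlinear \<Gamma> \<Gamma> (\<lambda>xs. curry_last D xs y)" "skewf \<Gamma> (\<lambda>xs. curry_last D xs y)" if "y \<in> \<Gamma>" for y
    using alternatingD[OF alt_opD(2)[OF alt_op that]] by simp_all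
  have smult: "s (xs @ (a *\<^sub>R u + b *\<^sub>R v) # ys) f x = a * s (xs @ u # ys) f x + b * s (xs @ v # ys) f x"
    if *: "set xs \<subseteq> \<Gamma>" "set ys \<subseteq> \<Gamma>" "u \<in> \<Gamma>" "v \<in> \<Gamma>" "f \<in> C" for xs ys u v a b f x
  proof (rule cancel)
    fix y assume y: "y \<in> \<Gamma>"
    have t: "a *\<^sub>R u + b *\<^sub>R v \<in> \<Gamma>"
      using * by (intro subspace_add subspace_scale subspace_sections)
    have fy: "f \<odot> y \<in> \<Gamma>" by (rule sections_fscale[OF *(5) y])
    have e: "s (xs @ z # ys) f x *\<^sub>R y x = curry_last D (xs @ z # ys) (f \<odot> y) x - f x *\<^sub>R curry_last D (xs @ z # ys) y x"
      if "z \<in> \<Gamma>" for z by (rule seq[OF _ *(5) y]) (use * that in simp)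
    show "s (xs @ (a *\<^sub>R u + b *\<^sub>R v) # ys) f x *\<^sub>R y x = (a * s (xs @ u # ys) f x + b * s (xs @ v # ys) f x) *\<^sub>R y x"
      unfolding scaleR_add_left scaleR_scaleR[symmetric] e[OF t] e[OF *(3)] e[OF *(4)]
        mlinear_lin[OF mf(1)[OF fy] *(1-4)] mlinear_lin[OF mf(1)[OF y] *(1-4)]
      by (simp add: scaleR_fun_def algebra_simps)
  qed
  have sskew: "s (xs @ u # ys @ v # zs) f x = - s (xs @ v # ys @ u # zs) f x"
    if *: "set xs \<subseteq> \<Gamma>" "set ys \<subseteq> \<Gamma>" "set zs \<subseteq> \<Gamma>" "u \<in> \<Gamma>" "v \<in> \<Gamma>" "f \<in> C" for xs ys zs u v f x
  proof (rule cancel)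
    fix y assume y: "y \<in> \<Gamma>"
    have fy: "f \<odot> y \<in> \<Gamma>" by (rule sections_fscale[OF *(6) y])
    have e: "s (xs @ a # ys @ b # zs) f x *\<^sub>R y x =
        curry_last D (xs @ a # ys @ b # zs) (f \<odot> y) x - f x *\<^sub>R curry_last D (xs @ a # ys @ b # zs) y x"
      if "a \<in> \<Gamma>" "b \<in> \<Gamma>" for a b by (rule seq[OF _ *(6) y]) (use * that in simp)
    have h: "curry_last D (xs @ u # ys @ v # zs) z = - curry_last D (xs @ v # ys @ u # zs) z" if "z \<in> \<Gamma>" for z
      by (rule skewf_swap[OF mf(2)[OF that] *(1-5)])
    show "s (xs @ u # ys @ v # zs) f x *\<^sub>R y x = (- s (xs @ v # ys @ u # zs) f x) *\<^sub>R y x"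
      unfolding scaleR_minus_left e[OF *(4,5)] e[OF *(5,4)] h[OF fy] h[OF y] by simp
  qed
  \<comment> \<open>For fixed \<open>f\<close>, \<open>y\<close> and \<open>x\<close> the expression
    for the symbol in \<open>seq\<close> is linear over functions in \<open>u\<close>, so by
    \<open>tensorial\<close> it depends on \<open>u x\<close> only.\<close>
  have K1: "s (xs @ u # ys) f x = s (xs @ v # ys) f x"
    if *: "set xs \<subseteq> \<Gamma>" "set ys \<subseteq> \<Gamma>" "u \<in> \<Gamma>" "v \<in> \<Gamma>" "f \<in> C" "u x = v x" for xs ys u v f x
  proof (rule cancel)
    fix y assume y: "y \<in> \<Gamma>"
    have fy: "f \<odot> y \<in> \<Gamma>" by (rule sections_fscale[OF *(5) y])
    let ?t = "\<lambda>u. curry_last D (xs @ u # ys) (f \<odot> y) x - f x *\<^sub>R curry_last D (xs @ u # ys) y x"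
    have lin: "?t (a *\<^sub>R p + b *\<^sub>R q) = a *\<^sub>R ?t p + b *\<^sub>R ?t q" if "p \<in> \<Gamma>" "q \<in> \<Gamma>" for a b p q
      unfolding mlinear_lin[OF mf(1)[OF fy] *(1,2) that] mlinear_lin[OF mf(1)[OF y] *(1,2) that]
      by (simp add: scaleR_fun_def algebra_simps)
    have "?t (u - v) = 0"
    proof (rule tensorial[where t="?t" and x=x])
      show "?t (p + q) = ?t p + ?t q" if "p \<in> \<Gamma>" "q \<in> \<Gamma>" for p q
        using lin[OF that, of 1 1] unfolding scaleR_one .
      show "?t (g \<odot> p) = g x *\<^sub>R ?t p" if "g \<in> C" "p \<in> \<Gamma>" for g p
        using section_derD(2)[OF sd that(1) fy, unfolded fun_linear_def, rule_format, OF *(1,2) that(2)]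
          section_derD(2)[OF sd that(1) y, unfolded fun_linear_def, rule_format, OF *(1,2) that(2)]
        by (simp add: fscale_def algebra_simps)
      show "u - v \<in> \<Gamma>" by (rule subspace_diff[OF subspace_sections *(3,4)])
      show "(u - v) x = 0" using *(6) by simp
    qed
    moreover have "?t (u - v) = ?t u - ?t v"
      using lin[OF *(3,4), of 1 "-1"] by (simp only: scaleR_one scaleR_minus1_left diff_conv_add_uminus)
    ultimately have "?t u = ?t v" by simp
    then show "s (xs @ u # ys) f x *\<^sub>R y x = s (xs @ v # ys) f x *\<^sub>R y x"
      using seq[of "xs @ u # ys" f y x] seq[of "xs @ v # ys" f y x] * y by simp
  qed
  \<comment> \<open>The arguments are replaced one at a time; \<open>ps\<close> collects those
    already replaced.\<close>
  have K: "s (ps @ us) f x = s (ps @ us') f x"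
    if "length us = length us'" and f: "f \<in> C" and "set us \<subseteq> \<Gamma>" "set us' \<subseteq> \<Gamma>"
      "map (\<lambda>u. u x) us = map (\<lambda>u. u x) us'" "set ps \<subseteq> \<Gamma>" for us us' f x ps
    using that(1,3-)
  proof (induction us us' arbitrary: ps rule: list_induct2)
    case Nil
    show ?case ..
  next
    case (Cons u us v vs)
    have p: "u \<in> \<Gamma>" "v \<in> \<Gamma>" "set us \<subseteq> \<Gamma>" "set vs \<subseteq> \<Gamma>" "u x = v x"
      "map (\<lambda>u. u x) us = map (\<lambda>u. u x) vs" "set (ps @ [v]) \<subseteq> \<Gamma>"
      using Cons.prems unfolding list.map list.inject by simp_all
    have "s (ps @ u # us) f x = s (ps @ v # us) f x"
      by (rule K1[OF Cons.prems(4) p(3,1,2) f p(5)])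
    also have "\<dots> = s (ps @ v # vs) f x"
      using Cons.IH[OF p(3,4,6,7)] unfolding append_assoc append_Cons append_Nil .
    finally show ?case .
  qed
  \<comment> \<open>An arbitrary global section through \<open>v\<close>; by \<open>K\<close> the
    choice does not affect the symbol.\<close>
  define ext where "ext x v = (SOME u. u \<in> \<Gamma> \<and> u x = v)" for x and v :: 'v
  have ext: "ext x v \<in> \<Gamma> \<and> ext x v x = v" if v: "v \<in> E x" for x v
  proof -
    obtain u where "u \<in> \<Gamma>" "u x = v" by (rule section_through[OF v])
    then have "\<exists>u. u \<in> \<Gamma> \<and> u x = v" by blast
    from someI_ex[OF this] show ?thesis unfolding ext_def .
  qed
  \<comment> \<open>The value 0 outside \<open>C\<close> is what \<open>tangent_space\<close>
    prescribes.\<close>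
  define \<sigma> where "\<sigma> x vs f = (if f \<in> C then s (map (ext x) vs) f x else 0)" for x vs f
  have exts: "set (map (ext x) vs) \<subseteq> \<Gamma>" "map (\<lambda>u. u x) (map (ext x) vs) = vs" if "set vs \<subseteq> E x" for x vs
  proof -
    have *: "ext x v \<in> \<Gamma>" "ext x v x = v" if "v \<in> set vs" for v
      using ext[of v x] that \<open>set vs \<subseteq> E x\<close> by blast+
    show "set (map (ext x) vs) \<subseteq> \<Gamma>" unfolding set_map using *(1) by blast
    show "map (\<lambda>u. u x) (map (ext x) vs) = vs"
      unfolding map_map by (rule map_idI) (simp add: *(2))
  qed
  have \<sigma>_eq: "\<sigma> x vs f = s us f x" if "set us \<subseteq> \<Gamma>" "map (\<lambda>u. u x) us = vs" "f \<in> C" for x vs f us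
  proof -
    have vs: "set vs \<subseteq> E x"
      unfolding that(2)[symmetric] set_map using that(1) section_in by blast
    have "s ([] @ map (ext x) vs) f x = s ([] @ us) f x"
    proof (rule K[OF _ that(3) exts(1)[OF vs] that(1)])
      show "length (map (ext x) vs) = length us" using that(2) by (metis length_map)
      show "map (\<lambda>u. u x) (map (ext x) vs) = map (\<lambda>u. u x) us" unfolding exts(2)[OF vs] that(2) ..
    qed simp
    then show ?thesis using that(3) by (simp add: \<sigma>_def)
  qed
  have tan: "\<sigma> x vs \<in> tangent_space A x" if vs: "set vs \<subseteq> E x" for x vs
  proof -
    define us where "us = map (ext x) vs"
    have us: "set us \<subseteq> \<Gamma>" using exts[OF vs] by (simp add: us_def)
    have e: "\<sigma> x vs f = s us f x" if "f \<in> C" for f using that by (simp add: \<sigma>_def us_def)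
    show ?thesis
      unfolding tangent_space_def
    proof (intro CollectI conjI allI impI ballI)
      show "\<sigma> x vs f = 0" if "f \<notin> C" for f using that by (simp add: \<sigma>_def)
      fix f g assume fg: "f \<in> C" "g \<in> C"
      show "\<sigma> x vs (a *\<^sub>R f + b *\<^sub>R g) = a * \<sigma> x vs f + b * \<sigma> x vs g" for a b
      proof -
        have c: "a *\<^sub>R f + b *\<^sub>R g \<in> C"
          using fg by (intro subspace_add subspace_scale subspace_smooth_funs)
        show ?thesis unfolding e[OF c] e[OF fg(1)] e[OF fg(2)]
        proof (rule cancel)
          fix y assume y: "y \<in> \<Gamma>"
          have "(a *\<^sub>R f + b *\<^sub>R g) \<odot> y = a *\<^sub>R (f \<odot> y) + b *\<^sub>R (g \<odot> y)"
            by (simp add: fscale_def scaleR_fun_def fun_eq_iff algebra_simps)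
          then have "curry_last D us ((a *\<^sub>R f + b *\<^sub>R g) \<odot> y) = a *\<^sub>R curry_last D us (f \<odot> y) + b *\<^sub>R curry_last D us (g \<odot> y)"
            using linear_op_lin[OF alt_opD(1)[OF alt_op] us sections_fscale[OF fg(1) y] sections_fscale[OF fg(2) y]] by (simp only:)
          then show "s us (a *\<^sub>R f + b *\<^sub>R g) x *\<^sub>R y x = (a * s us f x + b * s us g x) *\<^sub>R y x"
            unfolding scaleR_add_left scaleR_scaleR[symmetric] seq[OF us c y] seq[OF us fg(1) y] seq[OF us fg(2) y]
            by (simp add: scaleR_fun_def algebra_simps)
        qed
      qed
      show "\<sigma> x vs (f * g) = \<sigma> x vs f * g x + f x * \<sigma> x vs g"
        unfolding e[OF smooth_funs_mult[OF fg]] e[OF fg(1)] e[OF fg(2)]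
      proof (rule cancel)
        fix y assume y: "y \<in> \<Gamma>"
        note gy = sections_fscale[OF fg(2) y]
        \<comment> \<open>The product rule for the symbol comes from applying the Leibniz rule for
          \<open>D\<close> twice, to \<open>f \<odot> (g \<odot> y)\<close>.\<close>
        have p: "(f * g) \<odot> y = f \<odot> (g \<odot> y)" by (simp add: fscale_def fun_eq_iff)
        show "s us (f * g) x *\<^sub>R y x = (s us f x * g x + f x * s us g x) *\<^sub>R y x"
          unfolding seq[OF us smooth_funs_mult[OF fg] y] p section_derD(4)[OF sd us fg(1) gy] section_derD(4)[OF sd us fg(2) y]
          by (simp add: fscale_def algebra_simps)
      qed
    qed
  qed
  have "is_symbol A E T n D \<sigma>"
    unfolding is_symbol_def wedge_hom_sections_def
  proof (intro conjI CollectI allI ballI impI)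
    show "\<sigma> x vs \<in> tangent_space A x" if "vs \<in> args (E x) n" for x vs
      by (rule tan) (use that in \<open>simp add: args_def\<close>)
    show "multilinear_on (E x) n (\<sigma> x)" for x
    proof (rule multilinear_onI)
      fix xs ys v w a b assume *: "set xs \<subseteq> E x" "set ys \<subseteq> E x" "v \<in> E x" "w \<in> E x"
      let ?X = "map (ext x) xs" and ?Y = "map (ext x) ys"
      have X: "set ?X \<subseteq> \<Gamma>" "set ?Y \<subseteq> \<Gamma>" "ext x v \<in> \<Gamma>" "ext x w \<in> \<Gamma>"
        using exts(1)[OF *(1)] exts(1)[OF *(2)] ext *(3,4) by simp_all
      show "\<sigma> x (xs @ (a *\<^sub>R v + b *\<^sub>R w) # ys) = a *\<^sub>R \<sigma> x (xs @ v # ys) + b *\<^sub>R \<sigma> x (xs @ w # ys)"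
      proof
        fix f
        show "\<sigma> x (xs @ (a *\<^sub>R v + b *\<^sub>R w) # ys) f = (a *\<^sub>R \<sigma> x (xs @ v # ys) + b *\<^sub>R \<sigma> x (xs @ w # ys)) f"
        proof (cases "f \<in> C")
          case True
          have "\<sigma> x (xs @ (a *\<^sub>R v + b *\<^sub>R w) # ys) f = s (?X @ (a *\<^sub>R ext x v + b *\<^sub>R ext x w) # ?Y) f x"
          proof (rule \<sigma>_eq[OF _ _ True])
            show "set (?X @ (a *\<^sub>R ext x v + b *\<^sub>R ext x w) # ?Y) \<subseteq> \<Gamma>"
              using X by (simp add: subspace_add subspace_scale subspace_sections)
            show "map (\<lambda>u. u x) (?X @ (a *\<^sub>R ext x v + b *\<^sub>R ext x w) # ?Y) = xs @ (a *\<^sub>R v + b *\<^sub>R w) # ys"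
              using exts(2)[OF *(1)] exts(2)[OF *(2)] ext[OF *(3)] ext[OF *(4)] by (simp add: scaleR_fun_def)
          qed
          also have "\<dots> = a * s (?X @ ext x v # ?Y) f x + b * s (?X @ ext x w # ?Y) f x"
            by (rule smult[OF X True])
          finally show ?thesis using True by (simp add: \<sigma>_def scaleR_fun_def)
        next
          case False
          then show ?thesis by (simp add: \<sigma>_def scaleR_fun_def)
        qed
      qed
    qed
    show "skew_on (E x) n n (\<sigma> x)" for x
    proof (rule skew_onI)
      fix xs ys zs v w assume *: "set xs \<subseteq> E x" "set ys \<subseteq> E x" "set zs \<subseteq> E x" "v \<in> E x" "w \<in> E x"
      have "s (map (ext x) xs @ ext x v # map (ext x) ys @ ext x w # map (ext x) zs) f x =
         - s (map (ext x) xs @ ext x w # map (ext x) ys @ ext x v # map (ext x) zs) f x" if "f \<in> C" for f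
        by (rule sskew[OF exts(1)[OF *(1)] exts(1)[OF *(2)] exts(1)[OF *(3)] _ _ that]) (use ext * in simp_all)
      then show "\<sigma> x (xs @ v # ys @ w # zs) = - \<sigma> x (xs @ w # ys @ v # zs)"
        by (simp add: \<sigma>_def fun_eq_iff)
    qed simp
    fix W us assume W: "open W" and us: "us \<in> args {u. smooth_section_on A E T W u} n"
    have usE: "set (map (\<lambda>u. u x) us) \<subseteq> E x" if "x \<in> W" for x
      using us that unfolding args_def local_section_iff by auto
    show "smooth_vector_field_on A W (\<lambda>x. \<sigma> x (map (\<lambda>u. u x) us))"
      unfolding smooth_vector_field_on_def
    proof (intro conjI ballI)
      show "\<sigma> x (map (\<lambda>u. u x) us) \<in> tangent_space A x" if "x \<in> W" for x by (rule tan[OF usE[OF that]])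
      fix f assume f: "f \<in> C"
      show "smooth_map_on A W (\<lambda>x. \<sigma> x (map (\<lambda>u. u x) us) f)"
        unfolding smooth_map_on_smooth
      proof (rule smooth_local[OF W])
        fix p assume p: "p \<in> W"
        obtain \<eta> :: "'m \<Rightarrow> real" and N K where \<eta>: "smooth UNIV \<eta>" "open N" "p \<in> N" "N \<subseteq> W" "\<And>x. x \<in> N \<Longrightarrow> \<eta> x = 1"
          "closed K" "K \<subseteq> W" "\<And>x. x \<notin> K \<Longrightarrow> \<eta> x = 0"
          using bump[OF W p] by metis
        \<comment> \<open>Near \<open>p\<close> the local sections are replaced by global ones, for
          which \<open>s\<close> gives a smooth function. On \<open>N\<close> the values agree and
          therefore so does \<open>\<sigma>\<close>.\<close>
        define us' where "us' = map (\<lambda>u x. if x \<in> W then \<eta> x *\<^sub>R u x else 0) us"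
        have us': "set us' \<subseteq> \<Gamma>"
        proof
          fix u' assume "u' \<in> set us'"
          then obtain u where u: "u \<in> set us" "u' = (\<lambda>x. if x \<in> W then \<eta> x *\<^sub>R u x else 0)"
            unfolding us'_def by auto
          have "smooth_section_on A E T W u" using us u(1) by (auto simp: args_def)
          then show "u' \<in> \<Gamma>" unfolding u(2) by (rule extend_section[OF W _ \<eta>(1,6-8)])
        qed
        have "smooth (W \<inter> N) (s us' f)"
          using section_derD(3)[OF sd us' f] unfolding smooth_funs_smooth by (rule smooth_subset) simp
        then have "smooth (W \<inter> N) (\<lambda>x. \<sigma> x (map (\<lambda>u. u x) us) f)"
        proof (rule smooth_cong[rotated])
          fix x assume x: "x \<in> W \<inter> N"
          have "map (\<lambda>u. u x) us' = map (\<lambda>u. u x) us" using x \<eta>(5) by (simp add: us'_def)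
          then show "s us' f x = \<sigma> x (map (\<lambda>u. u x) us) f" by (rule \<sigma>_eq[OF us' _ f, symmetric])
        qed (use W \<eta>(2) in auto)
        then show "\<exists>N. open N \<and> p \<in> N \<and> smooth (W \<inter> N) (\<lambda>x. \<sigma> x (map (\<lambda>u. u x) us) f)"
          using \<eta>(2,3) by blast
      qed
    qed
  next
    fix us u f assume *: "us \<in> args \<Gamma> n" "u \<in> \<Gamma>" "f \<in> C"
    then have us: "set us \<subseteq> \<Gamma>" by (simp add: args_def)
    have "(\<lambda>x. \<sigma> x (map (\<lambda>u. u x) us) f) = s us f" using \<sigma>_eq[OF us refl *(3)] by (simp add: fun_eq_iff)
    then show "D (us @ [f \<odot> u]) = f \<odot> D (us @ [u]) + (\<lambda>x. \<sigma> x (map (\<lambda>u. u x) us) f) \<odot> u"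
      using section_derD(4)[OF sd us *(3,2)] unfolding curry_last_def by simp
  qed
  then show ?thesis by blast
qed

text \<open>With this converse of \<open>Der_section_der\<close>, it is enough to verify the bracket
  algebraically: the passage from a symbol on global sections to a bundle map is made here once and
  for all.\<close>

lemma section_der_Der:
  assumes zero: "\<And>us. us \<notin> args \<Gamma> (n + 1) \<Longrightarrow> D us = 0" and sd: "section_der \<Gamma> C n (curry_last D) s"
  shows "D \<in> Der A E T n"
proof -
  note alt_op = section_derD(1)[OF sd]
  have alt: "alternating \<Gamma> (\<lambda>xs. D (xs @ [y]))" if "y \<in> \<Gamma>" for y using alt_opD(2)[OF alt_op that] by (simp add: curry_last_def)
  have DS: "D us \<in> \<Gamma>" for us
  proof (cases "us \<in> args \<Gamma> (n + 1)")
    case True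
    then obtain vs y where "us = vs @ [y]" "set vs \<subseteq> \<Gamma>" "y \<in> \<Gamma>"
      by (cases us rule: rev_cases) (auto simp: args_def)
    then show ?thesis using alternatingD(3)[OF alt] by simp
  next
    case False
    then show ?thesis using zero subspace_0[OF subspace_sections] by simp
  qed
  have "multilinear_on \<Gamma> (n + 1) D"
  proof (rule multilinear_onI)
    fix xs ys v w a b
    assume *: "set xs \<subseteq> \<Gamma>" "set ys \<subseteq> \<Gamma>" "v \<in> \<Gamma>" "w \<in> \<Gamma>"
    show "D (xs @ (a *\<^sub>R v + b *\<^sub>R w) # ys) = a *\<^sub>R D (xs @ v # ys) + b *\<^sub>R D (xs @ w # ys)"
    proof (cases ys rule: rev_cases)
      case Nil
      then show ?thesis using linear_op_lin[OF alt_opD(1)[OF alt_op] *(1,3,4)] unfolding curry_last_def by simp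
    next
      case (snoc zs y)
      then show ?thesis using mlinear_lin[OF alternatingD(1)[OF alt] *(1) _ *(3,4), of y zs] *(2) by simp
    qed
  qed
  moreover have "skew_on \<Gamma> (n + 1) n D"
  proof (rule skew_onI)
    fix xs ys zs v w
    assume *: "set xs \<subseteq> \<Gamma>" "set ys \<subseteq> \<Gamma>" "set zs \<subseteq> \<Gamma>" "v \<in> \<Gamma>" "w \<in> \<Gamma>"
      and l: "length (xs @ v # ys @ w # zs) = n + 1" "length (xs @ v # ys @ [w]) \<le> n"
    \<comment> \<open>The exchanged positions are among the first \<open>n\<close> of
      \<open>n + 1\<close>, so a last argument remains behind them.\<close>
    then obtain zs' y where z: "zs = zs' @ [y]" by (cases zs rule: rev_cases) auto
    then show "D (xs @ v # ys @ w # zs) = - D (xs @ w # ys @ v # zs)"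
      using skewf_swap[OF alternatingD(2)[OF alt] *(1,2) _ *(4,5), of y zs'] *(3) by simp
  qed simp
  moreover have "D (us[i := f \<odot> us ! i]) = f \<odot> D us" if "us \<in> args \<Gamma> (n + 1)" "i < n" "f \<in> C" for us i f
  proof -
    have l: "length us = n + 1" "set us \<subseteq> \<Gamma>" using that(1) by (auto simp: args_def)
    then have i: "i < length us" using that by simp
    obtain xs v us' where 1: "us = xs @ v # us'" "length xs = i"
      using id_take_nth_drop[OF i] i by (metis length_take min.absorb4)
    moreover from 1 l that(2) obtain zs y where z: "us' = zs @ [y]" by (cases us' rule: rev_cases) auto
    ultimately show ?thesis
      using section_derD(2)[OF sd that(3), of y, unfolded fun_linear_def curry_last_def, rule_format, of xs zs v] l(2)
      by (simp add: nth_append list_update_append)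
  qed
  moreover have "\<exists>\<sigma>. is_symbol A E T n D \<sigma>"
  \<comment> \<open>A nonzero fibre vector is what recovers the symbol from \<open>D\<close>;
    without one, every section is 0.\<close>
  proof (cases "\<exists>w::'f. w \<noteq> 0")
    case True
    then show ?thesis using symbol_exists[OF sd] by blast
  next
    case False
    then show ?thesis using symbol_exists_rank0[of D n] DS by blast
  qed
  ultimately show ?thesis unfolding Der_def using DS zero by simp
qed

end

section \<open>The graded Lie algebra of multiderivations\<close>

text \<open>\<open>mn_bracket\<close> and \<open>op_bracket\<close> are known to agree on lists of
  sections only, so \<open>section_der\<close> has to be transported along such a partial
  equality.\<close>

lemma section_der_cong:
  assumes S: "subspace S" and CS: "\<And>f y. f \<in> C \<Longrightarrow> y \<in> S \<Longrightarrow> f \<odot> y \<in> S" and F: "section_der S C n F \<sigma>"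
    and e: "\<And>xs y. set xs \<subseteq> S \<Longrightarrow> y \<in> S \<Longrightarrow> F' xs y = F xs y"
  shows "section_der S C n F' \<sigma>"
proof -
  note mF = section_derD(1)[OF F]
  have lin: "a *\<^sub>R v + b *\<^sub>R w \<in> S" if "v \<in> S" "w \<in> S" for a b v w
    using that S by (simp add: subspace_add subspace_scale)
  have "linear_op S S F'"
    unfolding linear_op_def using e linear_op_in[OF alt_opD(1)[OF mF]] linear_op_lin[OF alt_opD(1)[OF mF]] lin by simp
  moreover have "alternating S (\<lambda>xs. F' xs y)" if y: "y \<in> S" for y
    unfolding alternating_def mlinear_def skewf_def
  proof (intro conjI allI impI ballI)
    note a = alt_opD(2)[OF mF y]
    show "F' us y \<in> S" if "set us \<subseteq> S" for us using e[OF that y] alternatingD(3)[OF a that] by simp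
    fix xs ys v w assume *: "set xs \<subseteq> S" "set ys \<subseteq> S" "v \<in> S" "w \<in> S"
    have e': "F' (xs @ z # ys) y = F (xs @ z # ys) y" if "z \<in> S" for z
      by (rule e[OF _ y]) (use * that in simp)
    show "F' (xs @ (p *\<^sub>R v + q *\<^sub>R w) # ys) y = p *\<^sub>R F' (xs @ v # ys) y + q *\<^sub>R F' (xs @ w # ys) y" for p q
      unfolding e'[OF lin[OF *(3,4)]] e'[OF *(3)] e'[OF *(4)] by (rule mlinear_lin[OF alternatingD(1)[OF a] *])
    have e'': "F' (xs @ z # z' # ys) y = F (xs @ z # z' # ys) y" if "z \<in> S" "z' \<in> S" for z z'
      by (rule e[OF _ y]) (use * that in simp)
    show "F' (xs @ v # w # ys) y = - F' (xs @ w # v # ys) y"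
      unfolding e''[OF *(3,4)] e''[OF *(4,3)]
      by (rule alternatingD(2)[OF a, unfolded skewf_def, rule_format, OF *])
  qed
  moreover have "supported S (\<lambda>i. i = n) (\<lambda>xs. F' xs y)" if y: "y \<in> S" for y
    using alt_opD(3)[OF mF y] e[OF _ y] unfolding supported_def by simp
  moreover have "fun_linear S f (\<lambda>xs. F' xs y)" if f: "f \<in> C" and y: "y \<in> S" for f y
    unfolding fun_linear_def
  proof (intro allI impI)
    fix xs ys v assume *: "set xs \<subseteq> S" "set ys \<subseteq> S" "v \<in> S"
    have e': "F' (xs @ z # ys) y = F (xs @ z # ys) y" if "z \<in> S" for z
      by (rule e[OF _ y]) (use * that in simp)
    show "F' (xs @ (f \<odot> v) # ys) y = f \<odot> F' (xs @ v # ys) y"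
      unfolding e'[OF CS[OF f *(3)]] e'[OF *(3)]
      by (rule section_derD(2)[OF F f y, unfolded fun_linear_def, rule_format, OF *])
  qed
  moreover have "F' xs (f \<odot> y) = f \<odot> F' xs y + \<sigma> xs f \<odot> y" if "set xs \<subseteq> S" "f \<in> C" "y \<in> S" for xs f y
    unfolding e[OF that(1) CS[OF that(2,3)]] e[OF that(1,3)] by (rule section_derD(4)[OF F that])
  ultimately show ?thesis
    unfolding section_der_def alt_op_def by (intro conjI ballI allI impI section_derD(3)[OF F])
qed

lemma section_der_lin:
  assumes S: "subspace S" and C: "subspace C" and F: "section_der S C n F \<sigma>" and G: "section_der S C n G \<tau>"
  shows "section_der S C n (\<lambda>xs y. a *\<^sub>R F xs y + b *\<^sub>R G xs y) (\<lambda>us f. a *\<^sub>R \<sigma> us f + b *\<^sub>R \<tau> us f)"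
proof -
  note mF = section_derD(1)[OF F] and mG = section_derD(1)[OF G]
  have "linear_op S S (\<lambda>xs y. a *\<^sub>R F xs y + b *\<^sub>R G xs y)"
    unfolding linear_op_def
    using linear_op_in[OF alt_opD(1)[OF mF]] linear_op_in[OF alt_opD(1)[OF mG]] linear_op_lin[OF alt_opD(1)[OF mF]] linear_op_lin[OF alt_opD(1)[OF mG]]
    by (simp add: subspace_add[OF S] subspace_scale[OF S] scaleR_add_right mult.commute)
  moreover have "alternating S (\<lambda>xs. a *\<^sub>R F xs y + b *\<^sub>R G xs y)" if y: "y \<in> S" for y
    by (rule alternating_lin[OF S alt_opD(2)[OF mF y] alt_opD(2)[OF mG y]])
  moreover have "supported S (\<lambda>i. i = n) (\<lambda>xs. a *\<^sub>R F xs y + b *\<^sub>R G xs y)" if y: "y \<in> S" for y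
    using alt_opD(3)[OF mF y] alt_opD(3)[OF mG y] unfolding supported_def by (metis add.right_neutral scaleR_zero_right)
  moreover have "fun_linear S f (\<lambda>xs. a *\<^sub>R F xs y + b *\<^sub>R G xs y)" if f: "f \<in> C" "y \<in> S" for f y
    using section_derD(2)[OF F f] section_derD(2)[OF G f] unfolding fun_linear_def
    by (auto simp: fun_eq_iff fscale_def scaleR_fun_def algebra_simps)
  moreover have "a *\<^sub>R F xs (f \<odot> y) + b *\<^sub>R G xs (f \<odot> y) =
     f \<odot> (a *\<^sub>R F xs y + b *\<^sub>R G xs y) + (a *\<^sub>R \<sigma> xs f + b *\<^sub>R \<tau> xs f) \<odot> y"
    if "set xs \<subseteq> S" "f \<in> C" "y \<in> S" for xs f y
    unfolding section_derD(4)[OF F that] section_derD(4)[OF G that]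
    by (auto simp: fun_eq_iff fscale_def scaleR_fun_def algebra_simps)
  moreover have "a *\<^sub>R \<sigma> xs f + b *\<^sub>R \<tau> xs f \<in> C" if "set xs \<subseteq> S" "f \<in> C" for xs f
    by (intro subspace_add[OF C] subspace_scale[OF C] section_derD(3)[OF F that] section_derD(3)[OF G that])
  ultimately show ?thesis unfolding section_der_def alt_op_def by (intro conjI ballI allI impI)
qed

lemma section_der_zero:
  assumes S: "subspace S" and C: "subspace C"
  shows "section_der S C n (\<lambda>xs y. 0) (\<lambda>us f. 0)"
  unfolding section_der_def alt_op_def linear_op_def alternating_def mlinear_def skewf_def supported_def fun_linear_def
  using subspace_0[OF S] subspace_0[OF C] by (simp add: fscale_def fun_eq_iff)

lemma act_cong_op:
  assumes S: "subspace S" and F: "alt_op S n F" and F': "alt_op S n F'"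
    and e: "\<And>xs y. set xs \<subseteq> S \<Longrightarrow> y \<in> S \<Longrightarrow> F xs y = F' xs y"
    and us: "set us \<subseteq> S" and B: "\<And>xs. set xs \<subseteq> S \<Longrightarrow> \<beta> xs \<in> S"
  shows "act n F \<beta> us = act n F' \<beta> us"
proof -
  have "vfield n F xs = vfield n F' xs" if "set xs \<subseteq> S" for xs
    unfolding vfield_def by (rule wedge_cong[OF that e refl alternatingD(3)[OF alternating_id_form[OF S]]])
  then have "insertion (Suc n) (vfield n F) \<beta> us = insertion (Suc n) (vfield n F') \<beta> us"
    by (intro insertion_cong[OF us]) (simp_all add: alternatingD(3)[OF alternating_vfield[OF S F']])
  moreover have "wedge n F \<beta> us = wedge n F' \<beta> us" by (rule wedge_cong[OF us e refl B])
  ultimately show ?thesis by (simp add: act_def)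
qed

text \<open>Needed for nested brackets: the inner bracket of the statement is replaced by
  \<open>op_bracket\<close>, with which it agrees on sections.\<close>

lemma op_bracket_cong:
  assumes S: "subspace S" and F: "alt_op S n F" "alt_op S n F'" and G: "alt_op S m G" "alt_op S m G'"
    and e: "\<And>xs y. set xs \<subseteq> S \<Longrightarrow> y \<in> S \<Longrightarrow> F xs y = F' xs y" "\<And>xs y. set xs \<subseteq> S \<Longrightarrow> y \<in> S \<Longrightarrow> G xs y = G' xs y"
    and us: "set us \<subseteq> S" and y: "y \<in> S"
  shows "op_bracket n m F G us y = op_bracket n m F' G' us y"
proof -
  have l: "act n F (\<lambda>vs. G vs y) us = act n F' (\<lambda>vs. G' vs y) us"
    if F: "alt_op S n F" "alt_op S n F'" and G: "alt_op S m G" "alt_op S m G'"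
    and e: "\<And>xs y. set xs \<subseteq> S \<Longrightarrow> y \<in> S \<Longrightarrow> F xs y = F' xs y" "\<And>xs y. set xs \<subseteq> S \<Longrightarrow> y \<in> S \<Longrightarrow> G xs y = G' xs y"
    for n m F F' G G'
    using act_cong_op[OF S F e(1) us alternatingD(3)[OF alt_opD(2)[OF G(1) y]]]
      act_cong[OF F(2) us S e(2)[OF _ y] alternatingD(3)[OF alt_opD(2)[OF G(1) y]]] by simp
  have "act n F (\<lambda>vs. G vs y) us = act n F' (\<lambda>vs. G' vs y) us" by (rule l[OF F G e])
  moreover have "act m G (\<lambda>vs. F vs y) us = act m G' (\<lambda>vs. F' vs y) us" by (rule l[OF G F e(2,1)])
  ultimately show ?thesis by (simp only: op_bracket_def)
qed

lemma act_lin_op: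
  assumes S: "subspace S" and F: "alt_op S n F" and G: "alt_op S n G" and us: "set us \<subseteq> S" and B: "alternating S \<beta>"
  shows "act n (\<lambda>xs y. a *\<^sub>R F xs y + b *\<^sub>R G xs y) \<beta> us = a *\<^sub>R act n F \<beta> us + b *\<^sub>R act n G \<beta> us"
proof -
  have v: "vfield n (\<lambda>xs y. a *\<^sub>R F xs y + b *\<^sub>R G xs y) = (\<lambda>xs. a *\<^sub>R vfield n F xs + b *\<^sub>R vfield n G xs)"
    by (simp add: fun_eq_iff vfield_def wedge_add_op wedge_scale_op)
  have "insertion (Suc n) (\<lambda>xs. a *\<^sub>R vfield n F xs + b *\<^sub>R vfield n G xs) \<beta> us =
      a *\<^sub>R insertion (Suc n) (vfield n F) \<beta> us + b *\<^sub>R insertion (Suc n) (vfield n G) \<beta> us"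
    by (rule insertion_lin_vec[OF us alternatingD(1)[OF B]])
      (simp_all add: alternatingD(3)[OF alternating_vfield[OF S F]] alternatingD(3)[OF alternating_vfield[OF S G]])
  then show ?thesis unfolding act_def v wedge_add_op wedge_scale_op by (simp add: algebra_simps)
qed

lemma op_bracket_lin:
  assumes S: "subspace S" and F: "alt_op S n F" and F': "alt_op S n F'" and G: "alt_op S m G"
    and us: "set us \<subseteq> S" and y: "y \<in> S"
  shows "op_bracket n m (\<lambda>xs y. a *\<^sub>R F xs y + b *\<^sub>R F' xs y) G us y = a *\<^sub>R op_bracket n m F G us y + b *\<^sub>R op_bracket n m F' G us y"
proof -
  have "act m G (\<lambda>vs. a *\<^sub>R F vs y + b *\<^sub>R F' vs y) us =
      a *\<^sub>R act m G (\<lambda>vs. F vs y) us + b *\<^sub>R act m G (\<lambda>vs. F' vs y) us"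
    by (rule act_lin[OF G us alternatingD(3)[OF alt_opD(2)[OF F y]] alternatingD(3)[OF alt_opD(2)[OF F' y]]])
  then show ?thesis
    unfolding op_bracket_def act_lin_op[OF S F F' us alt_opD(2)[OF G y]] by (simp add: algebra_simps)
qed

lemma scaleR_fun_apply: "(a *\<^sub>R f) x = a *\<^sub>R f x"
  by (simp add: scaleR_fun_def)

lemma mn_bracket_outside: "us \<notin> args S (n + m + 1) \<Longrightarrow> mn_bracket S n m D1 D2 us = 0"
  by (simp add: mn_bracket_def mn_comp_def scaleR_fun_apply add.commute)

text \<open>Formal, since the bracket is defined as a graded commutator. It also carries linearity
  over from the first argument to the second.\<close>

lemma mn_bracket_skew: "mn_bracket S m n D1 D2 = - ((-1) ^ (m * n) *\<^sub>R mn_bracket S n m D2 D1)"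
  unfolding mn_bracket_def
  by (cases m rule: neg_one_pow_cases; cases n rule: neg_one_pow_cases)
    (simp_all add: power_mult fun_eq_iff scaleR_fun_def)

text \<open>Multiderivations are total functions set to 0 outside their domain, so an identity
  between them has to be checked only on lists of sections with the last one split off.\<close>

lemma fun_eq_argsI:
  assumes "\<And>us. us \<notin> args S (N + 1) \<Longrightarrow> f us = 0" "\<And>us. us \<notin> args S (N + 1) \<Longrightarrow> g us = 0"
    and "\<And>us y. set us \<subseteq> S \<Longrightarrow> length us = N \<Longrightarrow> y \<in> S \<Longrightarrow> f (us @ [y]) = g (us @ [y])"
  shows "f = g"
proof
  fix us
  show "f us = g us"
  proof (cases "us \<in> args S (N + 1)")
    case True
    then obtain vs y where "us = vs @ [y]" "set vs \<subseteq> S" "length vs = N" "y \<in> S"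
      by (cases us rule: rev_cases) (auto simp: args_def)
    then show ?thesis using assms(3) by simp
  next
    case False
    then show ?thesis using assms(1,2) by simp
  qed
qed

section \<open>The bracket of multiderivations and left-symmetric algebroids\<close>

context vbundle
begin

lemma Der_alt_op:
  assumes "D \<in> Der A E T n" shows "alt_op \<Gamma> n (curry_last D)"
proof -
  obtain s where "section_der \<Gamma> C n (curry_last D) s" by (rule Der_section_der[OF assms])
  then show ?thesis by (rule section_derD(1))
qed

lemma Der_outside: "D \<in> Der A E T n \<Longrightarrow> us \<notin> args \<Gamma> (n + 1) \<Longrightarrow> D us = 0"
  unfolding Der_def by simp

text \<open>On lists of the wrong length both sides vanish, the left by its default value and the
  right by its degree.\<close>

lemma curry_last_mn_bracket:
  assumes "D1 \<in> Der A E T n" "D2 \<in> Der A E T m" "set us \<subseteq> \<Gamma>" "y \<in> \<Gamma>"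
  shows "curry_last (mn_bracket \<Gamma> n m D1 D2) us y = op_bracket n m (curry_last D1) (curry_last D2) us y"
proof (cases "length us = n + m")
  case True
  then show ?thesis
    using mn_bracket_curry_last[OF subspace_sections Der_alt_op[OF assms(1)] Der_alt_op[OF assms(2)] assms(3) True assms(4)]
    by (simp add: curry_last_def)
next
  case False
  have "op_bracket n m (curry_last D1) (curry_last D2) us y = 0"
    using supported_eq_0[OF alt_opD(3)[OF alt_op_op_bracket[OF subspace_sections Der_alt_op[OF assms(1)] Der_alt_op[OF assms(2)]] assms(4)] assms(3)] False
    by blast
  moreover have "us @ [y] \<notin> args \<Gamma> (n + m + 1)" using False by (simp add: args_def)
  ultimately show ?thesis using mn_bracket_outside[of "us @ [y]"] by (simp add: curry_last_def)
qed

lemma mn_bracket_Der: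
  assumes "D1 \<in> Der A E T n" "D2 \<in> Der A E T m"
  shows "mn_bracket \<Gamma> n m D1 D2 \<in> Der A E T (n + m)"
proof -
  obtain s1 where s1: "section_der \<Gamma> C n (curry_last D1) s1" by (rule Der_section_der[OF assms(1)])
  obtain s2 where s2: "section_der \<Gamma> C m (curry_last D2) s2" by (rule Der_section_der[OF assms(2)])
  note b = section_der_op_bracket[OF subspace_sections subspace_smooth_funs s1 s2 sections_fscale]
  show ?thesis
    by (rule section_der_Der[OF mn_bracket_outside section_der_cong[OF subspace_sections sections_fscale b curry_last_mn_bracket[OF assms]]])
qed

lemma subspace_Der: "subspace (Der A E T n)"
proof -
  have lin: "a *\<^sub>R D + b *\<^sub>R D' \<in> Der A E T n" if D: "D \<in> Der A E T n" and D': "D' \<in> Der A E T n" for a b D D'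
  proof -
    obtain s where s: "section_der \<Gamma> C n (curry_last D) s" by (rule Der_section_der[OF D])
    obtain s' where s': "section_der \<Gamma> C n (curry_last D') s'" by (rule Der_section_der[OF D'])
    have h: "curry_last (a *\<^sub>R D + b *\<^sub>R D') = (\<lambda>xs y. a *\<^sub>R curry_last D xs y + b *\<^sub>R curry_last D' xs y)"
      by (simp add: fun_eq_iff curry_last_def scaleR_fun_def)
    show ?thesis
    proof (rule section_der_Der)
      show "(a *\<^sub>R D + b *\<^sub>R D') us = 0" if "us \<notin> args \<Gamma> (n + 1)" for us
        using Der_outside[OF D that] Der_outside[OF D' that] by (simp add: scaleR_fun_apply)
      show "section_der \<Gamma> C n (curry_last (a *\<^sub>R D + b *\<^sub>R D')) (\<lambda>us f. a *\<^sub>R s us f + b *\<^sub>R s' us f)"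
        unfolding h by (rule section_der_lin[OF subspace_sections subspace_smooth_funs s s'])
    qed
  qed
  have "curry_last (0 :: ('m \<Rightarrow> 'v) list \<Rightarrow> 'm \<Rightarrow> 'v) = (\<lambda>xs y. 0)" by (simp add: fun_eq_iff curry_last_def)
  then have "0 \<in> Der A E T n"
    using section_der_Der[of n 0] section_der_zero[OF subspace_sections subspace_smooth_funs, of n] by simp
  then show ?thesis
    using lin[of _ _ 1 1] lin[of _ _ _ 0] by (intro subspaceI) (simp_all only: scaleR_one scaleR_zero_left add_0_right)
qed

lemma mn_bracket_lin1:
  assumes x: "x \<in> Der A E T m" and x': "x' \<in> Der A E T m" and y: "y \<in> Der A E T n"
  shows "mn_bracket \<Gamma> m n (a *\<^sub>R x + b *\<^sub>R x') y = a *\<^sub>R mn_bracket \<Gamma> m n x y + b *\<^sub>R mn_bracket \<Gamma> m n x' y"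
proof (rule fun_eq_argsI)
  fix us w assume *: "set us \<subseteq> \<Gamma>" "length us = m + n" "w \<in> \<Gamma>"
  have c: "a *\<^sub>R x + b *\<^sub>R x' \<in> Der A E T m"
    by (intro subspace_add subspace_scale subspace_Der x x')
  have h: "curry_last (a *\<^sub>R x + b *\<^sub>R x') = (\<lambda>xs y. a *\<^sub>R curry_last x xs y + b *\<^sub>R curry_last x' xs y)"
    by (simp add: fun_eq_iff curry_last_def scaleR_fun_def)
  have "curry_last (mn_bracket \<Gamma> m n (a *\<^sub>R x + b *\<^sub>R x') y) us w =
      a *\<^sub>R curry_last (mn_bracket \<Gamma> m n x y) us w + b *\<^sub>R curry_last (mn_bracket \<Gamma> m n x' y) us w"
    unfolding curry_last_mn_bracket[OF c y *(1,3)] curry_last_mn_bracket[OF x y *(1,3)] curry_last_mn_bracket[OF x' y *(1,3)] h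
    by (rule op_bracket_lin[OF subspace_sections Der_alt_op[OF x] Der_alt_op[OF x'] Der_alt_op[OF y] *(1,3)])
  then show "mn_bracket \<Gamma> m n (a *\<^sub>R x + b *\<^sub>R x') y (us @ [w]) =
      (a *\<^sub>R mn_bracket \<Gamma> m n x y + b *\<^sub>R mn_bracket \<Gamma> m n x' y) (us @ [w])"
    by (simp add: curry_last_def scaleR_fun_def)
qed (simp_all add: mn_bracket_outside scaleR_fun_apply)

lemma mn_bracket_lin2:
  assumes x: "x \<in> Der A E T m" and y: "y \<in> Der A E T n" and y': "y' \<in> Der A E T n"
  shows "mn_bracket \<Gamma> m n x (a *\<^sub>R y + b *\<^sub>R y') = a *\<^sub>R mn_bracket \<Gamma> m n x y + b *\<^sub>R mn_bracket \<Gamma> m n x y'"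
  unfolding mn_bracket_skew[of _ m n x] mn_bracket_lin1[OF y y' x]
  by (simp add: fun_eq_iff scaleR_fun_def algebra_simps)

lemma mn_bracket_jacobi:
  assumes x: "x \<in> Der A E T m" and y: "y \<in> Der A E T n" and z: "z \<in> Der A E T p"
  shows "mn_bracket \<Gamma> m (n + p) x (mn_bracket \<Gamma> n p y z) =
    mn_bracket \<Gamma> (m + n) p (mn_bracket \<Gamma> m n x y) z +
    (-1) ^ (m * n) *\<^sub>R mn_bracket \<Gamma> n (m + p) y (mn_bracket \<Gamma> m p x z)" (is "?L = ?R1 + _ *\<^sub>R ?R2")
proof (rule fun_eq_argsI)
  fix us w assume us: "set us \<subseteq> \<Gamma>" and w: "w \<in> \<Gamma>"
  note S = subspace_sections and X = Der_alt_op[OF x] and Y = Der_alt_op[OF y] and Z = Der_alt_op[OF z]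
  have r: "curry_last (mn_bracket \<Gamma> i (j + k) a (mn_bracket \<Gamma> j k b c)) us w =
      op_bracket i (j + k) (curry_last a) (op_bracket j k (curry_last b) (curry_last c)) us w"
    if a: "a \<in> Der A E T i" and b: "b \<in> Der A E T j" and c: "c \<in> Der A E T k" for a b c i j k
    unfolding curry_last_mn_bracket[OF a mn_bracket_Der[OF b c] us w]
    by (rule op_bracket_cong[OF S Der_alt_op[OF a] Der_alt_op[OF a] Der_alt_op[OF mn_bracket_Der[OF b c]]
          alt_op_op_bracket[OF S Der_alt_op[OF b] Der_alt_op[OF c]] refl curry_last_mn_bracket[OF b c] us w])
  have l: "curry_last ?R1 us w = op_bracket (m + n) p (op_bracket m n (curry_last x) (curry_last y)) (curry_last z) us w"
    unfolding curry_last_mn_bracket[OF mn_bracket_Der[OF x y] z us w]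
    by (rule op_bracket_cong[OF S Der_alt_op[OF mn_bracket_Der[OF x y]] alt_op_op_bracket[OF S X Y] Z Z
          curry_last_mn_bracket[OF x y] refl us w])
  have "curry_last ?L us w = curry_last ?R1 us w + (-1) ^ (m * n) *\<^sub>R curry_last ?R2 us w"
    unfolding r[OF x y z] r[OF y x z] l by (rule op_bracket_jacobi[OF S X Y Z us w])
  then show "?L (us @ [w]) = (?R1 + (-1) ^ (m * n) *\<^sub>R ?R2) (us @ [w])"
    by (simp add: curry_last_def scaleR_fun_def)
next
  fix us assume *: "us \<notin> args \<Gamma> (m + n + p + 1)"
  show "?L us = 0" by (rule mn_bracket_outside) (use * in \<open>simp add: add_ac\<close>)
  have "?R1 us = 0" by (rule mn_bracket_outside) (use * in \<open>simp add: add_ac\<close>)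
  moreover have "?R2 us = 0" by (rule mn_bracket_outside) (use * in \<open>simp add: add_ac\<close>)
  ultimately show "(?R1 + (-1) ^ (m * n) *\<^sub>R ?R2) us = 0" by (simp add: scaleR_fun_apply)
qed

lemma graded_lie_algebra_Der: "graded_lie_algebra (Der A E T) (mn_bracket \<Gamma>)"
  unfolding graded_lie_algebra_def
  by (intro conjI allI ballI subspace_Der mn_bracket_Der mn_bracket_lin1 mn_bracket_lin2
      mn_bracket_skew mn_bracket_jacobi)

text \<open>For two operators of degree 1 the sign \<open>(-1) ^ (1 * 1)\<close> makes both halves
  of the bracket equal to minus \<open>act\<close>, whence the factor -2. The field of
  \<open>\<pi>\<close> is its commutator, so \<open>act\<close> yields the curvature a*(b*c) -
  b*(a*c) - (a*b - b*a)*c, which is the antisymmetrized associator.\<close>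

lemma mn_bracket_1_1:
  assumes p: "\<pi> \<in> Der A E T 1" and u: "a \<in> \<Gamma>" "b \<in> \<Gamma>" "c \<in> \<Gamma>"
  shows "mn_bracket \<Gamma> 1 1 \<pi> \<pi> [a, b, c] = (-2) *\<^sub>R
    ((\<pi> [a, \<pi> [b, c]] - \<pi> [\<pi> [a, b], c]) - (\<pi> [b, \<pi> [a, c]] - \<pi> [\<pi> [b, a], c]))"
proof -
  let ?F = "curry_last \<pi>"
  note alt_op = Der_alt_op[OF p]
  have zl: "\<pi> us = 0" if "length us \<noteq> 2" for us
    using Der_outside[OF p, of us] that by (simp add: args_def)
  have z: "?F [] v = 0" "?F [v, w] x = 0" "?F [v, w, x'] x = 0" for v w x x' by (simp_all add: curry_last_def zl)
  have pin: "\<pi> [v, w] \<in> \<Gamma>" if "v \<in> \<Gamma>" "w \<in> \<Gamma>" for v w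
    using alternatingD(3)[OF alt_opD(2)[OF alt_op that(2)], of "[v]"] that by (simp add: curry_last_def)
  have F0: "?F [v] 0 = 0" if "v \<in> \<Gamma>" for v
    by (rule linear_op_zero[OF alt_opD(1)[OF alt_op]]) (use that subspace_0[OF subspace_sections] in simp_all)
  have wd2: "wedge 1 ?F \<beta> [a, b] = ?F [a] (\<beta> [b]) - ?F [b] (\<beta> [a])" for \<beta>
    by (simp add: z)
  have X: "vfield 1 ?F [a, b] = \<pi> [a, b] - \<pi> [b, a]"
    unfolding vfield_def wd2 by (simp add: curry_last_def)
  have i: "insertion 2 (vfield 1 ?F) (\<lambda>vs. ?F vs c) [a, b] = ?F [vfield 1 ?F [a, b]] c"
    by (simp add: z)
  have "?F [\<pi> [a, b] - \<pi> [b, a]] c = ?F [\<pi> [a, b]] c - ?F [\<pi> [b, a]] c"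
    using mlinear_lin_hd[OF alternatingD(1)[OF alt_opD(2)[OF alt_op u(3)]], of "[]" "\<pi> [a, b]" "\<pi> [b, a]" 1 "-1"]
      pin[OF u(1,2)] pin[OF u(2,1)] by (simp only: scaleR_one scaleR_minus1_left diff_conv_add_uminus) simp
  then have l: "act 1 ?F (\<lambda>vs. ?F vs c) [a, b] =
     (\<pi> [a, \<pi> [b, c]] - \<pi> [b, \<pi> [a, c]]) - (\<pi> [\<pi> [a, b], c] - \<pi> [\<pi> [b, a], c])"
    unfolding act_def wd2 Suc_1 i X by (simp add: curry_last_def)
  have "mn_bracket \<Gamma> 1 1 \<pi> \<pi> [a, b, c] = op_bracket 1 1 ?F ?F [a, b] c"
    using curry_last_mn_bracket[OF p p, of "[a, b]" c] u by (simp add: curry_last_def)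
  then show ?thesis unfolding op_bracket_def l
    by (simp add: fun_eq_iff scaleR_fun_def algebra_simps flip: scaleR_2)
qed

lemma mn_bracket_1_1_eq_0_iff:
  assumes p: "\<pi> \<in> Der A E T 1"
  shows "mn_bracket \<Gamma> 1 1 \<pi> \<pi> = 0 \<longleftrightarrow> (\<forall>x\<in>\<Gamma>. \<forall>y\<in>\<Gamma>. \<forall>z\<in>\<Gamma>.
    \<pi> [x, \<pi> [y, z]] - \<pi> [\<pi> [x, y], z] = \<pi> [y, \<pi> [x, z]] - \<pi> [\<pi> [y, x], z])"
    (is "?L \<longleftrightarrow> ?R")
proof
  assume 0: ?L
  show ?R
  proof (intro ballI)
    fix x y z assume "x \<in> \<Gamma>" "y \<in> \<Gamma>" "z \<in> \<Gamma>"
    let ?D = "(\<pi> [x, \<pi> [y, z]] - \<pi> [\<pi> [x, y], z]) - (\<pi> [y, \<pi> [x, z]] - \<pi> [\<pi> [y, x], z])"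
    have "(-2) *\<^sub>R ?D = 0"
      using mn_bracket_1_1[OF p \<open>x \<in> \<Gamma>\<close> \<open>y \<in> \<Gamma>\<close> \<open>z \<in> \<Gamma>\<close>] unfolding 0 zero_fun_apply by (rule sym)
    then have "?D = 0" unfolding scaleR_eq_0_iff by linarith
    then show "\<pi> [x, \<pi> [y, z]] - \<pi> [\<pi> [x, y], z] = \<pi> [y, \<pi> [x, z]] - \<pi> [\<pi> [y, x], z]"
      by (rule iffD2[OF eq_iff_diff_eq_0])
  qed
next
  assume R: ?R
  show ?L
  proof
    fix us
    show "mn_bracket \<Gamma> 1 1 \<pi> \<pi> us = 0 us"
    proof (cases "us \<in> args \<Gamma> (1 + 1 + 1)")
      case True
      then obtain a b c where u: "us = [a, b, c]" "a \<in> \<Gamma>" "b \<in> \<Gamma>" "c \<in> \<Gamma>"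
        by (auto simp: args_def numeral_3_eq_3 length_Suc_conv)
      have "(\<pi> [a, \<pi> [b, c]] - \<pi> [\<pi> [a, b], c]) - (\<pi> [b, \<pi> [a, c]] - \<pi> [\<pi> [b, a], c]) = 0"
        using R u(2-4) by simp
      then have "mn_bracket \<Gamma> 1 1 \<pi> \<pi> us = 0"
        unfolding u(1) mn_bracket_1_1[OF p u(2-4)] by (simp only: scaleR_zero_right)
      then show ?thesis by (rule trans[OF _ zero_fun_apply[symmetric]])
    next
      case False
      then have "mn_bracket \<Gamma> 1 1 \<pi> \<pi> us = 0" by (rule mn_bracket_outside)
      then show ?thesis by (rule trans[OF _ zero_fun_apply[symmetric]])
    qed
  qed
qed

text \<open>Bilinearity, the two rules for multiplication by functions and the anchor are already
  contained in \<open>\<pi>\<close> being a multiderivation with symbol \<open>\<sigma>\<close>.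
  Left symmetry is the only axiom left to the bracket.\<close>

lemma left_symmetric_algebroid_iff:
  assumes p: "\<pi> \<in> Der A E T 1" and sy: "is_symbol A E T 1 \<pi> \<sigma>"
  shows "left_symmetric_algebroid A E T (\<lambda>u v. \<pi> [u, v]) (\<lambda>x v. \<sigma> x [v]) \<longleftrightarrow> mn_bracket \<Gamma> 1 1 \<pi> \<pi> = 0"
proof -
  obtain s where sd: "section_der \<Gamma> C 1 (curry_last \<pi>) s" by (rule Der_section_der[OF p])
  note alt_op = Der_alt_op[OF p]
  have pin: "\<pi> [v, w] \<in> \<Gamma>" if "v \<in> \<Gamma>" "w \<in> \<Gamma>" for v w
    using alternatingD(3)[OF alt_opD(2)[OF alt_op that(2)], of "[v]"] that by (simp add: curry_last_def)
  have lin1: "\<pi> [a *\<^sub>R x + b *\<^sub>R y, z] = a *\<^sub>R \<pi> [x, z] + b *\<^sub>R \<pi> [y, z]" if "x \<in> \<Gamma>" "y \<in> \<Gamma>" "z \<in> \<Gamma>" for a b x y z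
    using mlinear_lin_hd[OF alternatingD(1)[OF alt_opD(2)[OF alt_op that(3)]] _ that(1,2), of "[]" a b]
    unfolding curry_last_def by simp
  have lin2: "\<pi> [z, a *\<^sub>R x + b *\<^sub>R y] = a *\<^sub>R \<pi> [z, x] + b *\<^sub>R \<pi> [z, y]" if "x \<in> \<Gamma>" "y \<in> \<Gamma>" "z \<in> \<Gamma>" for a b x y z
    using linear_op_lin[OF alt_opD(1)[OF alt_op] _ that(1,2), of "[z]" a b] that(3) unfolding curry_last_def by simp
  have f1: "\<pi> [f \<odot> x, y] = f \<odot> \<pi> [x, y]" if "f \<in> C" "x \<in> \<Gamma>" "y \<in> \<Gamma>" for f x y
    using fun_linear_hd[OF section_derD(2)[OF sd that(1,3)] _ that(2), of "[]"] unfolding curry_last_def by simp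
  have f2: "\<pi> [x, f \<odot> y] = f \<odot> \<pi> [x, y] + (\<lambda>p. \<sigma> p [x p] f) \<odot> y" if "f \<in> C" "x \<in> \<Gamma>" "y \<in> \<Gamma>" for f x y
  proof -
    have "[x] \<in> args \<Gamma> 1" using that by (simp add: args_def)
    from sy[unfolded is_symbol_def, THEN conjunct2, rule_format, OF this that(3,1)] show ?thesis by simp
  qed
  have ws: "\<sigma> \<in> wedge_hom_sections A E T 1" using sy unfolding is_symbol_def by (rule conjunct1)
  have anchor: "bundle_map_to_tangent A E T (\<lambda>x v. \<sigma> x [v])"
    unfolding bundle_map_to_tangent_def
  proof (intro conjI allI ballI impI)
    have t: "[v] \<in> args (E x) 1" if "v \<in> E x" for v x using that by (simp add: args_def)
    show "\<sigma> x [v] \<in> tangent_space A x" if "v \<in> E x" for x v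
      using ws t[OF that] unfolding wedge_hom_sections_def by simp
    show "\<sigma> x [a *\<^sub>R v + b *\<^sub>R w] = a *\<^sub>R \<sigma> x [v] + b *\<^sub>R \<sigma> x [w]" if "v \<in> E x" "w \<in> E x" for x v w a b
    proof -
      have "multilinear_on (E x) 1 (\<sigma> x)" using ws unfolding wedge_hom_sections_def by simp
      from this[unfolded multilinear_on_def, rule_format, OF t[OF that(1)] zero_less_one that, of a b]
      show ?thesis by simp
    qed
    show "smooth_vector_field_on A W (\<lambda>x. \<sigma> x [u x])" if "open W" "smooth_section_on A E T W u" for W u
    proof -
      have "[u] \<in> args {u. smooth_section_on A E T W u} 1" using that by (simp add: args_def)
      with ws that(1) have "smooth_vector_field_on A W (\<lambda>x. \<sigma> x (map (\<lambda>u. u x) [u]))"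
        unfolding wedge_hom_sections_def by blast
      then show ?thesis by simp
    qed
  qed
  show ?thesis
    unfolding mn_bracket_1_1_eq_0_iff[OF p]
  proof
    assume "left_symmetric_algebroid A E T (\<lambda>u v. \<pi> [u, v]) (\<lambda>x v. \<sigma> x [v])"
    then show "\<forall>x\<in>\<Gamma>. \<forall>y\<in>\<Gamma>. \<forall>z\<in>\<Gamma>.
       \<pi> [x, \<pi> [y, z]] - \<pi> [\<pi> [x, y], z] = \<pi> [y, \<pi> [x, z]] - \<pi> [\<pi> [y, x], z]"
      unfolding left_symmetric_algebroid_def by (elim conjE)
  next
    assume R: "\<forall>x\<in>\<Gamma>. \<forall>y\<in>\<Gamma>. \<forall>z\<in>\<Gamma>.
       \<pi> [x, \<pi> [y, z]] - \<pi> [\<pi> [x, y], z] = \<pi> [y, \<pi> [x, z]] - \<pi> [\<pi> [y, x], z]"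
    show "left_symmetric_algebroid A E T (\<lambda>u v. \<pi> [u, v]) (\<lambda>x v. \<sigma> x [v])"
      unfolding left_symmetric_algebroid_def
      by (intro conjI R ballI allI vb anchor pin lin1 lin2 f1 f2)
  qed
qed

end

theorem theorem5p6:
  fixes A :: "('m::{t2_space,second_countable_topology}, 'e::real_inner) chart set"
    and E :: "'m \<Rightarrow> 'v::real_vector set"
    and T :: "('m, 'v, 'f::real_inner) trivialization set"
  assumes "smooth_manifold A"
    and "vector_bundle A E T"
  shows "graded_lie_algebra (Der A E T) (mn_bracket (sections A E T)) \<and>
    (\<forall>\<pi>\<in>Der A E T 1. \<forall>\<sigma>. is_symbol A E T 1 \<pi> \<sigma> \<longrightarrow>
       (left_symmetric_algebroid A E T (\<lambda>u v. \<pi> [u, v]) (\<lambda>x v. \<sigma> x [v])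
          \<longleftrightarrow> mn_bracket (sections A E T) 1 1 \<pi> \<pi> = 0) \<and>
       (mn_bracket (sections A E T) 1 1 \<pi> \<pi> = 0
          \<longleftrightarrow> maurer_cartan (Der A E T) (mn_bracket (sections A E T)) \<pi>))"
proof -
  interpret vbundle A E T by unfold_locales (rule assms)+
  \<comment> \<open>A Maurer-Cartan element must have degree 1, which is given for
    \<open>\<pi>\<close>, so the last equivalence is immediate.\<close>
  show ?thesis
    unfolding maurer_cartan_def
    by (intro conjI graded_lie_algebra_Der ballI allI impI left_symmetric_algebroid_iff) blast+
qed

end
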